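(* In the errors-in-variables model described in the context, assume the following. (1) The vectors $\tilde c_i=(\tilde c_{i1},\dots,\tilde c_{i,n+d})^\top$, $i=1,2,\dots$, are independent with zero mean and finite second moments. (2) For a fixed set $J\subset\{1,\dots,n+d\}$, one has $\mathsf E\,\tilde c_{ij}^2=0$ for every $j\notin J$ and every $i\ge1$; moreover the covariance matrix of the subvector $(\tilde c_{ij},\,j\in J)$ equals $\sigma^2\Sigma_i$, $i\ge 1$, with an unknown factor $\sigma^2>0$ and known matrices $\Sigma_i$. (3) There exists $\varkappa>0$ such that $\lambda_{\min}(\Sigma_i)\ge\varkappa^2$ for every $i\ge1$. (4) $\mathrm{rank}(Z_{0J})=d$. (5) There exists $r\ge2$ with $r>d\left(|J|-\frac{d+1}{2}\right)$ such that $\sup_{i\ge1,\,j\in J}\mathsf E|\tilde c_{ij}|^{2r}<\infty$. (6) For some $\delta>0$, $\sup_{i\ge1,\,j\in J}\mathsf E|\tilde c_{ij}|^{4+2\delta}<\infty$, and for the same $\delta$, $\frac{1}{m^{1+\delta/2}}\sum_{i=1}^m\|a_{0i}\|^{2+\delta}\to0$ as $m\to\infty$. (7) $\frac1m A_0^\top A_0\to V_A$ as $m\to\infty$, where $V_A$ is a nonsingular matrix. (8) $\Sigma_i\to\Sigma_\infty$ as $i\to\infty$, for a certain matrix $\Sigma_\infty$. (9) For all $p,q,r\in J$ (not necessarily distinct) and all $i\ge1$, $\mathsf E\,\tilde c_{ip}\tilde c_{iq}\tilde c_{ir}=0$. (10) For all $p,q,r,u\in J$ (not necessarily distinct), $\frac1m\sum_{i=1}^m\mathsf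 E\,\tilde c_{ip}\tilde c_{iq}\tilde c_{ir}\tilde c_{iu}$ converges to a finite limit $\mu_4(p,q,r,u)$ as $m\to\infty$. Let $\hat X$ be the EW-TLS estimator and define $$\hat Z=\begin{pmatrix}\hat X\\-\mathrm I_d\end{pmatrix},\qquad \hat\sigma^2=\frac1d\,\mathrm{tr}\left[(\hat Z^\top\,\overline{cc^\top}\,\hat Z)(\hat Z^\top\bar S\hat Z)^{-1}\right],\qquad \hat V_A=\overline{aa^\top}-\hat\sigma^2\bar S_a,$$ where $\overline{cc^\top}=\frac1m\sum_{i=1}^mc_ic_i^\top$, $\overline{aa^\top}=\frac1m\sum_{i=1}^ma_ia_i^\top$, $\bar S=\frac1m\sum_{i=1}^mS_i$, and $\bar S_a$ is the upper-left $n\times n$ block of $\bar S$. Then, as $m\to\infty$, $\hat\sigma^2\to\sigma^2$ in probability and $\hat V_A\to V_A$ in probability.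
   Context: Model. Fix positive integers $n,d$. Let $X_0\in\mathbb R^{n\times d}$ be the true value of the matrix parameter, let $a_{0i}\in\mathbb R^n$, $i=1,2,\dots$, be nonrandom vectors, and put $b_{0i}=X_0^\top a_{0i}\in\mathbb R^d$. One observes $a_i=a_{0i}+\tilde a_i$, $b_i=b_{0i}+\tilde b_i$, where $\tilde a_i,\tilde b_i$ are random errors. Put $c_i=\begin{bmatrix}a_i\\ b_i\end{bmatrix}$ and $\tilde c_i=\begin{bmatrix}\tilde a_i\\\tilde b_i\end{bmatrix}=(\tilde c_{i1},\dots,\tilde c_{i,n+d})^\top$. For each $m$, the matrices $A,A_0,B$ have rows $a_i^\top,a_{0i}^\top,b_i^\top$, $i=1,\dots,m$, and $C=[A,B]=(c_{ij})$. Notation. $Z_0=\begin{bmatrix}X_0\\-\mathrm I_d\end{bmatrix}$, $Z=Z(X)=\begin{bmatrix}X\\-\mathrm I_d\end{bmatrix}$ for $X\in\mathbb R^{n\times d}$; $Z_{0J}$, $Z_J$ are the submatrices of $Z_0$, $Z$ formed by the rows with indices in $J$. $S_i:=\frac1{\sigma^2}\mathbf{cov}(\tilde c_i)\in\mathbb R^{(n+d)\times(n+d)}$, where $\mathbf{cov}$ denotes the covariance matrix of a random vector. EW-TLS estimator. The EW-TLS problem is to minimize $\sum_{i=1}^m\|\Sigma_i^{-1/2}\Delta c_i^J\|^2$ over $X\in\mathbb R^{n\times d}$, $\Delta A\in\mathbb R^{m\times n}$, $\Delta B\in\mathbb R^{m\times d}$, subject to $(A-\Delta A)X=B-\Delta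 B$ and $\Delta c_{ij}=0$ for $i=1,\dots,m$, $j\notin J$, where $[\Delta A,\Delta B]=(\Delta c_{ij})$ and $\Delta c_i^J=(\Delta c_{ij},\,j\in J)\in\mathbb R^{|J|}$ (column vector). The EW-TLS estimator $\hat X$ of $X_0$ is a Borel measurable mapping of the data matrix $C$ into $\mathbb R^{n\times d}\cup\{\infty\}$ which solves this problem (i.e. is the $X$-component of a minimizer) under the additional constraint $\mathrm{rank}(Z_J)=d$, if a solution exists, and $\hat X=\infty$ otherwise. Under the hypotheses $\hat X$ is finite with probability tending to one; expressions involving $\hat X$ may be given arbitrary values on the event $\{\hat X=\infty\}$. *)

theory Defs
  imports "HOL-Probability.Probability"
begin

text \<open>
  The index set \<open>{1, \<dots>, n + d}\<close> is the sum type \<open>'n + 'd\<close>: \<open>Inl\<close> indexes the part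
  \<open>a\<close> and \<open>Inr\<close> the part \<open>b\<close> of a stacked vector.  Observations are numbered
  \<open>0, 1, 2, \<dots>\<close>, so the first \<open>m\<close> of them have the indices \<open>i < m\<close>.  A matrix with
  a variable number \<open>m\<close> of rows is the family of its rows, a function on \<open>{..<m}\<close>.
\<close>

definition stack :: "real^'n \<Rightarrow> real^'d \<Rightarrow> real^('n::finite + 'd::finite)" where
  "stack a b = (\<chi> k. case k of Inl p \<Rightarrow> a $ p | Inr q \<Rightarrow> b $ q)"

definition upper :: "real^('n::finite + 'd::finite) \<Rightarrow> real^'n" where
  "upper c = (\<chi> p. c $ Inl p)"

definition lower :: "real^('n::finite + 'd::finite) \<Rightarrow> real^'d" where
  "lower c = (\<chi> q. c $ Inr q)"

definition upper_left :: "real^('n::finite + 'd::finite)^('n + 'd) \<Rightarrow> real^'n^'n" where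
  "upper_left S = (\<chi> p q. S $ Inl p $ Inl q)"

definition Zmat :: "real^'d^'n \<Rightarrow> real^'d^('n::finite + 'd::finite)" where
  "Zmat X = (\<chi> k. case k of Inl p \<Rightarrow> X $ p | Inr q \<Rightarrow> - (mat 1 $ q))"

text \<open>
  A nonempty index set \<open>J\<close> is enumerated by a bijection \<open>\<iota>\<close> from a finite type \<open>'j\<close>;
  \<open>rows_at \<iota>\<close> takes the subvector, respectively the submatrix of the rows, with indices
  in \<open>J\<close>.
\<close>

definition rows_at :: "('j \<Rightarrow> 'k) \<Rightarrow> 'a^'k \<Rightarrow> 'a^'j" where
  "rows_at \<iota> v = (\<chi> j. v $ \<iota> j)"

text \<open>\<open>outer u v = u v\<^sup>T\<close>; for \<open>A\<close> with the rows \<open>a i\<close>, \<open>i < m\<close>, the matrix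
  \<open>(1 / m) A\<^sup>T A\<close> is \<open>sample_mean m (\<lambda>i. outer (a i) (a i))\<close>.\<close>

definition outer :: "real^'k \<Rightarrow> real^'k \<Rightarrow> real^'k^'k" where
  "outer u v = (\<chi> p q. u $ p * v $ q)"

definition sample_mean :: "nat \<Rightarrow> (nat \<Rightarrow> 'a::real_vector) \<Rightarrow> 'a" where
  "sample_mean m f = (1 / real m) *\<^sub>R (\<Sum>i<m. f i)"

definition cov_matrix :: "'w measure \<Rightarrow> ('w \<Rightarrow> real^'k) \<Rightarrow> real^'k^'k" where
  "cov_matrix M Y = (\<chi> p q. \<integral>\<omega>. (Y \<omega> $ p - (\<integral>\<omega>'. Y \<omega>' $ p \<partial>M)) *
                                 (Y \<omega> $ q - (\<integral>\<omega>'. Y \<omega>' $ q \<partial>M)) \<partial>M)"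

definition lambda_min :: "real^'k^'k \<Rightarrow> real" where
  "lambda_min S = Min {l. \<exists>v. v \<noteq> 0 \<and> S *v v = l *\<^sub>R v}"

definition pos_def :: "real^'k^'k \<Rightarrow> bool" where
  "pos_def S \<longleftrightarrow> transpose S = S \<and> (\<forall>v. v \<noteq> 0 \<longrightarrow> 0 < v \<bullet> (S *v v))"

text \<open>\<open>S\<^sup>-\<^sup>1\<^sup>/\<^sup>2\<close> for positive definite \<open>S\<close>\<close>

definition inv_sqrt :: "real^'k^'k \<Rightarrow> real^'k^'k" where
  "inv_sqrt S = (THE R. pos_def R \<and> R ** R = matrix_inv S)"

text \<open>
  \<open>C\<close> is the data matrix \<open>[A, B]\<close> and \<open>D\<close> the correction \<open>[\<Delta>A, \<Delta>B]\<close>; row \<open>i\<close> of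
  the equation \<open>(A - \<Delta>A) X = B - \<Delta>B\<close> is an equation between row vectors.
\<close>

definition ewtls_feasible ::
  "('j \<Rightarrow> 'n::finite + 'd::finite) \<Rightarrow> nat \<Rightarrow> (nat \<Rightarrow> real^('n::finite + 'd::finite)) \<Rightarrow>
    real^'d^'n \<Rightarrow> (nat \<Rightarrow> real^('n::finite + 'd::finite)) \<Rightarrow> bool" where
  "ewtls_feasible \<iota> m C X D \<longleftrightarrow>
    (\<forall>i<m. upper (C i - D i) v* X = lower (C i - D i)) \<and>
    (\<forall>i<m. \<forall>k. k \<notin> range \<iota> \<longrightarrow> D i $ k = 0)"

definition ewtls_objective ::
  "('j \<Rightarrow> 'n::finite + 'd::finite) \<Rightarrow> (nat \<Rightarrow> real^'j^'j) \<Rightarrow> nat \<Rightarrow> (nat \<Rightarrow> real^('n::finite + 'd::finite)) \<Rightarrow> real" where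
  "ewtls_objective \<iota> \<Sigma> m D = (\<Sum>i<m. (norm (inv_sqrt (\<Sigma> i) *v rows_at \<iota> (D i)))\<^sup>2)"

definition ewtls_solution ::
  "('j \<Rightarrow> 'n::finite + 'd::finite) \<Rightarrow> (nat \<Rightarrow> real^'j^'j) \<Rightarrow> nat \<Rightarrow> (nat \<Rightarrow> real^('n::finite + 'd::finite)) \<Rightarrow>
    real^'d^'n \<Rightarrow> bool" where
  "ewtls_solution \<iota> \<Sigma> m C X \<longleftrightarrow>
    rank (rows_at \<iota> (Zmat X)) = CARD('d) \<and>
    (\<exists>D. ewtls_feasible \<iota> m C X D \<and>
      (\<forall>X' D'. rank (rows_at \<iota> (Zmat X')) = CARD('d) \<and> ewtls_feasible \<iota> m C X' D' \<longrightarrow>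
        ewtls_objective \<iota> \<Sigma> m D \<le> ewtls_objective \<iota> \<Sigma> m D'))"

text \<open>The value \<open>\<infinity>\<close> of an estimator is \<open>None\<close>; the space of values is the one-point
  compactification of the space of matrices with its Borel \<open>\<sigma>\<close>-algebra.\<close>

definition borel_infinity :: "'a::topological_space option measure" where
  "borel_infinity = sigma UNIV {U. openin (Alexandroff_compactification euclidean) U}"

definition ewtls_estimator ::
  "('j \<Rightarrow> 'n::finite + 'd::finite) \<Rightarrow> (nat \<Rightarrow> real^'j^'j) \<Rightarrow> nat \<Rightarrow>
    ((nat \<Rightarrow> real^('n::finite + 'd::finite)) \<Rightarrow> (real^'d^'n) option) \<Rightarrow> bool" where
  "ewtls_estimator \<iota> \<Sigma> m Xhat \<longleftrightarrow>
    Xhat \<in> (\<Pi>\<^sub>M i\<in>{..<m}. borel) \<rightarrow>\<^sub>M borel_infinity \<and>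
    (\<forall>C \<in> space (\<Pi>\<^sub>M i\<in>{..<m}. (borel :: (real^('n::finite + 'd::finite)) measure)).
      (case Xhat C of
        Some X \<Rightarrow> ewtls_solution \<iota> \<Sigma> m C X
      | None \<Rightarrow> \<not> (\<exists>X. ewtls_solution \<iota> \<Sigma> m C X)))"

definition observation ::
  "real^'d^'n \<Rightarrow> (nat \<Rightarrow> real^'n) \<Rightarrow> (nat \<Rightarrow> 'w \<Rightarrow> real^('n::finite + 'd::finite)) \<Rightarrow>
    nat \<Rightarrow> 'w \<Rightarrow> real^('n::finite + 'd::finite)" where
  "observation X0 a0 err i \<omega> = stack (a0 i) (transpose X0 *v a0 i) + err i \<omega>"

definition data_matrix :: "nat \<Rightarrow> (nat \<Rightarrow> 'w \<Rightarrow> real^'k) \<Rightarrow> 'w \<Rightarrow> nat \<Rightarrow> real^'k" where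
  "data_matrix m c \<omega> = (\<lambda>i\<in>{..<m}. c i \<omega>)"

definition S_bar ::
  "'w measure \<Rightarrow> real \<Rightarrow> (nat \<Rightarrow> 'w \<Rightarrow> real^'k) \<Rightarrow> nat \<Rightarrow> real^'k^'k" where
  "S_bar M \<sigma> err m = sample_mean m (\<lambda>i. (1 / \<sigma>\<^sup>2) *\<^sub>R cov_matrix M (err i))"

definition sigma2_formula ::
  "nat \<Rightarrow> (nat \<Rightarrow> real^('n + 'd)) \<Rightarrow> real^('n::finite + 'd::finite)^('n + 'd) \<Rightarrow> real^'d^'n \<Rightarrow> real" where
  "sigma2_formula m C S X =
    (1 / real CARD('d)) *
    trace ((transpose (Zmat X) ** sample_mean m (\<lambda>i. outer (C i) (C i)) ** Zmat X) **
           matrix_inv (transpose (Zmat X) ** S ** Zmat X))"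

definition VA_formula ::
  "nat \<Rightarrow> (nat \<Rightarrow> real^('n + 'd)) \<Rightarrow> real^('n::finite + 'd::finite)^('n + 'd) \<Rightarrow> real^'d^'n \<Rightarrow> real^'n^'n"
  where
  "VA_formula m C S X =
    sample_mean m (\<lambda>i. outer (upper (C i)) (upper (C i))) -
    sigma2_formula m C S X *\<^sub>R upper_left S"

definition tendsto_in_probability ::
  "'w measure \<Rightarrow> (nat \<Rightarrow> 'w \<Rightarrow> 'a::metric_space) \<Rightarrow> 'a \<Rightarrow> bool" where
  "tendsto_in_probability M Y y \<longleftrightarrow>
    (\<forall>\<epsilon>>0. (\<lambda>m. measure M {\<omega> \<in> space M. dist (Y m \<omega>) y > \<epsilon>}) \<longlonglongrightarrow> 0)"

end

theory Submission
  imports Defs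
begin

text \<open>
  The problem is solved by profiling out the corrections.  For fixed \<open>X\<close> with \<open>Z = Zmat X\<close> and
  \<open>Z\<^sub>J\<close> of full rank, the cheapest correction of one observation \<open>c\<close> costs the quadratic form
  \<open>(Z\<^sup>T c)\<^sup>T (Z\<^sub>J\<^sup>T \<Sigma>\<^sub>i Z\<^sub>J)\<^sup>-\<^sup>1 (Z\<^sup>T c)\<close>, so the estimator minimises the sum of these costs over \<open>X\<close>
  (\<open>ewtls_solution_iff\<close>).

  Since \<open>\<Sigma>\<^sub>i \<rightarrow> \<Sigma>\<^sub>\<infinity>\<close>, the costs lie between \<open>w\<^sub>i\<close> and \<open>w'\<^sub>i\<close> times the cost for \<open>\<Sigma>\<^sub>\<infinity>\<close>, with weights
  tending to one.  With one matrix for all \<open>i\<close> the mean cost depends on the data only through a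
  weighted second moment matrix \<open>W\<close> of the observations: it is \<open>tr (Z\<^sup>T W Z (Z\<^sub>J\<^sup>T \<Sigma>\<^sub>\<infinity> Z\<^sub>J)\<^sup>-\<^sup>1)\<close>.  By the
  weak law of large numbers \<open>W\<close> converges in probability to
  \<open>W\<^sub>\<infinity> = N\<^sup>T V\<^sub>A N + \<sigma>\<^sup>2 S\<^sub>\<infinity>\<close>, where \<open>N = [I, X\<^sub>0]\<close> and \<open>S\<^sub>\<infinity>\<close> is \<open>\<Sigma>\<^sub>\<infinity>\<close> on \<open>J \<times> J\<close> and zero elsewhere.
  As \<open>N Zmat X = X - X\<^sub>0\<close>, the limit of the mean cost at \<open>X\<close> is
  \<open>\<sigma>\<^sup>2 d + tr ((X - X\<^sub>0)\<^sup>T V\<^sub>A (X - X\<^sub>0) (Z\<^sub>J\<^sup>T \<Sigma>\<^sub>\<infinity> Z\<^sub>J)\<^sup>-\<^sup>1)\<close>, which is minimal exactly at \<open>X\<^sub>0\<close>.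

  The domain of \<open>X\<close> is not compact, and the costs may blow up where \<open>Z\<^sub>J\<close> loses rank, so a uniform
  law of large numbers is not available.  What saves the argument is that \<open>W\<^sub>\<infinity>\<close> is positive
  definite: this is where the rank of \<open>Z\<^sub>0\<^sub>J\<close> enters.  Closeness of \<open>W\<close> to \<open>W\<^sub>\<infinity>\<close> in norm
  therefore implies \<open>W \<ge> (1 - \<rho>) W\<^sub>\<infinity>\<close> in the Loewner order with a small \<open>\<rho>\<close>, and such a
  multiplicative bound survives multiplication by any inverse Gram matrix.  Consequently every \<open>X\<close>
  whose cost does not exceed that of \<open>X\<^sub>0\<close> lies in a small ball around \<open>X\<^sub>0\<close>
  (\<open>limit_cost_localises\<close>).  On this ball \<open>Z\<^sub>J\<close> has full rank and the cost is continuous, so a minimiser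
  exists, and all minimisers are in the ball (\<open>ewtls_solution_near\<close>).  Existence and consistency
  of the estimator thus come out of the same deterministic statement.

  The two estimates are continuous functions of \<open>W\<close> with unit weights, of the mean error covariance
  and of \<open>X\<close>, with the values \<open>\<sigma>\<^sup>2\<close> and \<open>V\<^sub>A\<close> at the limit point (\<open>formulas_near\<close>).  Hence they are
  within any prescribed distance of the limits as soon as three weighted moment matrices are close enough
  to \<open>W\<^sub>\<infinity>\<close>, and this has probability tending to one.
\<close>

section \<open>Symmetric matrices: eigenvalues and square roots\<close>

lemma symmetric_matrix_inner:
  fixes A :: "real^'k^'k"
  assumes "transpose A = A"
  shows "x \<bullet> (A *v y) = (A *v x) \<bullet> y"
  by (metis assms dot_lmul_matrix vector_transpose_matrix)

lemma transpose_matrix_inner: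
  fixes A :: "real^'k^'l"
  shows "x \<bullet> (A *v y) = (transpose A *v x) \<bullet> y"
  by (metis dot_lmul_matrix transpose_matrix_vector)

text \<open>
  A minimiser \<open>e\<close> of the Rayleigh quotient on the unit sphere of \<open>S\<close> is an eigenvector: for
  the residual \<open>g = A e - \<mu> e\<close> the nonnegative form \<open>x \<bullet> A x - \<mu> |x|\<^sup>2\<close> vanishes at \<open>e\<close>, and its
  expansion at \<open>e + t g\<close> has the linear term \<open>2 t |g|\<^sup>2\<close>, which must vanish as well.  Working inside an
  invariant subspace allows induction on the dimension.
\<close>

lemma rayleigh_minimum_on_invariant_subspace:
  fixes A :: "real^'k^'k"
  assumes sym: "transpose A = A" and S: "subspace S" "S \<noteq> {0}"
    and inv: "\<And>x. x \<in> S \<Longrightarrow> A *v x \<in> S"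
  obtains \<mu> e where "e \<in> S" "norm e = 1" "A *v e = \<mu> *\<^sub>R e"
    "\<And>x. x \<in> S \<Longrightarrow> \<mu> * (norm x)\<^sup>2 \<le> x \<bullet> (A *v x)"
proof -
  obtain x0 where x0: "x0 \<in> S" "x0 \<noteq> 0"
    using S subspace_0 by blast
  have "compact (S \<inter> sphere 0 1)"
    using closed_subspace[OF S(1)] by (simp add: closed_Int_compact)
  moreover have "x0 /\<^sub>R norm x0 \<in> S \<inter> sphere 0 1"
    using x0 S(1) by (simp add: subspace_scale)
  moreover have "continuous_on (S \<inter> sphere 0 1) (\<lambda>x. x \<bullet> (A *v x))"
    by (intro continuous_intros matrix_vector_mult_linear_continuous_on)
  ultimately obtain e where e: "e \<in> S \<inter> sphere 0 1"
    and emin: "\<And>y. y \<in> S \<inter> sphere 0 1 \<Longrightarrow> e \<bullet> (A *v e) \<le> y \<bullet> (A *v y)"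
    using continuous_attains_inf[of "S \<inter> sphere 0 1" "\<lambda>x. x \<bullet> (A *v x)"] by blast
  define \<mu> where "\<mu> = e \<bullet> (A *v e)"
  have low: "\<mu> * (norm x)\<^sup>2 \<le> x \<bullet> (A *v x)" if "x \<in> S" for x
  proof (cases "x = 0")
    case False
    have "x /\<^sub>R norm x \<in> S \<inter> sphere 0 1"
      using that False S(1) by (simp add: subspace_scale)
    from emin[OF this] have "\<mu> \<le> (x \<bullet> (A *v x)) / (norm x)\<^sup>2"
      by (simp add: \<mu>_def matrix_vector_mult_scaleR power2_eq_square divide_inverse ac_simps)
    then show ?thesis
      using False by (simp add: pos_le_divide_eq)
  qed simp
  define g where "g = A *v e - \<mu> *\<^sub>R e"
  define c where "c = g \<bullet> (A *v g) - \<mu> * (norm g)\<^sup>2"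
  have eS: "e \<in> S" "norm e = 1" using e by auto
  have gS: "g \<in> S"
    unfolding g_def using eS inv S(1) by (intro subspace_diff subspace_scale) auto
  have c0: "c \<ge> 0" using low[OF gS] by (simp add: c_def)
  have ee: "e \<bullet> e = 1" using eS(2) by (simp add: norm_eq_1)
  have gg: "(norm g)\<^sup>2 = g \<bullet> (A *v e) - \<mu> * (g \<bullet> e)"
    by (subst power2_norm_eq_inner, subst (2) g_def) (simp add: inner_diff_right)
  have eAg: "e \<bullet> (A *v g) = g \<bullet> (A *v e)"
    using symmetric_matrix_inner[OF sym, of e g] by (simp add: inner_commute)
  have quad: "0 \<le> 2 * t * (norm g)\<^sup>2 + t\<^sup>2 * c" for t
  proof -
    have "e + t *\<^sub>R g \<in> S" using eS gS S(1) by (intro subspace_add subspace_scale) auto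
    from low[OF this]
    have "\<mu> * ((e + t *\<^sub>R g) \<bullet> (e + t *\<^sub>R g)) \<le> (e + t *\<^sub>R g) \<bullet> (A *v (e + t *\<^sub>R g))"
      by (simp add: power2_norm_eq_inner)
    also have "(e + t *\<^sub>R g) \<bullet> (A *v (e + t *\<^sub>R g))
        = \<mu> + 2 * t * (g \<bullet> (A *v e)) + t\<^sup>2 * (g \<bullet> (A *v g))"
      by (simp add: matrix_vector_right_distrib matrix_vector_mult_scaleR inner_add_left
          inner_add_right eAg \<mu>_def power2_eq_square algebra_simps)
    also have "\<mu> * ((e + t *\<^sub>R g) \<bullet> (e + t *\<^sub>R g))
        = \<mu> + 2 * t * \<mu> * (g \<bullet> e) + t\<^sup>2 * \<mu> * (norm g)\<^sup>2"
      by (simp add: inner_add_left inner_add_right ee inner_commute[of e g] dot_square_norm[of g]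
          power2_eq_square distrib_left mult.assoc mult.left_commute)
    finally show ?thesis unfolding gg c_def by argo
  qed
  have "(norm g)\<^sup>2 = 0"
  proof (rule ccontr)
    assume "(norm g)\<^sup>2 \<noteq> 0"
    then have n: "(norm g)\<^sup>2 > 0" by simp
    \<comment> \<open>At \<open>t = - s\<close> the linear term of the expansion beats the quadratic one.\<close>
    define s where "s = (norm g)\<^sup>2 / (c + 1)"
    have s0: "s > 0" using n c0 by (simp add: s_def)
    have "0 \<le> s * (s * c - 2 * (norm g)\<^sup>2)"
      using quad[of "- s"] by (simp add: power2_eq_square algebra_simps)
    then have "2 * (norm g)\<^sup>2 \<le> s * c"
      using s0 by (simp add: zero_le_mult_iff)
    moreover have "s * (c + 1) = (norm g)\<^sup>2" using c0 by (simp add: s_def)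
    ultimately have "2 * (norm g)\<^sup>2 \<le> (norm g)\<^sup>2 - s" by (simp add: algebra_simps)
    then show False using n s0 by linarith
  qed
  then have "A *v e = \<mu> *\<^sub>R e" by (simp add: g_def)
  with eS low that show thesis by blast
qed

lemma rayleigh_minimum:
  fixes A :: "real^'k^'k"
  assumes "transpose A = A"
  obtains \<mu> e where "norm e = 1" "A *v e = \<mu> *\<^sub>R e" "\<And>x. \<mu> * (norm x)\<^sup>2 \<le> x \<bullet> (A *v x)"
proof -
  have "axis undefined 1 \<noteq> (0::real^'k)" by (simp add: axis_eq_0_iff)
  then have "UNIV \<noteq> {0::real^'k}" by blast
  then show thesis
    using rayleigh_minimum_on_invariant_subspace[OF assms subspace_UNIV] that by (metis UNIV_I)
qed

text \<open>
  The spectral theorem.  The orthogonal complement of an eigenvector inside \<open>S\<close> is again invariant and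
  has smaller dimension.
\<close>

lemma orthonormal_eigenbasis:
  fixes A :: "real^'k^'k"
  assumes sym: "transpose A = A" and S: "subspace S"
    and inv: "\<And>x. x \<in> S \<Longrightarrow> A *v x \<in> S"
  shows "\<exists>B \<subseteq> S. pairwise orthogonal B \<and> (\<forall>b\<in>B. norm b = 1 \<and> (\<exists>l. A *v b = l *\<^sub>R b)) \<and> span B = S"
  using S inv
proof (induction "dim S" arbitrary: S rule: less_induct)
  case less
  show ?case
  proof (cases "S = {0}")
    case True
    then show ?thesis by (intro exI[of _ "{}"]) auto
  next
    case False
    from rayleigh_minimum_on_invariant_subspace[OF sym less.prems(1) False less.prems(2)]
    obtain \<mu> e where e: "e \<in> S" "norm e = 1" "A *v e = \<mu> *\<^sub>R e" by metis
    define S' where "S' = {x \<in> S. e \<bullet> x = 0}"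
    have sub: "subspace S'"
      using less.prems(1) unfolding S'_def subspace_def by (auto simp: inner_add_right)
    have ee: "e \<bullet> e = 1" using e(2) by (simp add: norm_eq_1)
    have "e \<notin> S'" "S' \<subseteq> S" using ee unfolding S'_def by auto
    then have "S' \<subset> S" using e(1) by blast
    then have "dim S' < dim S"
      using dim_psubset[of S' S] span_eq_iff[THEN iffD2, OF sub] span_eq_iff[THEN iffD2, OF less.prems(1)] by simp
    moreover have "A *v x \<in> S'" if "x \<in> S'" for x
      using that less.prems(2) e(3) symmetric_matrix_inner[OF sym, of e x] unfolding S'_def
      by auto
    ultimately obtain B where B: "B \<subseteq> S'" "pairwise orthogonal B"
      "\<forall>b\<in>B. norm b = 1 \<and> (\<exists>l. A *v b = l *\<^sub>R b)" "span B = S'"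
      using less.hyps[OF _ sub] by blast
    have "span (insert e B) = S"
    proof
      show "span (insert e B) \<subseteq> S"
        using B(1) e(1) less.prems(1) unfolding S'_def by (intro span_minimal) auto
      show "S \<subseteq> span (insert e B)"
      proof
        fix x assume x: "x \<in> S"
        have "x - (e \<bullet> x) *\<^sub>R e \<in> S'"
          using x e(1) less.prems(1) ee unfolding S'_def
          by (simp add: subspace_diff subspace_scale inner_diff_right)
        then have "x - (e \<bullet> x) *\<^sub>R e \<in> span B" using B(4) by simp
        then show "x \<in> span (insert e B)" using span_breakdown_eq by blast
      qed
    qed
    moreover have "pairwise orthogonal (insert e B)"
      using B(1,2) unfolding pairwise_insert S'_def by (auto simp: orthogonal_def inner_commute)
    ultimately show ?thesis
      using B(1,3) e unfolding S'_def by (intro exI[of _ "insert e B"]) auto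
  qed
qed

lemma pos_def_imp_invertible:
  assumes "pos_def A" shows "invertible A"
proof -
  have "x = 0" if "A *v x = 0" for x
    using assms that unfolding pos_def_def by (metis inner_zero_right less_irrefl)
  then show ?thesis
    using matrix_left_invertible_ker invertible_left_inverse by blast
qed

lemma matrix_inv_right: "invertible (A::real^'k^'k) \<Longrightarrow> A ** matrix_inv A = mat 1"
  and matrix_inv_left: "invertible (A::real^'k^'k) \<Longrightarrow> matrix_inv A ** A = mat 1"
  unfolding matrix_inv_def invertible_def by (metis (mono_tags, lifting) someI_ex)+

lemma matrix_inv_eqI: "(A::real^'k^'k) ** B = mat 1 \<Longrightarrow> matrix_inv A = B"
  by (metis invertible_def matrix_inv_left matrix_left_right_inverse matrix_mul_assoc matrix_mul_lid
      matrix_mul_rid)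

lemma pos_def_matrix_inv:
  fixes A :: "real^'k^'k"
  assumes "pos_def A" shows "pos_def (matrix_inv A)"
proof -
  have inv: "invertible A" using assms by (rule pos_def_imp_invertible)
  have sym: "transpose A = A" using assms by (simp add: pos_def_def)
  have "A ** transpose (matrix_inv A) = mat 1"
    by (metis inv matrix_inv_left matrix_transpose_mul sym transpose_mat)
  then have s: "transpose (matrix_inv A) = matrix_inv A"
    using matrix_inv_eqI by metis
  moreover have "0 < v \<bullet> (matrix_inv A *v v)" if "v \<noteq> 0" for v
  proof -
    let ?y = "matrix_inv A *v v"
    have y: "A *v ?y = v" by (simp add: matrix_vector_mul_assoc matrix_inv_right[OF inv])
    then have "?y \<noteq> 0" using that by force
    then have "0 < ?y \<bullet> (A *v ?y)" using assms unfolding pos_def_def by blast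
    then show ?thesis unfolding y by (simp add: inner_commute)
  qed
  ultimately show ?thesis by (simp add: pos_def_def)
qed

lemma pos_def_sqrt_exists:
  fixes A :: "real^'k^'k"
  assumes A: "pos_def A"
  shows "\<exists>R. pos_def R \<and> R ** R = A"
proof -
  have sym: "transpose A = A" using A by (simp add: pos_def_def)
  obtain B where B: "pairwise orthogonal B" "span B = UNIV"
    and eig: "\<And>b. b \<in> B \<Longrightarrow> norm b = 1" "\<And>b. b \<in> B \<Longrightarrow> \<exists>l. A *v b = l *\<^sub>R b"
    using orthonormal_eigenbasis[OF sym subspace_UNIV] by auto
  define l where "l b = b \<bullet> (A *v b)" for b
  have l: "A *v b = l b *\<^sub>R b" if b: "b \<in> B" for b
    using eig[OF b] by (auto simp: l_def norm_eq_1)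
  have nz: "0 \<notin> B" using eig(1) by force
  have fin: "finite B"
    using B(1) by (rule pairwise_orthogonal_imp_finite)
  have lpos: "l b > 0" if "b \<in> B" for b
    using A that nz unfolding pos_def_def l_def by metis
  have ortho: "b \<bullet> b' = (if b = b' then 1 else 0)" if "b \<in> B" "b' \<in> B" for b b'
    using that B(1) eig(1)[OF that(1)] unfolding pairwise_def orthogonal_def
    by (auto simp: norm_eq_1)
  define R where "R = (\<Sum>b\<in>B. sqrt (l b) *\<^sub>R outer b b)"
  have outer_mult: "outer b b *v x = (b \<bullet> x) *\<^sub>R b" for b x :: "real^'k"
    by (simp add: vec_eq_iff outer_def matrix_vector_mult_def inner_vec_def sum_distrib_left
        sum_distrib_right ac_simps)
  have Rx: "R *v x = (\<Sum>b\<in>B. (sqrt (l b) * (b \<bullet> x)) *\<^sub>R b)" for x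
    unfolding R_def
    by (induction B rule: infinite_finite_induct)
       (simp_all add: matrix_vector_mult_add_rdistrib outer_mult flip: scaleR_matrix_vector_assoc)
  have "transpose R = R"
    unfolding R_def transpose_def outer_def
    by (simp add: vec_eq_iff mult.commute)
  moreover have "0 < v \<bullet> (R *v v)" if "v \<noteq> 0" for v
  proof -
    have eq: "v \<bullet> (R *v v) = (\<Sum>b\<in>B. sqrt (l b) * (b \<bullet> v)\<^sup>2)"
      unfolding Rx by (simp add: inner_sum_right power2_eq_square inner_commute mult.assoc)
    have "\<exists>b\<in>B. b \<bullet> v \<noteq> 0"
    proof (rule ccontr)
      assume "\<not> ?thesis"
      then have "orthogonal v b" if "b \<in> B" for b
        using that by (simp add: orthogonal_def inner_commute)
      then have "orthogonal v v"
        using B(2) orthogonal_to_span[of v B v] by auto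
      with \<open>v \<noteq> 0\<close> show False by (simp add: orthogonal_def)
    qed
    then obtain b where b: "b \<in> B" "b \<bullet> v \<noteq> 0" by blast
    show ?thesis
      unfolding eq using b lpos fin
      by (intro sum_pos2[of B b]) (auto simp: less_imp_le)
  qed
  moreover have "R ** R = A"
  proof -
    have Rb: "R *v b = sqrt (l b) *\<^sub>R b" if "b \<in> B" for b
    proof -
      have "R *v b = (\<Sum>b'\<in>B. if b' = b then sqrt (l b) *\<^sub>R b else 0)"
        unfolding Rx using that by (intro sum.cong) (auto simp: ortho)
      then show ?thesis using that fin by simp
    qed
    have "(R ** R) *v x = A *v x" for x
    proof (rule linear_eq_on_span[of "(*v) (R ** R)" "(*v) A" B])
      fix b assume b: "b \<in> B"
      show "(R ** R) *v b = A *v b"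
        using lpos[OF b] by (simp add: matrix_vector_mul_assoc[symmetric] Rb[OF b] l[OF b]
            matrix_vector_mult_scaleR)
    qed (use B(2) in \<open>auto\<close>)
    then show ?thesis by (simp add: matrix_eq)
  qed
  ultimately show ?thesis by (auto simp: pos_def_def)
qed

lemma symmetric_matrix_eq_0I:
  fixes A :: "real^'k^'k"
  assumes sym: "transpose A = A" and z: "\<And>x. x \<bullet> (A *v x) = 0"
  shows "A = 0"
proof -
  have "A *v x = 0" for x
  proof -
    have "2 * (y \<bullet> (A *v x)) = 0" for y
      using z[of "x + y"] z[of x] z[of y] symmetric_matrix_inner[OF sym, of x y]
      by (simp add: matrix_vector_right_distrib inner_add_left inner_add_right inner_commute)
    from this[of "A *v x"] show ?thesis by simp
  qed
  then show ?thesis by (simp add: matrix_eq)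
qed

lemma symmetric_matrix_eq_0_if_eigenvalues_0:
  fixes A :: "real^'k^'k"
  assumes sym: "transpose A = A" and eig: "\<And>e \<mu>. e \<noteq> 0 \<Longrightarrow> A *v e = \<mu> *\<^sub>R e \<Longrightarrow> \<mu> = 0"
  shows "A = 0"
proof -
  obtain \<mu> e where 1: "norm e = 1" "A *v e = \<mu> *\<^sub>R e" "\<And>x. \<mu> * (norm x)\<^sup>2 \<le> x \<bullet> (A *v x)"
    using rayleigh_minimum[OF sym] by metis
  have symm: "transpose (- A) = - A" using sym by (simp add: transpose_def vec_eq_iff)
  obtain \<nu> f where 2: "norm f = 1" "(- A) *v f = \<nu> *\<^sub>R f" "\<And>x. \<nu> * (norm x)\<^sup>2 \<le> x \<bullet> ((- A) *v x)"
    using rayleigh_minimum[OF symm] by metis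
  have neg: "(- A) *v x = - (A *v x)" for x
    by (simp add: vec_eq_iff matrix_vector_mult_def sum_negf)
  have "e \<noteq> 0" "f \<noteq> 0" using 1(1) 2(1) by auto
  then have "\<mu> = 0" "f \<noteq> 0" using 1(2) eig by auto
  moreover have "A *v f = (- \<nu>) *\<^sub>R f" using 2(2) neg[of f] by (metis minus_minus scaleR_minus_left)
  then have "\<nu> = 0" using \<open>f \<noteq> 0\<close> eig[of f "- \<nu>"] by simp
  ultimately have "x \<bullet> (A *v x) = 0" for x
    using 1(3)[of x] 2(3)[of x] by (simp add: neg)
  then show ?thesis by (rule symmetric_matrix_eq_0I[OF sym])
qed

text \<open>
  If \<open>e\<close> is an eigenvector of \<open>R - Q\<close> for \<open>\<mu>\<close>, comparing \<open>|R e|\<close> with \<open>|Q e|\<close> gives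
  \<open>\<mu> (e \<bullet> R e + e \<bullet> Q e) = 0\<close>.  So \<open>R - Q\<close> has no eigenvalue but zero, without any appeal to
  commuting matrices.
\<close>

lemma pos_def_sqrt_unique:
  fixes R Q :: "real^'k^'k"
  assumes R: "pos_def R" and Q: "pos_def Q" and eq: "R ** R = Q ** Q"
  shows "R = Q"
proof -
  have sym: "transpose R = R" "transpose Q = Q" using R Q by (auto simp: pos_def_def)
  have symD: "transpose (R - Q) = R - Q"
    using sym by (simp add: transpose_def vec_eq_iff)
  have "R - Q = 0"
  proof (rule symmetric_matrix_eq_0_if_eigenvalues_0[OF symD])
    fix e \<mu> assume e: "e \<noteq> 0" and ev: "(R - Q) *v e = \<mu> *\<^sub>R e"
    have Re: "R *v e = Q *v e + \<mu> *\<^sub>R e"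
      using ev by (simp add: matrix_vector_mult_diff_rdistrib algebra_simps)
    have "(R *v e) \<bullet> (R *v e) = (Q *v e) \<bullet> (Q *v e)"
      using eq symmetric_matrix_inner[OF sym(1), of e "R *v e"]
        symmetric_matrix_inner[OF sym(2), of e "Q *v e"]
      by (simp add: matrix_vector_mul_assoc)
    then have "\<mu> * (e \<bullet> (R *v e) + e \<bullet> (Q *v e)) = 0"
      unfolding Re by (simp add: inner_add_left inner_add_right inner_commute algebra_simps)
    moreover have "e \<bullet> (R *v e) + e \<bullet> (Q *v e) > 0"
      using R Q e by (auto simp: pos_def_def intro: add_pos_pos)
    ultimately show "\<mu> = 0" by auto
  qed
  then show ?thesis by simp
qed

text \<open>
  The weighted norm of the optimisation problem is the quadratic form of \<open>S\<^sup>-\<^sup>1\<close>; existence and uniqueness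
  of the square root make the definite description in \<open>inv_sqrt\<close> meaningful.
\<close>

lemma norm_inv_sqrt:
  fixes S :: "real^'k^'k"
  assumes S: "pos_def S"
  shows "(norm (inv_sqrt S *v x))\<^sup>2 = x \<bullet> (matrix_inv S *v x)"
proof -
  have "\<exists>!R. pos_def R \<and> R ** R = matrix_inv S"
    using pos_def_sqrt_exists[OF pos_def_matrix_inv[OF S]] pos_def_sqrt_unique by metis
  from theI'[OF this] have R: "pos_def (inv_sqrt S)" "inv_sqrt S ** inv_sqrt S = matrix_inv S"
    unfolding inv_sqrt_def by auto
  have "transpose (inv_sqrt S) = inv_sqrt S" using R(1) by (simp add: pos_def_def)
  from symmetric_matrix_inner[OF this, of x "inv_sqrt S *v x"] show ?thesis
    by (simp add: power2_norm_eq_inner matrix_vector_mul_assoc R(2))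
qed

text \<open>
  Eigenvectors for distinct eigenvalues are orthogonal, and a pairwise orthogonal set is finite.  Without
  finiteness the minimum in \<open>lambda_min\<close> would say nothing.
\<close>

lemma finite_eigenvalues:
  fixes A :: "real^'k^'k"
  assumes sym: "transpose A = A"
  shows "finite {l. \<exists>v. v \<noteq> 0 \<and> A *v v = l *\<^sub>R v}" (is "finite ?E")
proof -
  define f where "f l = (SOME v. v \<noteq> 0 \<and> A *v v = l *\<^sub>R v)" for l
  have f: "f l \<noteq> 0" "A *v f l = l *\<^sub>R f l" if "l \<in> ?E" for l
    using someI_ex[of "\<lambda>v. v \<noteq> 0 \<and> A *v v = l *\<^sub>R v"] that unfolding f_def by auto
  have orth: "f l \<bullet> f k = 0" if "l \<in> ?E" "k \<in> ?E" "l \<noteq> k" for l k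
  proof -
    have "k * (f l \<bullet> f k) = l * (f l \<bullet> f k)"
      using symmetric_matrix_inner[OF sym, of "f l" "f k"] f(2)[OF that(1)] f(2)[OF that(2)] by simp
    then show ?thesis using that(3) by simp
  qed
  have "inj_on f ?E"
  proof (rule inj_onI, rule ccontr)
    fix l k assume lk: "l \<in> ?E" "k \<in> ?E" "f l = f k" "l \<noteq> k"
    then have "f l \<bullet> f l = 0" using orth[OF lk(1,2,4)] by simp
    with f(1)[OF lk(1)] show False by simp
  qed
  moreover have "pairwise orthogonal (f ` ?E)"
    unfolding pairwise_def orthogonal_def using orth by blast
  then have "finite (f ` ?E)"
    by (rule pairwise_orthogonal_imp_finite)
  ultimately show ?thesis using finite_imageD by blast
qed

lemma lambda_min_le_quadratic_form:
  fixes A :: "real^'k^'k"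
  assumes sym: "transpose A = A"
  shows "lambda_min A * (norm x)\<^sup>2 \<le> x \<bullet> (A *v x)"
proof -
  obtain \<mu> e where 1: "norm e = 1" "A *v e = \<mu> *\<^sub>R e" "\<And>x. \<mu> * (norm x)\<^sup>2 \<le> x \<bullet> (A *v x)"
    using rayleigh_minimum[OF sym] by metis
  then have "\<mu> \<in> {l. \<exists>v. v \<noteq> 0 \<and> A *v v = l *\<^sub>R v}" by (auto intro!: exI[of _ e])
  then have "lambda_min A \<le> \<mu>"
    unfolding lambda_min_def using finite_eigenvalues[OF sym] by (intro Min_le)
  then have "lambda_min A * (norm x)\<^sup>2 \<le> \<mu> * (norm x)\<^sup>2" by (intro mult_right_mono) auto
  with 1(3)[of x] show ?thesis by linarith
qed

lemma pos_def_lower_bound: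
  fixes A :: "real^'k^'k"
  assumes A: "pos_def A"
  obtains p where "p > 0" "\<And>x. p * (norm x)\<^sup>2 \<le> x \<bullet> (A *v x)"
proof -
  have sym: "transpose A = A" using A by (simp add: pos_def_def)
  obtain \<mu> e where 1: "norm e = 1" "A *v e = \<mu> *\<^sub>R e" "\<And>x. \<mu> * (norm x)\<^sup>2 \<le> x \<bullet> (A *v x)"
    using rayleigh_minimum[OF sym] by metis
  have "e \<noteq> 0" using 1(1) by auto
  then have "e \<bullet> (A *v e) > 0" using A unfolding pos_def_def by blast
  then have "\<mu> > 0" using 1(1,2) by (simp add: norm_eq_1)
  with 1(3) that show thesis by blast
qed

lemma pos_defI_lower_bound:
  fixes A :: "real^'k^'k"
  assumes "transpose A = A" "p > 0" "\<And>x. p * (norm x)\<^sup>2 \<le> x \<bullet> (A *v x)"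
  shows "pos_def A"
  unfolding pos_def_def
proof (intro conjI allI impI)
  fix v :: "real^'k" assume "v \<noteq> 0"
  then have "0 < p * (norm v)\<^sup>2" using assms(2) by simp
  also have "\<dots> \<le> v \<bullet> (A *v v)" by (rule assms(3))
  finally show "0 < v \<bullet> (A *v v)" .
qed (rule assms(1))

lemma pos_def_if_semidefinite_invertible:
  fixes A :: "real^'k^'k"
  assumes sym: "transpose A = A" and psd: "\<And>x. 0 \<le> x \<bullet> (A *v x)" and inv: "invertible A"
  shows "pos_def A"
proof -
  obtain \<mu> e where 1: "norm e = 1" "A *v e = \<mu> *\<^sub>R e" "\<And>x. \<mu> * (norm x)\<^sup>2 \<le> x \<bullet> (A *v x)"
    using rayleigh_minimum[OF sym] by metis
  have "\<mu> \<ge> 0" using psd[of e] 1(1,2) by (simp add: norm_eq_1)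
  moreover have "\<mu> \<noteq> 0"
  proof
    assume "\<mu> = 0"
    then have "A *v e = 0" using 1(2) by simp
    then have "e = 0" using inv matrix_left_invertible_ker invertible_left_inverse by blast
    with 1(1) show False by simp
  qed
  ultimately show ?thesis using 1(3) sym by (intro pos_defI_lower_bound[of A \<mu>]) auto
qed

section \<open>Norm bounds and limits of matrix expressions\<close>

lemma norm_matrix_vector_mult_le:
  fixes A :: "real^'k^'l"
  shows "norm (A *v x) \<le> norm A * norm x"
proof -
  have "(norm (A *v x))\<^sup>2 = (\<Sum>i\<in>UNIV. (A $ i \<bullet> x)\<^sup>2)"
    unfolding norm_vec_def L2_set_def matrix_vector_mul_component
    by (simp add: sum_nonneg)
  also have "\<dots> \<le> (\<Sum>i\<in>UNIV. (norm (A $ i))\<^sup>2 * (norm x)\<^sup>2)"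
    by (intro sum_mono) (simp add: Cauchy_Schwarz_ineq power2_norm_eq_inner)
  also have "\<dots> = (norm A * norm x)\<^sup>2"
    by (simp add: norm_vec_def[of A] L2_set_def sum_nonneg power_mult_distrib sum_distrib_right)
  finally show ?thesis by (rule power2_le_imp_le) simp
qed

lemma abs_quadratic_form_le:
  fixes A :: "real^'k^'k"
  shows "\<bar>x \<bullet> (A *v x)\<bar> \<le> norm A * (norm x)\<^sup>2"
proof -
  have "\<bar>x \<bullet> (A *v x)\<bar> \<le> norm x * norm (A *v x)" by (rule Cauchy_Schwarz_ineq2)
  also have "\<dots> \<le> norm x * (norm A * norm x)"
    by (intro mult_left_mono norm_matrix_vector_mult_le) simp
  finally show ?thesis by (simp add: power2_eq_square ac_simps)
qed

lemma tendsto_matrix_mult: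
  fixes f :: "'z \<Rightarrow> real^'k^'l" and g :: "'z \<Rightarrow> real^'m^'k"
  assumes "(f \<longlongrightarrow> a) F" "(g \<longlongrightarrow> b) F"
  shows "((\<lambda>z. f z ** g z) \<longlongrightarrow> a ** b) F"
  unfolding matrix_matrix_mult_def
  by (intro vec_tendstoI)
     (simp, intro tendsto_sum tendsto_mult tendsto_vec_nth[OF tendsto_vec_nth[OF assms(1)]]
       tendsto_vec_nth[OF tendsto_vec_nth[OF assms(2)]])

lemma tendsto_matrix_vector_mult:
  fixes f :: "'z \<Rightarrow> real^'k^'l" and g :: "'z \<Rightarrow> real^'k"
  assumes "(f \<longlongrightarrow> a) F" "(g \<longlongrightarrow> b) F"
  shows "((\<lambda>z. f z *v g z) \<longlongrightarrow> a *v b) F"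
  unfolding matrix_vector_mult_def
  by (intro vec_tendstoI)
     (simp, intro tendsto_sum tendsto_mult tendsto_vec_nth[OF tendsto_vec_nth[OF assms(1)]]
       tendsto_vec_nth[OF assms(2)])

lemma tendsto_transpose:
  fixes f :: "'z \<Rightarrow> real^'k^'l"
  assumes "(f \<longlongrightarrow> a) F"
  shows "((\<lambda>z. transpose (f z)) \<longlongrightarrow> transpose a) F"
  unfolding transpose_def
  by (intro vec_tendstoI) (simp add: tendsto_vec_nth[OF tendsto_vec_nth[OF assms]])

lemma tendsto_trace:
  fixes f :: "'z \<Rightarrow> real^'k^'k"
  assumes "(f \<longlongrightarrow> a) F"
  shows "((\<lambda>z. trace (f z)) \<longlongrightarrow> trace a) F"
  unfolding trace_def by (intro tendsto_sum tendsto_vec_nth[OF tendsto_vec_nth[OF assms]])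

lemma tendsto_det:
  fixes f :: "'z \<Rightarrow> real^'k^'k"
  assumes "\<And>i j. ((\<lambda>z. f z $ i $ j) \<longlongrightarrow> a $ i $ j) F"
  shows "((\<lambda>z. det (f z)) \<longlongrightarrow> det a) F"
  unfolding det_def by (intro tendsto_sum tendsto_mult tendsto_prod; (rule tendsto_const | rule assms))

text \<open>
  Cramer's rule turns the entries of the inverse into quotients of polynomials in the entries of \<open>A\<close>,
  which is what makes inversion continuous.
\<close>

lemma matrix_inv_cramer:
  fixes A :: "real^'k^'k"
  assumes "det A \<noteq> 0"
  shows "matrix_inv A $ k $ l = det (\<chi> i j. if j = k then mat 1 $ i $ l else A $ i $ j) / det A"
proof -
  have inv: "invertible A" using assms by (simp add: invertible_det_nz)
  have "A ** matrix_inv A = mat 1" using inv by (rule matrix_inv_right)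
  then have "A *v column l (matrix_inv A) = column l (mat 1)"
    by (simp add: matrix_vector_mult_basis[symmetric] matrix_vector_mul_assoc)
  then have "column l (matrix_inv A) =
      (\<chi> k. det (\<chi> i j. if j = k then column l (mat 1) $ i else A $ i $ j) / det A)"
    unfolding cramer[OF assms] .
  then have "column l (matrix_inv A) $ k =
      det (\<chi> i j. if j = k then column l (mat 1) $ i else A $ i $ j) / det A"
    by simp
  then show ?thesis by (simp only: column_def vec_lambda_beta)
qed

lemma tendsto_matrix_inv:
  fixes f :: "'z \<Rightarrow> real^'k^'k"
  assumes f: "(f \<longlongrightarrow> a) F" and inv: "invertible a"
  shows "((\<lambda>z. matrix_inv (f z)) \<longlongrightarrow> matrix_inv a) F"
proof -
  have comp: "((\<lambda>z. f z $ i $ j) \<longlongrightarrow> a $ i $ j) F" for i j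
    by (rule tendsto_vec_nth[OF tendsto_vec_nth[OF f]])
  have nz: "det a \<noteq> 0" using inv by (simp add: invertible_det_nz)
  have d: "((\<lambda>z. det (f z)) \<longlongrightarrow> det a) F" by (intro tendsto_det comp)
  have "((\<lambda>z. matrix_inv (f z) $ k $ l) \<longlongrightarrow> matrix_inv a $ k $ l) F" for k l
  proof -
    have "((\<lambda>z. det (\<chi> i j. if j = k then mat 1 $ i $ l else f z $ i $ j) / det (f z))
        \<longlongrightarrow> det (\<chi> i j. if j = k then mat 1 $ i $ l else a $ i $ j) / det a) F"
    proof (intro tendsto_divide d nz tendsto_det)
      fix i j
      show "((\<lambda>z. (\<chi> i j. if j = k then mat 1 $ i $ l else f z $ i $ j) $ i $ j)
          \<longlongrightarrow> (\<chi> i j. if j = k then mat 1 $ i $ l else a $ i $ j) $ i $ j) F"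
        by (cases "j = k") (simp_all add: comp)
    qed
    moreover have "\<forall>\<^sub>F z in F. det (\<chi> i j. if j = k then mat 1 $ i $ l else f z $ i $ j) / det (f z)
        = matrix_inv (f z) $ k $ l"
      using tendsto_imp_eventually_ne[OF d nz] by eventually_elim (simp add: matrix_inv_cramer)
    ultimately show ?thesis
      unfolding matrix_inv_cramer[OF nz] by (rule Lim_transform_eventually)
  qed
  then show ?thesis by (intro vec_tendstoI)
qed

section \<open>The cost of the cheapest correction\<close>

text \<open>
  Products with a transposed matrix are kept as they stand, so that \<open>matrix_mul_assoc\<close> and
  \<open>matrix_transpose_mul\<close> apply to them.
\<close>

declare transpose_matrix_vector [simp del]

lemma transpose_scaleR: "transpose (c *\<^sub>R A) = c *\<^sub>R transpose (A::real^'k^'l)"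
  and transpose_add: "transpose (A + B) = transpose A + transpose (B::real^'k^'l)"
  by (simp_all add: transpose_def vec_eq_iff)

lemma matrix_scaleR_left: "(c *\<^sub>R A) ** B = c *\<^sub>R (A ** (B::real^'k^'l))"
  for A :: "real^'l^'m"
  by (simp add: scalar_matrix_assoc)

lemma matrix_scaleR_right: "A ** (c *\<^sub>R B) = c *\<^sub>R (A ** B)"
  for A :: "real^'l^'m" and B :: "real^'k^'l"
  by (simp add: matrix_matrix_mult_def vec_eq_iff sum_distrib_left ac_simps)

lemma matrix_add_rdistrib: "(A + B) ** C = A ** C + B ** C"
  for A B :: "real^'l^'m" and C :: "real^'k^'l"
  by (simp add: matrix_matrix_mult_def vec_eq_iff sum.distrib distrib_right)

lemma quadratic_form_congruence:
  fixes S :: "real^'j^'j" and Y :: "real^'d^'j"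
  shows "x \<bullet> ((transpose Y ** S ** Y) *v x) = (Y *v x) \<bullet> (S *v (Y *v x))"
proof -
  have "x \<bullet> ((transpose Y ** S ** Y) *v x) = x \<bullet> (transpose Y *v (S *v (Y *v x)))"
    by (simp add: matrix_vector_mul_assoc matrix_mul_assoc)
  then show ?thesis by (simp add: transpose_matrix_inner)
qed

lemma trace_congruence:
  fixes W :: "real^'k^'k" and U :: "real^'d^'k"
  shows "trace (transpose U ** W ** U) = (\<Sum>q\<in>UNIV. column q U \<bullet> (W *v column q U))"
proof -
  have "(transpose U ** W ** U) $ q $ q = column q U \<bullet> (W *v column q U)" for q
  proof -
    have "(transpose U ** W ** U) $ q $ q = axis q 1 \<bullet> ((transpose U ** W ** U) *v axis q 1)"
      by (simp only: inner_axis' matrix_vector_mult_basis column_def vec_lambda_beta) simp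
    also have "\<dots> = (U *v axis q 1) \<bullet> (W *v (U *v axis q 1))"
      by (rule quadratic_form_congruence)
    finally show ?thesis by (simp add: matrix_vector_mult_basis)
  qed
  then show ?thesis by (simp add: trace_def)
qed

lemma gram_pos_def:
  fixes S :: "real^'j^'j" and Y :: "real^'d^'j"
  assumes S: "pos_def S" and Y: "rank Y = CARD('d)"
  shows "pos_def (transpose Y ** S ** Y)"
proof -
  have sym: "transpose S = S" using S by (simp add: pos_def_def)
  have "inj ((*v) Y)" using Y full_rank_injective by blast
  then have "Y *v v \<noteq> 0" if "v \<noteq> 0" for v
    using that by (metis injD matrix_vector_mult_0_right)
  then show ?thesis
    using S sym unfolding pos_def_def quadratic_form_congruence
    by (simp add: matrix_transpose_mul matrix_mul_assoc)
qed

text \<open>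
  The squared length, in the metric \<open>S\<^sup>-\<^sup>1\<close>, of the shortest vector \<open>x\<close> with \<open>Y\<^sup>T x = z\<close>.
\<close>

definition min_correction_cost :: "real^'j^'j \<Rightarrow> real^'d^'j \<Rightarrow> real^'d \<Rightarrow> real" where
  "min_correction_cost S Y z = z \<bullet> (matrix_inv (transpose Y ** S ** Y) *v z)"

text \<open>
  With \<open>x = S y\<close> and \<open>g = (Y\<^sup>T S Y)\<^sup>-\<^sup>1 Y\<^sup>T x\<close>, the vector \<open>Y g\<close> is the \<open>S\<close>-orthogonal projection of \<open>y\<close>
  to the column space of \<open>Y\<close>, and the difference of the two sides is the \<open>S\<close>-length of \<open>y - Y g\<close>.
\<close>

lemma min_correction_cost_le:
  fixes S :: "real^'j^'j" and Y :: "real^'d^'j"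
  assumes S: "pos_def S" and Y: "rank Y = CARD('d)"
  shows "min_correction_cost S Y (transpose Y *v x) \<le> x \<bullet> (matrix_inv S *v x)"
proof -
  let ?G = "transpose Y ** S ** Y"
  define y where "y = matrix_inv S *v x"
  define z where "z = transpose Y *v x"
  define g where "g = matrix_inv ?G *v z"
  have sym: "transpose S = S" using S by (simp add: pos_def_def)
  have x: "S *v y = x"
    by (simp add: y_def matrix_vector_mul_assoc matrix_inv_right pos_def_imp_invertible S)
  have Gg: "?G *v g = z"
    using pos_def_imp_invertible[OF gram_pos_def[OF S Y]]
    by (simp add: g_def matrix_vector_mul_assoc matrix_inv_right)
  have gGg: "(Y *v g) \<bullet> (S *v (Y *v g)) = z \<bullet> g"
    using Gg by (metis quadratic_form_congruence inner_commute)
  have xg: "x \<bullet> (Y *v g) = z \<bullet> g"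
    by (simp add: z_def transpose_matrix_inner)
  have "0 \<le> (y - Y *v g) \<bullet> (S *v (y - Y *v g))"
    using S unfolding pos_def_def by (metis inner_zero_left less_imp_le order_refl)
  also have "\<dots> = y \<bullet> x - 2 * (x \<bullet> (Y *v g)) + (Y *v g) \<bullet> (S *v (Y *v g))"
    using symmetric_matrix_inner[OF sym, of y "Y *v g"]
    by (simp add: matrix_vector_mult_diff_distrib inner_diff_left inner_diff_right x inner_commute)
  also have "\<dots> = y \<bullet> x - z \<bullet> g" by (simp add: gGg xg)
  finally show ?thesis
    by (simp add: min_correction_cost_def y_def[symmetric] z_def[symmetric] g_def[symmetric] inner_commute)
qed

text \<open>
  Equality holds for \<open>x = S Y (Y\<^sup>T S Y)\<^sup>-\<^sup>1 z\<close>.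
\<close>

lemma min_correction_cost_attained:
  fixes S :: "real^'j^'j" and Y :: "real^'d^'j"
  assumes S: "pos_def S" and Y: "rank Y = CARD('d)"
  obtains x where "transpose Y *v x = z" "x \<bullet> (matrix_inv S *v x) = min_correction_cost S Y z"
proof -
  let ?G = "transpose Y ** S ** Y"
  define g where "g = matrix_inv ?G *v z"
  define x where "x = S *v (Y *v g)"
  have Gg: "?G *v g = z"
    using pos_def_imp_invertible[OF gram_pos_def[OF S Y]]
    by (simp add: g_def matrix_vector_mul_assoc matrix_inv_right)
  have 1: "transpose Y *v x = z"
    using Gg by (simp add: x_def matrix_vector_mul_assoc matrix_mul_assoc)
  have "matrix_inv S *v x = Y *v g"
    using pos_def_imp_invertible[OF S]
    by (simp add: x_def matrix_vector_mul_assoc matrix_inv_left matrix_mul_assoc)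
  then have "x \<bullet> (matrix_inv S *v x) = z \<bullet> g"
    using 1 transpose_matrix_inner[of x Y g] by simp
  with 1 show thesis using that by (simp add: min_correction_cost_def g_def)
qed

text \<open>
  The 0-1 matrix that takes the subvector with indices in the range of \<open>\<iota>\<close>; it turns \<open>rows_at\<close> into
  a matrix product.
\<close>

definition selection :: "('j::finite \<Rightarrow> 'k::finite) \<Rightarrow> real^'k^'j" where
  "selection \<iota> = rows_at \<iota> (mat 1)"

lemma rows_at_eq_selection_mult: "rows_at \<iota> Z = selection \<iota> ** (Z::real^'d^'k::finite)"
  by (simp add: rows_at_def selection_def matrix_matrix_mult_def vec_eq_iff mat_def if_distrib
      if_distribR cong: if_cong)

lemma rows_at_eq_selection_vector_mult: "rows_at \<iota> v = selection \<iota> *v (v::real^'k::finite)"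
  by (simp add: rows_at_def selection_def matrix_vector_mult_def vec_eq_iff mat_def if_distrib
      if_distribR cong: if_cong)

lemma transpose_selection_mult:
  fixes x :: "real^'j::finite" and \<iota> :: "'j \<Rightarrow> 'k::finite"
  shows "(transpose (selection \<iota>) *v x) $ k = (\<Sum>j\<in>UNIV. if \<iota> j = k then x $ j else 0)"
  unfolding selection_def rows_at_def transpose_def matrix_vector_mult_def mat_def
  by (auto intro!: sum.cong)

lemma selection_transpose_selection:
  fixes x :: "real^'j::finite"
  assumes "inj \<iota>"
  shows "selection \<iota> *v (transpose (selection \<iota>) *v x) = x"
  unfolding rows_at_eq_selection_vector_mult[symmetric]
  by (simp add: rows_at_def transpose_selection_mult vec_eq_iff inj_eq[OF assms])

lemma supported_vector_eq:
  fixes v :: "real^'k::finite" and \<iota> :: "'j::finite \<Rightarrow> 'k"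
  assumes inj: "inj \<iota>" and v: "\<And>k. k \<notin> range \<iota> \<Longrightarrow> v $ k = 0"
  shows "v = transpose (selection \<iota>) *v rows_at \<iota> v"
proof -
  have eq: "v $ k = (\<Sum>j\<in>UNIV. if \<iota> j = k then v $ \<iota> j else 0)" for k
  proof (cases "k \<in> range \<iota>")
    case True
    then obtain j where "k = \<iota> j" by blast
    then show ?thesis by (simp add: inj_eq[OF inj])
  next
    case False
    then have "(\<Sum>j\<in>UNIV. if \<iota> j = k then v $ \<iota> j else 0) = 0"
      by (intro sum.neutral) auto
    then show ?thesis using v[OF False] by simp
  qed
  show ?thesis
    unfolding vec_eq_iff transpose_selection_mult rows_at_def vec_lambda_beta using eq by blast
qed

lemma sum_UNIV_Plus:
  fixes f :: "'n::finite + 'd::finite \<Rightarrow> 'a::comm_monoid_add"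
  shows "(\<Sum>k\<in>UNIV. f k) = (\<Sum>p\<in>UNIV. f (Inl p)) + (\<Sum>q\<in>UNIV. f (Inr q))"
  by (simp flip: UNIV_Plus_UNIV add: sum.Plus comp_def)

lemma vec_Plus_eqI:
  fixes u v :: "real^('n::finite + 'd::finite)"
  assumes "upper u = upper v" "lower u = lower v"
  shows "u = v"
  unfolding vec_eq_iff
proof
  fix k show "u $ k = v $ k"
    using assms by (cases k) (auto simp: upper_def lower_def vec_eq_iff)
qed

text \<open>
  The EW-TLS constraint \<open>(a - \<Delta>a)\<^sup>T X = (b - \<Delta>b)\<^sup>T\<close> on one observation is a linear equation with the
  matrix \<open>Z\<^sup>T\<close>.
\<close>

lemma transpose_Zmat_mult: "transpose (Zmat X) *v v = upper v v* X - lower v"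
proof -
  have "(\<Sum>k\<in>UNIV. Zmat X $ k $ q * v $ k) = (\<Sum>p\<in>UNIV. X $ p $ q * upper v $ p) - lower v $ q" for q
    by (simp add: sum_UNIV_Plus Zmat_def upper_def lower_def mat_def sum_negf if_distrib if_distribR
        cong: if_cong)
  then show ?thesis
    by (simp add: vec_eq_iff matrix_vector_mult_def vector_matrix_mult_def transpose_def mult.commute)
qed

lemma upper_Zmat_mult: "upper (Zmat X *v t) = X *v t"
  and lower_Zmat_mult: "lower (Zmat X *v t) = - t"
  by (simp_all add: upper_def lower_def Zmat_def vec_eq_iff matrix_vector_mult_def mat_def sum_negf
      if_distrib if_distribR cong: if_cong)

lemma ewtls_feasible_iff:
  "ewtls_feasible \<iota> m C X D \<longleftrightarrow>
    (\<forall>i<m. transpose (Zmat X) *v D i = transpose (Zmat X) *v C i) \<and>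
    (\<forall>i<m. \<forall>k. k \<notin> range \<iota> \<longrightarrow> D i $ k = 0)"
proof -
  have "upper (c - e) v* X = lower (c - e) \<longleftrightarrow> transpose (Zmat X) *v e = transpose (Zmat X) *v c"
    for c e
  proof -
    have "upper (c - e) v* X = lower (c - e) \<longleftrightarrow> transpose (Zmat X) *v (c - e) = 0"
      by (simp add: transpose_Zmat_mult)
    then show ?thesis by (auto simp: matrix_vector_mult_diff_distrib)
  qed
  then show ?thesis unfolding ewtls_feasible_def by simp
qed

text \<open>
  The objective function after the corrections have been minimised out.
\<close>

definition profile_objective ::
  "('j::finite \<Rightarrow> 'n::finite + 'd::finite) \<Rightarrow> (nat \<Rightarrow> real^'j^'j) \<Rightarrow> nat \<Rightarrow>
    (nat \<Rightarrow> real^('n + 'd)) \<Rightarrow> real^'d^'n \<Rightarrow> real" where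
  "profile_objective \<iota> \<Sigma> m C X =
    (\<Sum>i<m. min_correction_cost (\<Sigma> i) (rows_at \<iota> (Zmat X)) (transpose (Zmat X) *v C i))"

lemma transpose_rows_at_mult:
  fixes Z :: "real^'d^'k::finite" and \<iota> :: "'j::finite \<Rightarrow> 'k"
  assumes "inj \<iota>" "\<And>k. k \<notin> range \<iota> \<Longrightarrow> v $ k = 0"
  shows "transpose (rows_at \<iota> Z) *v rows_at \<iota> v = transpose Z *v v"
proof -
  have "transpose Z *v v = transpose Z *v (transpose (selection \<iota>) *v rows_at \<iota> v)"
    by (subst supported_vector_eq[OF assms]) simp_all
  then show ?thesis
    by (simp add: rows_at_eq_selection_mult matrix_transpose_mul matrix_vector_mul_assoc)
qed

lemma profile_objective_le:
  fixes \<iota> :: "'j::finite \<Rightarrow> 'n::finite + 'd::finite"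
  assumes \<iota>: "inj \<iota>" and \<Sigma>: "\<And>i. pos_def (\<Sigma> i)"
    and X: "rank (rows_at \<iota> (Zmat X)) = CARD('d)" and D: "ewtls_feasible \<iota> m C X D"
  shows "profile_objective \<iota> \<Sigma> m C X \<le> ewtls_objective \<iota> \<Sigma> m D"
  unfolding profile_objective_def ewtls_objective_def
proof (rule sum_mono)
  fix i assume "i \<in> {..<m}"
  then have i: "transpose (Zmat X) *v D i = transpose (Zmat X) *v C i"
    and z: "\<And>k. k \<notin> range \<iota> \<Longrightarrow> D i $ k = 0"
    using D by (auto simp: ewtls_feasible_iff)
  have "transpose (rows_at \<iota> (Zmat X)) *v rows_at \<iota> (D i) = transpose (Zmat X) *v C i"
    using transpose_rows_at_mult[OF \<iota> z, where Z="Zmat X"] i by simp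
  then show "min_correction_cost (\<Sigma> i) (rows_at \<iota> (Zmat X)) (transpose (Zmat X) *v C i)
      \<le> (norm (inv_sqrt (\<Sigma> i) *v rows_at \<iota> (D i)))\<^sup>2"
    using min_correction_cost_le[OF \<Sigma>[of i] X, of "rows_at \<iota> (D i)"]
    unfolding norm_inv_sqrt[OF \<Sigma>[of i]] by simp
qed

lemma profile_objective_attained:
  fixes \<iota> :: "'j::finite \<Rightarrow> 'n::finite + 'd::finite"
  assumes \<iota>: "inj \<iota>" and \<Sigma>: "\<And>i. pos_def (\<Sigma> i)"
    and X: "rank (rows_at \<iota> (Zmat X)) = CARD('d)"
  obtains D where "ewtls_feasible \<iota> m C X D"
    "ewtls_objective \<iota> \<Sigma> m D = profile_objective \<iota> \<Sigma> m C X"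
proof -
  have "\<exists>x. transpose (rows_at \<iota> (Zmat X)) *v x = transpose (Zmat X) *v C i \<and>
      x \<bullet> (matrix_inv (\<Sigma> i) *v x) =
        min_correction_cost (\<Sigma> i) (rows_at \<iota> (Zmat X)) (transpose (Zmat X) *v C i)" for i
    by (rule min_correction_cost_attained[OF \<Sigma>[of i] X, of "transpose (Zmat X) *v C i"]) blast
  then obtain x where
    x: "\<And>i. transpose (rows_at \<iota> (Zmat X)) *v x i = transpose (Zmat X) *v C i"
       "\<And>i. x i \<bullet> (matrix_inv (\<Sigma> i) *v x i) =
        min_correction_cost (\<Sigma> i) (rows_at \<iota> (Zmat X)) (transpose (Zmat X) *v C i)"
    by metis
  define D where "D i = transpose (selection \<iota>) *v x i" for i
  have Dx: "rows_at \<iota> (D i) = x i" for i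
    by (simp add: D_def rows_at_eq_selection_vector_mult selection_transpose_selection[OF \<iota>])
  have D0: "D i $ k = 0" if "k \<notin> range \<iota>" for i k
    using that unfolding D_def transpose_selection_mult by (intro sum.neutral) auto
  have "transpose (Zmat X) *v D i = transpose (Zmat X) *v C i" for i
    using transpose_rows_at_mult[OF \<iota>, of "D i" "Zmat X"] D0 x(1)[of i] by (simp add: Dx)
  then have "ewtls_feasible \<iota> m C X D" by (auto simp: ewtls_feasible_iff D0)
  moreover have "ewtls_objective \<iota> \<Sigma> m D = profile_objective \<iota> \<Sigma> m C X"
    by (simp add: ewtls_objective_def profile_objective_def norm_inv_sqrt[OF \<Sigma>] Dx x(2))
  ultimately show thesis by (rule that)
qed

text \<open>
  The minimisation over \<open>X\<close> and the corrections together becomes a minimisation over \<open>X\<close> alone.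
\<close>

lemma ewtls_solution_iff:
  fixes \<iota> :: "'j::finite \<Rightarrow> 'n::finite + 'd::finite"
  assumes \<iota>: "inj \<iota>" and \<Sigma>: "\<And>i. pos_def (\<Sigma> i)"
  shows "ewtls_solution \<iota> \<Sigma> m C X \<longleftrightarrow> rank (rows_at \<iota> (Zmat X)) = CARD('d) \<and>
    (\<forall>X'. rank (rows_at \<iota> (Zmat X')) = CARD('d) \<longrightarrow>
      profile_objective \<iota> \<Sigma> m C X \<le> profile_objective \<iota> \<Sigma> m C X')"
    (is "?L \<longleftrightarrow> ?R")
proof
  assume L: ?L
  then have X: "rank (rows_at \<iota> (Zmat X)) = CARD('d)"
    unfolding ewtls_solution_def by (rule conjunct1)
  from L have "\<exists>D. ewtls_feasible \<iota> m C X D \<and>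
      (\<forall>X' D'. rank (rows_at \<iota> (Zmat X')) = CARD('d) \<and> ewtls_feasible \<iota> m C X' D' \<longrightarrow>
        ewtls_objective \<iota> \<Sigma> m D \<le> ewtls_objective \<iota> \<Sigma> m D')"
    unfolding ewtls_solution_def by (rule conjunct2)
  then obtain D where D: "ewtls_feasible \<iota> m C X D"
    and opt: "\<And>X' D'. rank (rows_at \<iota> (Zmat X')) = CARD('d) \<Longrightarrow> ewtls_feasible \<iota> m C X' D' \<Longrightarrow>
      ewtls_objective \<iota> \<Sigma> m D \<le> ewtls_objective \<iota> \<Sigma> m D'"
    by (elim exE conjE) simp
  have "profile_objective \<iota> \<Sigma> m C X \<le> profile_objective \<iota> \<Sigma> m C X'"
    if X': "rank (rows_at \<iota> (Zmat X')) = CARD('d)" for X'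
  proof -
    obtain D' where D': "ewtls_feasible \<iota> m C X' D'"
      "ewtls_objective \<iota> \<Sigma> m D' = profile_objective \<iota> \<Sigma> m C X'"
      by (rule profile_objective_attained[where \<Sigma>=\<Sigma>, OF \<iota> \<Sigma> X'])
    show ?thesis
      using profile_objective_le[where \<Sigma>=\<Sigma>, OF \<iota> \<Sigma> X D] opt[OF X' D'(1)] D'(2) by linarith
  qed
  then show ?R using X by simp
next
  assume R: ?R
  then have X: "rank (rows_at \<iota> (Zmat X)) = CARD('d)" by simp
  obtain D where D: "ewtls_feasible \<iota> m C X D"
      "ewtls_objective \<iota> \<Sigma> m D = profile_objective \<iota> \<Sigma> m C X"
    by (rule profile_objective_attained[where \<Sigma>=\<Sigma>, OF \<iota> \<Sigma> X])
  have "ewtls_objective \<iota> \<Sigma> m D \<le> ewtls_objective \<iota> \<Sigma> m D'"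
    if X': "rank (rows_at \<iota> (Zmat X')) = CARD('d)" and D': "ewtls_feasible \<iota> m C X' D'" for X' D'
  proof -
    have "profile_objective \<iota> \<Sigma> m C X \<le> profile_objective \<iota> \<Sigma> m C X'"
      using R X' by simp
    then show ?thesis using D(2) profile_objective_le[where \<Sigma>=\<Sigma>, OF \<iota> \<Sigma> X' D'] by linarith
  qed
  then show ?L
    unfolding ewtls_solution_def using X D(1) by (intro conjI exI[of _ D]) auto
qed

lemma outer_vector_mult: "outer u v *v x = (v \<bullet> x) *\<^sub>R u"
  by (simp add: vec_eq_iff outer_def matrix_vector_mult_def inner_vec_def sum_distrib_left
      sum_distrib_right ac_simps)

lemma matrix_vector_mult_sum_left:
  fixes A :: "'i \<Rightarrow> real^'k^'l"
  shows "(\<Sum>i\<in>I. A i) *v x = (\<Sum>i\<in>I. A i *v x)"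
  by (induction I rule: infinite_finite_induct) (simp_all add: matrix_vector_mult_add_rdistrib)

definition weighted_second_moment :: "(nat \<Rightarrow> real) \<Rightarrow> nat \<Rightarrow> (nat \<Rightarrow> real^'k) \<Rightarrow> real^'k^'k" where
  "weighted_second_moment w m C = sample_mean m (\<lambda>i. w i *\<^sub>R outer (C i) (C i))"

lemma quadratic_form_weighted_second_moment:
  "u \<bullet> (weighted_second_moment w m C *v u) = (\<Sum>i<m. w i * (u \<bullet> C i)\<^sup>2) / real m"
  by (simp add: weighted_second_moment_def sample_mean_def matrix_vector_mult_sum_left outer_vector_mult inner_sum_right
      power2_eq_square inner_commute mult.assoc flip: scaleR_matrix_vector_assoc)

text \<open>
  With \<open>W\<close> the second moment matrix of the observations and one matrix \<open>S\<close> for all of them, this is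
  the mean correction cost at \<open>X\<close> (\<open>limit_cost_weighted_second_moment\<close> below).
\<close>

definition limit_cost :: "('j::finite \<Rightarrow> 'n::finite + 'd::finite) \<Rightarrow> real^'j^'j \<Rightarrow>
    real^('n + 'd)^('n + 'd) \<Rightarrow> real^'d^'n \<Rightarrow> real" where
  "limit_cost \<iota> S W X = trace ((transpose (Zmat X) ** W ** Zmat X) **
     matrix_inv (transpose (rows_at \<iota> (Zmat X)) ** S ** rows_at \<iota> (Zmat X)))"

text \<open>
  The symmetric square root \<open>T\<close> of the inverse Gram matrix makes the columns of \<open>Y T\<close> orthonormal for
  \<open>S\<close>.  It moves the inverse out of traces and costs: both become sums over the columns of \<open>Z T\<close>.
\<close>

lemma orthonormalisation:
  fixes Y :: "real^'d^'j" and S :: "real^'j^'j"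
  assumes S: "pos_def S" and Y: "rank Y = CARD('d)"
  obtains T where "invertible T" "transpose T = T" "T ** T = matrix_inv (transpose Y ** S ** Y)"
    "transpose (Y ** T) ** S ** (Y ** T) = mat 1"
proof -
  let ?G = "transpose Y ** S ** Y"
  have G: "pos_def ?G" by (rule gram_pos_def[OF S Y])
  obtain T where T: "pos_def T" "T ** T = matrix_inv ?G"
    using pos_def_sqrt_exists[OF pos_def_matrix_inv[OF G]] by blast
  have inv: "invertible T" and sym: "transpose T = T"
    using T(1) pos_def_imp_invertible by (auto simp: pos_def_def)
  have "T ** (T ** ?G) = mat 1"
    using matrix_inv_left[OF pos_def_imp_invertible[OF G]] T(2) by (simp add: matrix_mul_assoc)
  then have "T ** ?G ** T = mat 1"
    using matrix_left_right_inverse by blast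
  then have "transpose (Y ** T) ** S ** (Y ** T) = mat 1"
    by (simp add: matrix_transpose_mul sym matrix_mul_assoc)
  with inv sym T(2) show thesis by (rule that)
qed

lemma trace_mat_1: "trace (mat 1 :: real^'d^'d) = real CARD('d)"
  by (simp add: trace_def mat_def)

lemma limit_cost_orthonormalised:
  assumes "T ** T = matrix_inv (transpose (rows_at \<iota> (Zmat X)) ** S ** rows_at \<iota> (Zmat X))"
    "transpose T = T"
  shows "limit_cost \<iota> S W X = trace (transpose (Zmat X ** T) ** W ** (Zmat X ** T))"
proof -
  let ?A = "transpose (Zmat X) ** W ** Zmat X"
  have "limit_cost \<iota> S W X = trace ((?A ** T) ** T)"
    unfolding limit_cost_def assms(1)[symmetric] by (simp add: matrix_mul_assoc)
  also have "\<dots> = trace (T ** (?A ** T))" by (rule trace_mul_sym)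
  finally show ?thesis
    by (simp add: matrix_transpose_mul assms(2) matrix_mul_assoc)
qed

lemma min_correction_cost_orthonormalised:
  assumes "T ** T = matrix_inv (transpose Y ** S ** Y)" "transpose T = T"
  shows "min_correction_cost S Y (transpose Z *v c) = (\<Sum>q\<in>UNIV. (column q (Z ** T) \<bullet> c)\<^sup>2)"
proof -
  have "min_correction_cost S Y (transpose Z *v c)
      = (T *v (transpose Z *v c)) \<bullet> (T *v (transpose Z *v c))"
    unfolding min_correction_cost_def assms(1)[symmetric]
    using symmetric_matrix_inner[OF assms(2), of "transpose Z *v c" "T *v (transpose Z *v c)"]
    by (simp add: matrix_vector_mul_assoc matrix_mul_assoc)
  also have "T *v (transpose Z *v c) = transpose (Z ** T) *v c"
    by (simp add: matrix_vector_mul_assoc matrix_transpose_mul assms(2))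
  also have "\<dots> \<bullet> \<dots> = (\<Sum>q\<in>UNIV. ((transpose (Z ** T) *v c) $ q)\<^sup>2)"
    by (simp add: inner_vec_def power2_eq_square)
  also have "\<dots> = (\<Sum>q\<in>UNIV. (column q (Z ** T) \<bullet> c)\<^sup>2)"
    by (simp add: matrix_vector_mul_component row_transpose column_def transpose_def inner_commute
        cong: sum.cong)
  finally show ?thesis .
qed

lemma limit_cost_weighted_second_moment:
  fixes \<iota> :: "'j::finite \<Rightarrow> 'n::finite + 'd::finite"
  assumes S: "pos_def S" and X: "rank (rows_at \<iota> (Zmat X)) = CARD('d)"
  shows "limit_cost \<iota> S (weighted_second_moment w m C) X =
    (\<Sum>i<m. w i * min_correction_cost S (rows_at \<iota> (Zmat X)) (transpose (Zmat X) *v C i)) / real m"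
proof -
  obtain T where T: "transpose T = T"
    "T ** T = matrix_inv (transpose (rows_at \<iota> (Zmat X)) ** S ** rows_at \<iota> (Zmat X))"
    using orthonormalisation[OF S X] by metis
  show ?thesis
    unfolding limit_cost_orthonormalised[OF T(2,1)] min_correction_cost_orthonormalised[OF T(2,1)]
      trace_congruence quadratic_form_weighted_second_moment
      sum_distrib_left sum_divide_distrib
    by (rule sum.swap)
qed

section \<open>The limit problem\<close>

text \<open>
  The matrix \<open>N = [I, X\<^sub>0]\<close>.  Its transpose maps \<open>a\<close> to the noiseless observation, and
  \<open>N Zmat X = X - X\<^sub>0\<close>.
\<close>

definition regression_map :: "real^'d^'n \<Rightarrow> real^('n::finite + 'd::finite)^'n" where
  "regression_map X0 = (\<chi> p k. case k of Inl p' \<Rightarrow> mat 1 $ p $ p' | Inr q \<Rightarrow> X0 $ p $ q)"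

lemma regression_map_mult: "regression_map X0 *v v = upper v + X0 *v lower v"
  by (simp add: regression_map_def vec_eq_iff matrix_vector_mult_def sum_UNIV_Plus upper_def
      lower_def mat_def if_distrib if_distribR cong: if_cong)

lemma transpose_regression_map_mult:
  "transpose (regression_map X0) *v a = stack a (transpose X0 *v a)"
  by (rule vec_Plus_eqI)
     (simp_all add: regression_map_def vec_eq_iff matrix_vector_mult_def transpose_def stack_def
      upper_def lower_def mat_def if_distrib if_distribR cong: if_cong)

lemma regression_map_Zmat: "regression_map X0 ** Zmat X = X - X0"
proof -
  have "(regression_map X0 ** Zmat X) *v t = (X - X0) *v t" for t
  proof -
    have "regression_map X0 *v (Zmat X *v t) = X *v t - X0 *v t"
      unfolding regression_map_mult upper_Zmat_mult lower_Zmat_mult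
      by (simp add: vec_eq_iff matrix_vector_mult_def sum_negf)
    then show ?thesis by (simp add: matrix_vector_mul_assoc matrix_vector_mult_diff_rdistrib)
  qed
  then show ?thesis by (simp add: matrix_eq)
qed

lemma norm_sq_sum_columns: "(norm A)\<^sup>2 = (\<Sum>q\<in>UNIV. (norm (column q A))\<^sup>2)"
  for A :: "real^'d^'k"
proof -
  have "(norm A)\<^sup>2 = (\<Sum>p\<in>UNIV. \<Sum>q\<in>UNIV. (A $ p $ q)\<^sup>2)"
    by (simp add: norm_vec_def L2_set_def sum_nonneg)
  also have "\<dots> = (\<Sum>q\<in>UNIV. \<Sum>p\<in>UNIV. (A $ p $ q)\<^sup>2)" by (rule sum.swap)
  also have "\<dots> = (\<Sum>q\<in>UNIV. (norm (column q A))\<^sup>2)"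
    by (simp add: norm_vec_def L2_set_def sum_nonneg column_def)
  finally show ?thesis .
qed

lemma norm_Zmat_mult:
  fixes X :: "real^'d^'n::finite"
  shows "(norm (Zmat X *v t))\<^sup>2 = (norm (X *v t))\<^sup>2 + (norm t)\<^sup>2"
proof -
  have "v \<bullet> v = upper v \<bullet> upper v + lower v \<bullet> lower v" for v :: "real^('n + 'd)"
    by (simp add: inner_vec_def sum_UNIV_Plus upper_def lower_def)
  from this[of "Zmat X *v t"] show ?thesis
    by (simp add: power2_norm_eq_inner upper_Zmat_mult lower_Zmat_mult)
qed

lemma column_matrix_mult: "column q (A ** B) = A *v column q B"
  for A :: "real^'k^'l" and B :: "real^'d^'k"
  by (simp add: vec_eq_iff column_def matrix_matrix_mult_def matrix_vector_mult_def)

lemma tendsto_Zmat: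
  fixes f :: "'z \<Rightarrow> real^'d^'n::finite"
  assumes "(f \<longlongrightarrow> X) F"
  shows "((\<lambda>z. Zmat (f z) :: real^'d^('n + 'd::finite)) \<longlongrightarrow> Zmat X) F"
proof (rule vec_tendstoI)
  fix k :: "'n + 'd"
  show "((\<lambda>z. Zmat (f z) $ k) \<longlongrightarrow> Zmat X $ k) F"
    by (cases k) (simp_all add: Zmat_def tendsto_vec_nth[OF assms])
qed

lemma tendsto_upper_left:
  assumes "(f \<longlongrightarrow> W) F"
  shows "((\<lambda>z. upper_left (f z)) \<longlongrightarrow> upper_left W) F"
  unfolding upper_left_def
  by (intro vec_tendstoI) (simp add: tendsto_vec_nth[OF tendsto_vec_nth[OF assms]])

lemma tendsto_rows_at_Zmat:
  fixes f :: "'z \<Rightarrow> real^'d^'n::finite" and \<iota> :: "'j::finite \<Rightarrow> 'n + 'd::finite"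
  assumes "(f \<longlongrightarrow> X) F"
  shows "((\<lambda>z. rows_at \<iota> (Zmat (f z))) \<longlongrightarrow> rows_at \<iota> (Zmat X)) F"
  unfolding rows_at_eq_selection_mult
  by (intro tendsto_matrix_mult tendsto_const tendsto_Zmat assms)

lemma rank_eq_if_gram_invertible:
  fixes Y :: "real^'d^'j" and S :: "real^'j^'j"
  assumes "invertible (transpose Y ** S ** Y)"
  shows "rank Y = CARD('d)"
proof -
  obtain B where "B ** (transpose Y ** S ** Y) = mat 1"
    using assms invertible_def by blast
  then have "(B ** transpose Y ** S) ** Y = mat 1" by (simp add: matrix_mul_assoc)
  then have "x = y" if "Y *v x = Y *v y" for x y
    by (metis that matrix_vector_mul_assoc matrix_vector_mul_lid)
  then have "inj ((*v) Y)" by (simp add: inj_def)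
  then show ?thesis using full_rank_injective by blast
qed

text \<open>
  The cost is a minimum of quadratic forms in \<open>S\<^sup>-\<^sup>1\<close>, so a multiplicative comparison of the inverses
  passes to the costs.
\<close>

lemma min_correction_cost_lower_comparison:
  fixes S S' :: "real^'j^'j" and Y :: "real^'d^'j"
  assumes S: "pos_def S" "pos_def S'" and Y: "rank Y = CARD('d)"
    and w: "0 \<le> w" "\<And>x. w * (x \<bullet> (matrix_inv S *v x)) \<le> x \<bullet> (matrix_inv S' *v x)"
  shows "w * min_correction_cost S Y z \<le> min_correction_cost S' Y z"
proof -
  obtain x where x: "transpose Y *v x = z" "x \<bullet> (matrix_inv S' *v x) = min_correction_cost S' Y z"
    by (rule min_correction_cost_attained[OF S(2) Y])
  have "w * min_correction_cost S Y z \<le> w * (x \<bullet> (matrix_inv S *v x))"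
    using min_correction_cost_le[OF S(1) Y, of x] w(1) x(1) by (intro mult_left_mono) auto
  also have "\<dots> \<le> min_correction_cost S' Y z" using w(2)[of x] x(2) by simp
  finally show ?thesis .
qed

lemma min_correction_cost_upper_comparison:
  fixes S S' :: "real^'j^'j" and Y :: "real^'d^'j"
  assumes S: "pos_def S" "pos_def S'" and Y: "rank Y = CARD('d)"
    and w: "\<And>x. x \<bullet> (matrix_inv S' *v x) \<le> w * (x \<bullet> (matrix_inv S *v x))"
  shows "min_correction_cost S' Y z \<le> w * min_correction_cost S Y z"
proof -
  obtain x where x: "transpose Y *v x = z" "x \<bullet> (matrix_inv S *v x) = min_correction_cost S Y z"
    by (rule min_correction_cost_attained[OF S(1) Y])
  show ?thesis
    using min_correction_cost_le[OF S(2) Y, of x] w[of x] x by simp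
qed

text \<open>
  The data of the limit problem: \<open>V\<close> is the limit of the second moments of the regressors, \<open>S\<close> the
  limit of the known error covariance matrices and \<open>s\<close> the unknown factor.
\<close>

locale ewtls_limit =
  fixes \<iota> :: "'j::finite \<Rightarrow> 'n::finite + 'd::finite"
    and X0 :: "real^'d^'n" and V :: "real^'n^'n" and S :: "real^'j^'j" and s :: real
  assumes inj: "inj \<iota>" and V: "pos_def V" and S: "pos_def S" and s: "s > 0"
    and rank_X0: "rank (rows_at \<iota> (Zmat X0)) = CARD('d)"
begin

definition error_covariance :: "real^('n + 'd)^('n + 'd)" where
  "error_covariance = transpose (selection \<iota>) ** S ** selection \<iota>"

definition limit_moment :: "real^('n + 'd)^('n + 'd)" where
  "limit_moment = transpose (regression_map X0) ** V ** regression_map X0 + s *\<^sub>R error_covariance"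

lemma gram_error_covariance:
  "transpose Z ** error_covariance ** Z = transpose (rows_at \<iota> Z) ** S ** rows_at \<iota> Z"
  for Z :: "real^'e^('n + 'd)"
  by (simp add: error_covariance_def rows_at_eq_selection_mult matrix_transpose_mul matrix_mul_assoc)

lemma quadratic_form_limit_moment:
  "u \<bullet> (limit_moment *v u) = (regression_map X0 *v u) \<bullet> (V *v (regression_map X0 *v u))
     + s * ((selection \<iota> *v u) \<bullet> (S *v (selection \<iota> *v u)))"
  unfolding limit_moment_def error_covariance_def matrix_vector_mult_add_rdistrib inner_add_right
    scaleR_matrix_vector_assoc[symmetric] inner_scaleR_right quadratic_form_congruence ..

text \<open>
  A null vector \<open>u\<close> of both summands satisfies \<open>N u = 0\<close>, that is \<open>u = Z\<^sub>0 t\<close>, and vanishes on \<open>J\<close>, that is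
  \<open>Z\<^sub>0\<^sub>J t = 0\<close>; by the rank condition \<open>t = 0\<close>.
\<close>

lemma limit_moment_pos_def: "pos_def limit_moment"
proof -
  have "transpose V = V" "transpose S = S" using V S by (auto simp: pos_def_def)
  then have "transpose limit_moment = limit_moment"
    by (simp add: limit_moment_def error_covariance_def transpose_add transpose_scaleR
        matrix_transpose_mul matrix_mul_assoc)
  moreover have "0 < u \<bullet> (limit_moment *v u)" if "u \<noteq> 0" for u
  proof (rule ccontr)
    assume neg: "\<not> ?thesis"
    have V0: "0 \<le> y \<bullet> (V *v y)" "y \<bullet> (V *v y) \<le> 0 \<Longrightarrow> y = 0" for y
      using V unfolding pos_def_def by (cases "y = 0"; force)+
    have S0: "0 \<le> y \<bullet> (S *v y)" "y \<bullet> (S *v y) \<le> 0 \<Longrightarrow> y = 0" for y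
      using S unfolding pos_def_def by (cases "y = 0"; force)+
    let ?a = "regression_map X0 *v u" and ?b = "selection \<iota> *v u"
    have "?a \<bullet> (V *v ?a) + s * (?b \<bullet> (S *v ?b)) \<le> 0"
      using neg by (simp add: quadratic_form_limit_moment)
    moreover have "0 \<le> s * (?b \<bullet> (S *v ?b))" using S0 s by simp
    ultimately have "?a \<bullet> (V *v ?a) \<le> 0" "s * (?b \<bullet> (S *v ?b)) \<le> 0"
      using V0(1)[of ?a] by linarith+
    then have a: "?a = 0" and b: "?b = 0"
      using V0(2) S0(2) s by (auto simp: mult_le_0_iff)
    define t where "t = - lower u"
    have u: "u = Zmat X0 *v t"
    proof (rule vec_Plus_eqI)
      have "upper u = - (X0 *v lower u)"
        using a by (simp add: regression_map_mult eq_neg_iff_add_eq_0)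
      also have "\<dots> = X0 *v t"
        by (simp add: t_def vec_eq_iff matrix_vector_mult_def sum_negf)
      finally show "upper u = upper (Zmat X0 *v t)" by (simp add: upper_Zmat_mult)
    qed (simp add: lower_Zmat_mult t_def)
    then have "rows_at \<iota> (Zmat X0) *v t = 0"
      using b by (simp add: rows_at_eq_selection_mult matrix_vector_mul_assoc)
    moreover have "inj ((*v) (rows_at \<iota> (Zmat X0)))"
      using rank_X0 full_rank_injective by blast
    ultimately have "t = 0" by (metis injD matrix_vector_mult_0_right)
    with u that show False by simp
  qed
  ultimately show ?thesis by (simp add: pos_def_def)
qed

text \<open>
  Let \<open>U = Z T\<close> have columns orthonormal for \<open>S\<close> on \<open>J\<close>, and let \<open>Y = X - X\<^sub>0\<close>.  Then
  \<open>tr (U\<^sup>T W\<^sub>\<infinity> U) = s d + tr ((Y T)\<^sup>T V (Y T))\<close>.  From \<open>W \<ge> (1 - \<rho>) W\<^sub>\<infinity>\<close> and the bound on the cost, the second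
  summand, and with it \<open>|Y T|\<close>, is small.  To remove \<open>T\<close>, note that \<open>t = T \<alpha>\<close> with
  \<open>|\<alpha>|\<^sup>2 = (Z\<^sub>J t) \<bullet> S (Z\<^sub>J t)\<close>, which is of the order \<open>|t|\<^sup>2 + |Y t|\<^sup>2\<close>; so \<open>|Y t|\<^sup>2\<close> is at most a small multiple
  of \<open>|t|\<^sup>2 + |Y t|\<^sup>2\<close>, and hence of \<open>|t|\<^sup>2\<close>.
\<close>

lemma limit_cost_localises:
  assumes \<epsilon>: "\<epsilon> > 0"
  obtains h where "h > 0"
    "\<And>X W. rank (rows_at \<iota> (Zmat X)) = CARD('d) \<Longrightarrow> norm (W - limit_moment) \<le> h \<Longrightarrow>
      limit_cost \<iota> S W X \<le> s * real CARD('d) + h \<Longrightarrow> norm (X - X0) < \<epsilon>"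
proof -
  obtain w0 where w0: "w0 > 0" "\<And>u. w0 * (norm u)\<^sup>2 \<le> u \<bullet> (limit_moment *v u)"
    using pos_def_lower_bound[OF limit_moment_pos_def] by blast
  obtain v0 where v0: "v0 > 0" "\<And>u. v0 * (norm u)\<^sup>2 \<le> u \<bullet> (V *v u)"
    using pos_def_lower_bound[OF V] by blast
  define d where "d = real CARD('d)"
  have d: "d > 0" by (simp add: d_def)
  define L where "L = norm S * (norm (selection \<iota> :: real^('n + 'd)^'j))\<^sup>2 + 1"
  have L: "L > 0" unfolding L_def by (simp add: add_nonneg_pos)
  define M where "M = 2 + 2 * (norm X0)\<^sup>2"
  have M: "M > 0" unfolding M_def by (simp add: add_pos_nonneg)
  define K1 where "K1 = 2 * (1 + s * d / w0)"
  have K1: "K1 > 0" using s d w0(1) by (simp add: K1_def add_pos_pos)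
  define K where "K = K1 / v0 * L * M"
  have K: "K > 0" using K1 v0(1) L M by (simp add: K_def)
  \<comment> \<open>The three bounds give \<open>\<rho> \<le> 1/2\<close>, allow the term \<open>|Y t|\<^sup>2\<close> to be absorbed, and make the final bound
    smaller than \<open>\<epsilon>\<^sup>2\<close>.\<close>
  define h where "h = min (w0 / 2) (min (1 / (2 * K)) (\<epsilon>\<^sup>2 / (4 * K * d)))"
  have h: "h > 0" using w0(1) K d \<epsilon> by (simp add: h_def)
  have "norm (X - X0) < \<epsilon>"
    if X: "rank (rows_at \<iota> (Zmat X)) = CARD('d)" and W: "norm (W - limit_moment) \<le> h"
      and cost: "limit_cost \<iota> S W X \<le> s * d + h" for X W
  proof -
    obtain T where T: "invertible T" "transpose T = T"
      "T ** T = matrix_inv (transpose (rows_at \<iota> (Zmat X)) ** S ** rows_at \<iota> (Zmat X))"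
      "transpose (rows_at \<iota> (Zmat X) ** T) ** S ** (rows_at \<iota> (Zmat X) ** T) = mat 1"
      by (rule orthonormalisation[OF S X])
    define U where "U = Zmat X ** T"
    define Y where "Y = X - X0"
    define A where "A = (\<Sum>q\<in>UNIV. column q (Y ** T) \<bullet> (V *v column q (Y ** T)))"
    have RU: "selection \<iota> ** U = rows_at \<iota> (Zmat X) ** T"
      by (simp add: U_def rows_at_eq_selection_mult matrix_mul_assoc)
    have NU: "regression_map X0 ** U = Y ** T"
      unfolding U_def Y_def regression_map_Zmat[symmetric] by (simp add: matrix_mul_assoc)
    have "(\<Sum>q\<in>UNIV. column q (selection \<iota> ** U) \<bullet> (S *v column q (selection \<iota> ** U))) = d"
      unfolding trace_congruence[symmetric] RU T(4) by (simp add: trace_mat_1 d_def)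
    then have total: "(\<Sum>q\<in>UNIV. column q U \<bullet> (limit_moment *v column q U)) = A + s * d"
      unfolding quadratic_form_limit_moment
      by (simp add: sum.distrib A_def flip: sum_distrib_left NU column_matrix_mult)
    define \<rho> where "\<rho> = h / w0"
    have \<rho>: "0 \<le> \<rho>" "\<rho> \<le> 1 / 2"
      using h w0(1) unfolding \<rho>_def h_def by (auto simp: field_simps)
    \<comment> \<open>An additive error of at most \<open>h |u|\<^sup>2\<close> is a multiplicative one because \<open>|u|\<^sup>2\<close> is bounded by the form of
      \<open>W\<^sub>\<infinity>\<close> divided by \<open>w0\<close>.\<close>
    have low: "(1 - \<rho>) * (u \<bullet> (limit_moment *v u)) \<le> u \<bullet> (W *v u)" for u
    proof -
      have "- (norm (W - limit_moment) * (norm u)\<^sup>2) \<le> u \<bullet> ((W - limit_moment) *v u)"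
        using abs_quadratic_form_le[of u "W - limit_moment"] by linarith
      moreover have "norm (W - limit_moment) * (norm u)\<^sup>2 \<le> h * (norm u)\<^sup>2"
        using W by (intro mult_right_mono) auto
      moreover have "h * (norm u)\<^sup>2 \<le> \<rho> * (u \<bullet> (limit_moment *v u))"
        using w0(2)[of u] h w0(1) unfolding \<rho>_def by (simp add: field_simps)
      ultimately show ?thesis
        by (simp add: matrix_vector_mult_diff_rdistrib inner_diff_right algebra_simps)
    qed
    have "(1 - \<rho>) * (A + s * d) \<le> (\<Sum>q\<in>UNIV. column q U \<bullet> (W *v column q U))"
      unfolding total[symmetric] sum_distrib_left by (intro sum_mono low)
    also have "\<dots> = limit_cost \<iota> S W X"
      unfolding limit_cost_orthonormalised[OF T(3,2)] trace_congruence U_def ..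
    also have "\<dots> \<le> s * d + h" by (rule cost)
    finally have A1: "(1 - \<rho>) * A \<le> h + \<rho> * (s * d)" by (simp add: algebra_simps)
    have Alow: "v0 * (norm (Y ** T))\<^sup>2 \<le> A"
      unfolding A_def norm_sq_sum_columns[of "Y ** T"] sum_distrib_left by (intro sum_mono v0(2))
    then have A0: "0 \<le> A" using v0(1) by (meson less_imp_le mult_nonneg_nonneg order_trans zero_le_power2)
    have "A / 2 \<le> (1 - \<rho>) * A" using mult_right_mono[OF \<rho>(2) A0] by (simp add: algebra_simps)
    then have "A / 2 \<le> h + \<rho> * (s * d)" using A1 by (rule order_trans)
    then have "A \<le> 2 * (h + \<rho> * (s * d))" by simp
    also have "\<dots> = K1 * h" by (simp add: K1_def \<rho>_def field_simps)
    finally have YT: "(norm (Y ** T))\<^sup>2 \<le> K1 * h / v0"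
      using Alow v0(1) by (simp add: field_simps)
    have Yt: "(norm (Y *v t))\<^sup>2 \<le> 2 * K * h * (norm t)\<^sup>2" for t
    proof -
      define \<alpha> where "\<alpha> = matrix_inv T *v t"
      have t: "T *v \<alpha> = t"
        by (simp add: \<alpha>_def matrix_vector_mul_assoc matrix_inv_right T(1))
      have "(norm \<alpha>)\<^sup>2 = \<alpha> \<bullet> ((transpose (selection \<iota> ** U) ** S ** (selection \<iota> ** U)) *v \<alpha>)"
        unfolding RU T(4) by (simp add: power2_norm_eq_inner)
      also have "\<dots> = (selection \<iota> *v (Zmat X *v t)) \<bullet> (S *v (selection \<iota> *v (Zmat X *v t)))"
        unfolding quadratic_form_congruence U_def
        by (simp add: matrix_vector_mul_assoc[symmetric] t)
      also have "\<dots> \<le> norm S * (norm (selection \<iota> *v (Zmat X *v t)))\<^sup>2"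
        using abs_quadratic_form_le[of "selection \<iota> *v (Zmat X *v t)" S] by linarith
      also have "\<dots> \<le> norm S * (norm (selection \<iota> :: real^('n + 'd)^'j) * norm (Zmat X *v t))\<^sup>2"
        by (intro mult_left_mono power_mono norm_matrix_vector_mult_le) auto
      also have "\<dots> \<le> L * (norm (Zmat X *v t))\<^sup>2"
        by (simp add: L_def power_mult_distrib algebra_simps)
      finally have \<alpha>: "(norm \<alpha>)\<^sup>2 \<le> L * (norm (Zmat X *v t))\<^sup>2" .
      have "X *v t = X0 *v t + Y *v t"
        by (simp add: Y_def matrix_vector_mult_diff_rdistrib)
      then have "(norm (X *v t))\<^sup>2 \<le> (norm (X0 *v t) + norm (Y *v t))\<^sup>2"
        by (simp add: norm_triangle_ineq power_mono)
      also have "\<dots> \<le> 2 * (norm (X0 *v t))\<^sup>2 + 2 * (norm (Y *v t))\<^sup>2"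
        using sum_squares_bound[of "norm (X0 *v t)" "norm (Y *v t)"] by (simp add: power2_sum)
      also have "(norm (X0 *v t))\<^sup>2 \<le> (norm X0 * norm t)\<^sup>2"
        by (intro power_mono norm_matrix_vector_mult_le) auto
      finally have "(norm (Zmat X *v t))\<^sup>2 \<le> 2 * (norm X0)\<^sup>2 * (norm t)\<^sup>2 + 2 * (norm (Y *v t))\<^sup>2 + (norm t)\<^sup>2"
        by (simp add: norm_Zmat_mult power_mult_distrib)
      also have "\<dots> \<le> M * ((norm t)\<^sup>2 + (norm (Y *v t))\<^sup>2)"
        by (simp add: M_def algebra_simps)
      finally have Z: "(norm (Zmat X *v t))\<^sup>2 \<le> M * ((norm t)\<^sup>2 + (norm (Y *v t))\<^sup>2)" .
      have "(norm (Y *v t))\<^sup>2 \<le> (norm (Y ** T) * norm \<alpha>)\<^sup>2"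
        unfolding t[symmetric] matrix_vector_mul_assoc
        by (intro power_mono norm_matrix_vector_mult_le) auto
      also have "\<dots> \<le> (K1 * h / v0) * (L * (M * ((norm t)\<^sup>2 + (norm (Y *v t))\<^sup>2)))"
        unfolding power_mult_distrib
        using YT \<alpha> Z L K1 h v0(1)
        by (intro mult_mono) (auto intro: order_trans[OF \<alpha>] mult_left_mono)
      also have "\<dots> = K * h * ((norm t)\<^sup>2 + (norm (Y *v t))\<^sup>2)"
        by (simp add: K_def)
      finally have *: "(norm (Y *v t))\<^sup>2 \<le> K * h * (norm t)\<^sup>2 + K * h * (norm (Y *v t))\<^sup>2"
        by (simp add: distrib_left)
      have "K * h \<le> K * (1 / (2 * K))"
        using K unfolding h_def by (intro mult_left_mono) auto
      then have "K * h \<le> 1 / 2" using K by simp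
      then have "K * h * (norm (Y *v t))\<^sup>2 \<le> 1 / 2 * (norm (Y *v t))\<^sup>2"
        by (intro mult_right_mono) auto
      with * show ?thesis by linarith
    qed
    have "(norm Y)\<^sup>2 = (\<Sum>q\<in>UNIV. (norm (Y *v axis q 1))\<^sup>2)"
      unfolding norm_sq_sum_columns[of Y] by (simp add: matrix_vector_mult_basis)
    also have "\<dots> \<le> (\<Sum>q\<in>(UNIV::'d set). 2 * K * h * (norm (axis q 1 :: real^'d))\<^sup>2)"
      by (intro sum_mono Yt)
    also have "\<dots> = 2 * K * d * h" by (simp add: d_def norm_axis_1)
    also have "\<dots> \<le> 2 * K * d * (\<epsilon>\<^sup>2 / (4 * K * d))"
      using K d unfolding h_def by (intro mult_left_mono) auto
    also have "\<dots> = \<epsilon>\<^sup>2 / 2" using K d by simp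
    also have "\<dots> < \<epsilon>\<^sup>2" using \<epsilon> by simp
    finally show ?thesis
      using \<epsilon> unfolding Y_def by (simp add: power2_less_imp_less)
  qed
  with h show thesis using that unfolding d_def by blast
qed

lemma tendsto_trace_gram_quotient:
  fixes f g :: "'z \<Rightarrow> real^('n + 'd)^('n + 'd)"
  assumes f: "(f \<longlongrightarrow> W) F" and g: "(g \<longlongrightarrow> E) F" and X: "(x \<longlongrightarrow> X) F"
    and inv: "invertible (transpose (Zmat X) ** E ** Zmat X)"
  shows "((\<lambda>z. trace ((transpose (Zmat (x z)) ** f z ** Zmat (x z)) **
      matrix_inv (transpose (Zmat (x z)) ** g z ** Zmat (x z)))) \<longlongrightarrow>
    trace ((transpose (Zmat X) ** W ** Zmat X) ** matrix_inv (transpose (Zmat X) ** E ** Zmat X))) F"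
  by (intro tendsto_trace tendsto_matrix_mult tendsto_transpose tendsto_Zmat tendsto_matrix_inv
      f g X inv)

lemma gram_X0_invertible: "invertible (transpose (Zmat X0) ** error_covariance ** Zmat X0)"
  unfolding gram_error_covariance
  by (rule pos_def_imp_invertible[OF gram_pos_def[OF S rank_X0]])

text \<open>
  At \<open>X\<^sub>0\<close> the summand of \<open>W\<^sub>\<infinity>\<close> with \<open>V\<close> disappears, since \<open>N Z\<^sub>0 = 0\<close>.
\<close>

lemma trace_gram_quotient_limit:
  "trace ((transpose (Zmat X0) ** limit_moment ** Zmat X0) **
     matrix_inv (transpose (Zmat X0) ** error_covariance ** Zmat X0)) = s * real CARD('d)"
proof -
  have "regression_map X0 ** Zmat X0 = 0" by (simp add: regression_map_Zmat)
  then have "transpose (Zmat X0) ** limit_moment ** Zmat X0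
      = s *\<^sub>R (transpose (Zmat X0) ** error_covariance ** Zmat X0)"
    by (simp add: limit_moment_def matrix_add_ldistrib matrix_add_rdistrib
        matrix_mul_assoc[symmetric] matrix_scaleR_left matrix_scaleR_right)
  then show ?thesis
    using matrix_inv_right[OF gram_X0_invertible]
    by (simp add: matrix_scaleR_left trace_mat_1 trace_def mat_def sum_distrib_left[symmetric])
qed

lemma eventually_full_rank:
  assumes x: "(x \<longlongrightarrow> X) F" and X: "rank (rows_at \<iota> (Zmat X)) = CARD('d)"
  shows "\<forall>\<^sub>F z in F. rank (rows_at \<iota> (Zmat (x z))) = CARD('d)"
proof -
  let ?G = "\<lambda>X. transpose (rows_at \<iota> (Zmat X)) ** S ** rows_at \<iota> (Zmat X)"
  have "((\<lambda>z. ?G (x z)) \<longlongrightarrow> ?G X) F"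
    by (intro tendsto_matrix_mult tendsto_transpose tendsto_rows_at_Zmat x tendsto_const)
  then have "((\<lambda>z. det (?G (x z))) \<longlongrightarrow> det (?G X)) F"
    by (intro tendsto_det tendsto_vec_nth)
  moreover have "det (?G X) \<noteq> 0"
    using pos_def_imp_invertible[OF gram_pos_def[OF S X]] by (simp add: invertible_det_nz)
  ultimately have "\<forall>\<^sub>F z in F. det (?G (x z)) \<noteq> 0" by (rule tendsto_imp_eventually_ne)
  then show ?thesis
    by eventually_elim (rule rank_eq_if_gram_invertible[of _ S], simp add: invertible_det_nz)
qed

lemma limit_cost_eq:
  "limit_cost \<iota> S W X = trace ((transpose (Zmat X) ** W ** Zmat X) **
     matrix_inv (transpose (Zmat X) ** error_covariance ** Zmat X))"
  by (simp add: limit_cost_def gram_error_covariance)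

lemma tendsto_profile_objective:
  assumes x: "(x \<longlongrightarrow> X) F" and \<Sigma>: "\<And>i. pos_def (\<Sigma> i)"
    and X: "rank (rows_at \<iota> (Zmat X)) = CARD('d)"
  shows "((\<lambda>z. profile_objective \<iota> \<Sigma> m C (x z)) \<longlongrightarrow> profile_objective \<iota> \<Sigma> m C X) F"
  unfolding profile_objective_def min_correction_cost_def
  by (intro tendsto_sum tendsto_inner tendsto_matrix_vector_mult tendsto_transpose tendsto_Zmat
      tendsto_matrix_inv tendsto_matrix_mult tendsto_rows_at_Zmat x tendsto_const
      pos_def_imp_invertible gram_pos_def \<Sigma> X)

definition comparison_weights ::
  "(nat \<Rightarrow> real^'j^'j) \<Rightarrow> (nat \<Rightarrow> real) \<Rightarrow> (nat \<Rightarrow> real) \<Rightarrow> bool" where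
  "comparison_weights \<Sigma> w w' \<longleftrightarrow> (\<forall>i. pos_def (\<Sigma> i) \<and> 0 \<le> w i \<and>
    (\<forall>x. w i * (x \<bullet> (matrix_inv S *v x)) \<le> x \<bullet> (matrix_inv (\<Sigma> i) *v x) \<and>
         x \<bullet> (matrix_inv (\<Sigma> i) *v x) \<le> w' i * (x \<bullet> (matrix_inv S *v x))))"

text \<open>
  If \<open>S\<^sup>-\<^sup>1 \<ge> p I\<close>, the relative error of the form \<open>\<Sigma>\<^sub>i\<^sup>-\<^sup>1\<close> is at most \<open>|\<Sigma>\<^sub>i\<^sup>-\<^sup>1 - S\<^sup>-\<^sup>1| / p\<close>, which tends to zero.
  The lower weight is cut off at zero, as nonnegativity is part of the comparison.
\<close>

lemma comparison_weights_exist: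
  assumes \<Sigma>: "\<And>i. pos_def (\<Sigma> i)" and lim: "\<Sigma> \<longlonglongrightarrow> S"
  obtains w w' where "w \<longlonglongrightarrow> 1" "w' \<longlonglongrightarrow> 1" "comparison_weights \<Sigma> w w'"
proof -
  define P where "P i = matrix_inv (\<Sigma> i)" for i
  define Q where "Q = matrix_inv S"
  have P_lim: "P \<longlonglongrightarrow> Q"
    unfolding P_def Q_def by (rule tendsto_matrix_inv[OF lim pos_def_imp_invertible[OF S]])
  obtain p where p: "p > 0" "\<And>x. p * (norm x)\<^sup>2 \<le> x \<bullet> (Q *v x)"
    using pos_def_lower_bound[OF pos_def_matrix_inv[OF S]] unfolding Q_def by blast
  define v where "v i = norm (P i - Q) / p" for i
  have v0: "v i \<ge> 0" for i using p(1) by (simp add: v_def)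
  have v_lim: "v \<longlonglongrightarrow> 0"
  proof -
    have "(\<lambda>i. norm (P i - Q) / p) \<longlonglongrightarrow> norm (Q - Q) / p"
      using p(1) by (intro tendsto_divide tendsto_norm tendsto_diff P_lim tendsto_const) simp
    then show ?thesis by (simp add: v_def[abs_def])
  qed
  have near: "\<bar>x \<bullet> (P i *v x) - x \<bullet> (Q *v x)\<bar> \<le> v i * (x \<bullet> (Q *v x))" for i x
  proof -
    have "\<bar>x \<bullet> (P i *v x) - x \<bullet> (Q *v x)\<bar> \<le> norm (P i - Q) * (norm x)\<^sup>2"
      using abs_quadratic_form_le[of x "P i - Q"]
      by (simp add: matrix_vector_mult_diff_rdistrib inner_diff_right)
    also have "\<dots> = v i * (p * (norm x)\<^sup>2)" using p(1) by (simp add: v_def)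
    also have "\<dots> \<le> v i * (x \<bullet> (Q *v x))" by (intro mult_left_mono p(2) v0)
    finally show ?thesis .
  qed
  have low: "max 0 (1 - v i) * (x \<bullet> (Q *v x)) \<le> x \<bullet> (P i *v x)" for i x
  proof -
    have "0 \<le> x \<bullet> (P i *v x)"
      using pos_def_matrix_inv[OF \<Sigma>[of i]] unfolding P_def pos_def_def
      by (cases "x = 0") (auto simp: less_imp_le)
    moreover have "(1 - v i) * (x \<bullet> (Q *v x)) \<le> x \<bullet> (P i *v x)"
      using near[of x i] by (simp add: left_diff_distrib)
    ultimately show ?thesis by (simp add: max_def)
  qed
  have up: "x \<bullet> (P i *v x) \<le> (1 + v i) * (x \<bullet> (Q *v x))" for i x
    using near[of x i] by (simp add: distrib_right)
  have "(\<lambda>i. max 0 (1 - v i)) \<longlonglongrightarrow> max 0 (1 - 0)" "(\<lambda>i. 1 + v i) \<longlonglongrightarrow> 1 + 0"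
    by (intro tendsto_max tendsto_diff tendsto_add tendsto_const v_lim)+
  moreover have "comparison_weights \<Sigma> (\<lambda>i. max 0 (1 - v i)) (\<lambda>i. 1 + v i)"
    using \<Sigma> low up unfolding comparison_weights_def P_def Q_def by simp
  ultimately show thesis using that by simp
qed

text \<open>
  Upper weights at \<open>X\<^sub>0\<close> bound the optimal cost by about \<open>s d\<close>; lower weights and
  \<open>limit_cost_localises\<close> confine everything that is at least as good as \<open>X\<^sub>0\<close> to a ball.  The ball is
  chosen so small that it lies in the open set of matrices with full rank, hence the profiled objective
  has a minimum on it, which is then a global one.
\<close>

lemma ewtls_solution_near:
  assumes \<epsilon>: "\<epsilon> > 0"
  obtains h where "h > 0"
    "\<And>m C \<Sigma> w w'. m > 0 \<Longrightarrow> comparison_weights \<Sigma> w w' \<Longrightarrow>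
      norm (weighted_second_moment w m C - limit_moment) \<le> h \<Longrightarrow>
      norm (weighted_second_moment w' m C - limit_moment) \<le> h \<Longrightarrow>
      (\<exists>X. ewtls_solution \<iota> \<Sigma> m C X) \<and>
      (\<forall>X. ewtls_solution \<iota> \<Sigma> m C X \<longrightarrow> norm (X - X0) < \<epsilon>)"
proof -
  obtain e where e: "e > 0" "\<And>X. dist X X0 < e \<Longrightarrow> rank (rows_at \<iota> (Zmat X)) = CARD('d)"
    using eventually_full_rank[OF tendsto_ident_at[of X0 UNIV] rank_X0] rank_X0
    unfolding eventually_at by (metis UNIV_I zero_less_dist_iff)
  define \<epsilon>1 where "\<epsilon>1 = min \<epsilon> (e / 2)"
  have \<epsilon>1: "\<epsilon>1 > 0" "\<epsilon>1 \<le> \<epsilon>" "\<epsilon>1 < e" using \<epsilon> e(1) by (auto simp: \<epsilon>1_def)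
  obtain h1 where h1: "h1 > 0" "\<And>X W. rank (rows_at \<iota> (Zmat X)) = CARD('d) \<Longrightarrow>
      norm (W - limit_moment) \<le> h1 \<Longrightarrow>
      limit_cost \<iota> S W X \<le> s * real CARD('d) + h1 \<Longrightarrow> norm (X - X0) < \<epsilon>1"
    using limit_cost_localises[OF \<epsilon>1(1)] by blast
  have "((\<lambda>W. limit_cost \<iota> S W X0) \<longlongrightarrow> s * real CARD('d)) (nhds limit_moment)"
    unfolding limit_cost_eq trace_gram_quotient_limit[symmetric]
    by (intro tendsto_trace_gram_quotient gram_X0_invertible tendsto_const filterlim_ident)
  then have "\<forall>\<^sub>F W in nhds limit_moment. limit_cost \<iota> S W X0 < s * real CARD('d) + h1"
    using h1(1) by (intro order_tendstoD) auto
  then obtain h2 where h2: "h2 > 0"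
    "\<And>W. dist W limit_moment < h2 \<Longrightarrow> limit_cost \<iota> S W X0 < s * real CARD('d) + h1"
    unfolding eventually_nhds_metric by blast
  define h where "h = min h1 (h2 / 2)"
  have h: "h > 0" "h \<le> h1" "h < h2" using h1(1) h2(1) by (auto simp: h_def)
  show thesis
  proof (rule that[OF h(1)])
    fix m :: nat and C :: "nat \<Rightarrow> real^('n + 'd)" and \<Sigma> :: "nat \<Rightarrow> real^'j^'j" and w w' :: "nat \<Rightarrow> real"
    assume m: "m > 0" and weights: "comparison_weights \<Sigma> w w'"
      and W: "norm (weighted_second_moment w m C - limit_moment) \<le> h"
      and W': "norm (weighted_second_moment w' m C - limit_moment) \<le> h"
    have \<Sigma>: "\<And>i. pos_def (\<Sigma> i)" and w: "\<And>i. 0 \<le> w i"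
      and low: "\<And>i x. w i * (x \<bullet> (matrix_inv S *v x)) \<le> x \<bullet> (matrix_inv (\<Sigma> i) *v x)"
      and up: "\<And>i x. x \<bullet> (matrix_inv (\<Sigma> i) *v x) \<le> w' i * (x \<bullet> (matrix_inv S *v x))"
      using weights unfolding comparison_weights_def by simp_all
    let ?P = "profile_objective \<iota> \<Sigma> m C"
    have lowP: "limit_cost \<iota> S (weighted_second_moment w m C) X \<le> ?P X / real m"
      if X: "rank (rows_at \<iota> (Zmat X)) = CARD('d)" for X
      unfolding limit_cost_weighted_second_moment[OF S X] profile_objective_def
      by (intro divide_right_mono sum_mono min_correction_cost_lower_comparison S \<Sigma> X w low) simp
    have upP: "?P X / real m \<le> limit_cost \<iota> S (weighted_second_moment w' m C) X"
      if X: "rank (rows_at \<iota> (Zmat X)) = CARD('d)" for X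
      unfolding limit_cost_weighted_second_moment[OF S X] profile_objective_def
      by (intro divide_right_mono sum_mono min_correction_cost_upper_comparison S \<Sigma> X up) simp
    have "limit_cost \<iota> S (weighted_second_moment w' m C) X0 < s * real CARD('d) + h1"
      using W' h(3) by (intro h2(2)) (simp add: dist_norm)
    with upP[OF rank_X0] have P0: "?P X0 / real m < s * real CARD('d) + h1" by linarith
    have near: "norm (X - X0) < \<epsilon>1"
      if X: "rank (rows_at \<iota> (Zmat X)) = CARD('d)" and le: "?P X \<le> ?P X0" for X
    proof (rule h1(2)[OF X])
      show "norm (weighted_second_moment w m C - limit_moment) \<le> h1" using W h(2) by linarith
      have "?P X / real m \<le> ?P X0 / real m" using le by (simp add: divide_right_mono)
      then show "limit_cost \<iota> S (weighted_second_moment w m C) X \<le> s * real CARD('d) + h1"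
        using lowP[OF X] P0 by linarith
    qed
    have full: "rank (rows_at \<iota> (Zmat X)) = CARD('d)" if "X \<in> cball X0 \<epsilon>1" for X
      using that \<epsilon>1(3) by (intro e(2)) (simp add: dist_commute)
    have "continuous_on (cball X0 \<epsilon>1) ?P"
      unfolding continuous_on_def by (intro ballI tendsto_profile_objective tendsto_ident_at \<Sigma> full)
    then obtain X where X: "X \<in> cball X0 \<epsilon>1" "\<And>X'. X' \<in> cball X0 \<epsilon>1 \<Longrightarrow> ?P X \<le> ?P X'"
      using continuous_attains_inf[of "cball X0 \<epsilon>1" ?P] \<epsilon>1(1) by (auto simp: Ball_def)
    have "?P X \<le> ?P X'" if X': "rank (rows_at \<iota> (Zmat X')) = CARD('d)" for X'
    proof (cases "?P X' \<le> ?P X0")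
      case True
      then show ?thesis
        using near[OF X'] by (intro X(2)) (simp add: dist_norm norm_minus_commute)
    next
      case False
      moreover have "?P X \<le> ?P X0" using \<epsilon>1(1) by (intro X(2)) simp
      ultimately show ?thesis by linarith
    qed
    then have "ewtls_solution \<iota> \<Sigma> m C X"
      using full[OF X(1)] by (simp add: ewtls_solution_iff[where \<Sigma>=\<Sigma>, OF inj \<Sigma>])
    moreover have "norm (X - X0) < \<epsilon>" if "ewtls_solution \<iota> \<Sigma> m C X" for X
    proof -
      have "norm (X - X0) < \<epsilon>1"
        using that rank_X0 by (intro near) (auto simp: ewtls_solution_iff[where \<Sigma>=\<Sigma>, OF inj \<Sigma>])
      then show ?thesis using \<epsilon>1(2) by linarith
    qed
    ultimately show "(\<exists>X. ewtls_solution \<iota> \<Sigma> m C X) \<and>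
      (\<forall>X. ewtls_solution \<iota> \<Sigma> m C X \<longrightarrow> norm (X - X0) < \<epsilon>)" by blast
  qed
qed

lemma sigma2_formula_eq:
  "sigma2_formula m C E X = (1 / real CARD('d)) *
    trace ((transpose (Zmat X) ** weighted_second_moment (\<lambda>_. 1) m C ** Zmat X) **
           matrix_inv (transpose (Zmat X) ** E ** Zmat X))"
  for X :: "real^'d^'n"
  by (simp add: sigma2_formula_def weighted_second_moment_def)

lemma VA_formula_eq:
  "VA_formula m C E X = upper_left (weighted_second_moment (\<lambda>_. 1) m C) -
    sigma2_formula m C E X *\<^sub>R upper_left E"
proof -
  have "sample_mean m (\<lambda>i. outer (upper (C i)) (upper (C i)))
      = upper_left (weighted_second_moment (\<lambda>_. 1) m C)"
    by (simp add: weighted_second_moment_def sample_mean_def upper_left_def upper_def outer_def vec_eq_iff)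
  then show ?thesis by (simp add: VA_formula_def)
qed

lemma upper_left_limit_moment: "upper_left limit_moment - s *\<^sub>R upper_left error_covariance = V"
proof -
  have "(transpose (regression_map X0) ** V ** regression_map X0) $ Inl p $ Inl q = V $ p $ q" for p q
    by (simp add: regression_map_def matrix_matrix_mult_def transpose_def mat_def if_distrib if_distribR
        cong: if_cong)
  then show ?thesis by (simp add: upper_left_def limit_moment_def vec_eq_iff)
qed

text \<open>
  Both estimates are continuous at the limit point, since the Gram matrix \<open>Z\<^sub>0\<^sup>T S\<^sub>\<infinity> Z\<^sub>0\<close> is invertible.  At
  this point they take the values \<open>s\<close> (as \<open>Z\<^sub>0\<^sup>T W\<^sub>\<infinity> Z\<^sub>0 = s Z\<^sub>0\<^sup>T S\<^sub>\<infinity> Z\<^sub>0\<close>) and \<open>V\<close>.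
\<close>

lemma formulas_near:
  assumes \<epsilon>: "\<epsilon> > 0"
  obtains h where "h > 0"
    "\<And>m C E X. norm (weighted_second_moment (\<lambda>_. 1) m C - limit_moment) \<le> h \<Longrightarrow>
      norm (E - error_covariance) \<le> h \<Longrightarrow> norm (X - X0) \<le> h \<Longrightarrow>
      dist (sigma2_formula m C E X) s < \<epsilon> \<and> dist (VA_formula m C E X) V < \<epsilon>"
proof -
  let ?F = "nhds (limit_moment, error_covariance, X0)"
  let ?sig = "\<lambda>(W, E, X). (1 / real CARD('d)) * trace ((transpose (Zmat X) ** W ** Zmat X) **
           matrix_inv (transpose (Zmat X) ** E ** Zmat X))"
  let ?VA = "\<lambda>(W, E, X). upper_left W - ?sig (W, E, X) *\<^sub>R upper_left E"
  have W: "((\<lambda>p. fst p) \<longlongrightarrow> limit_moment) ?F"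
    and E: "((\<lambda>p. fst (snd p)) \<longlongrightarrow> error_covariance) ?F"
    and X: "((\<lambda>p. snd (snd p)) \<longlongrightarrow> X0) ?F"
    using tendsto_fst[OF filterlim_ident[of ?F]] tendsto_fst[OF tendsto_snd[OF filterlim_ident[of ?F]]]
      tendsto_snd[OF tendsto_snd[OF filterlim_ident[of ?F]]] by simp_all
  have lim: "(1 / real CARD('d)) * (s * real CARD('d)) = s" by simp
  have "(?sig \<longlongrightarrow> (1 / real CARD('d)) * (s * real CARD('d))) ?F"
    unfolding case_prod_beta trace_gram_quotient_limit[symmetric]
    by (intro tendsto_mult tendsto_const tendsto_trace_gram_quotient W E X gram_X0_invertible)
  then have sig: "(?sig \<longlongrightarrow> s) ?F" unfolding lim .
  have "(?VA \<longlongrightarrow> upper_left limit_moment - s *\<^sub>R upper_left error_covariance) ?F"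
    using sig unfolding case_prod_beta fst_conv snd_conv
    by (intro tendsto_diff tendsto_scaleR tendsto_upper_left W E)
  then have VA: "(?VA \<longlongrightarrow> V) ?F" unfolding upper_left_limit_moment .
  have "\<forall>\<^sub>F p in ?F. dist (?sig p) s < \<epsilon> \<and> dist (?VA p) V < \<epsilon>"
    using tendstoD[OF sig \<epsilon>] tendstoD[OF VA \<epsilon>] by (rule eventually_conj)
  then obtain k where k: "k > 0"
    "\<And>p. dist p (limit_moment, error_covariance, X0) < k \<Longrightarrow> dist (?sig p) s < \<epsilon> \<and> dist (?VA p) V < \<epsilon>"
    unfolding eventually_nhds_metric by blast
  have "dist (sigma2_formula m C E X) s < \<epsilon> \<and> dist (VA_formula m C E X) V < \<epsilon>"
    if "norm (weighted_second_moment (\<lambda>_. 1) m C - limit_moment) \<le> k / 4"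
      "norm (E - error_covariance) \<le> k / 4" "norm (X - X0) \<le> k / 4" for m C E X
  proof -
    let ?W = "weighted_second_moment (\<lambda>_. 1) m C"
    have "dist (?W, E, X) (limit_moment, error_covariance, X0)
        \<le> dist ?W limit_moment + dist (E, X) (error_covariance, X0)"
      unfolding dist_Pair_Pair[of ?W] by (rule sqrt_sum_squares_le_sum) auto
    also have "dist (E, X) (error_covariance, X0) \<le> dist E error_covariance + dist X X0"
      unfolding dist_Pair_Pair by (rule sqrt_sum_squares_le_sum) auto
    finally have "dist (?W, E, X) (limit_moment, error_covariance, X0) < k"
      using that k(1) by (simp add: dist_norm)
    from k(2)[OF this] show ?thesis
      unfolding VA_formula_eq sigma2_formula_eq by simp
  qed
  with k(1) that[of "k / 4"] show thesis by simp
qed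

end

section \<open>Means of sequences and the weak law of large numbers\<close>

text \<open>
  The finitely many large \<open>v i\<close> contribute a bounded sum, and the others a small multiple of the mean of
  \<open>c\<close>.  The domination by \<open>c\<close> covers terms \<open>b i\<close> that are not bounded themselves, such as
  products of regressors.
\<close>

lemma mean_of_vanishing_multiples:
  fixes v b c :: "nat \<Rightarrow> real"
  assumes v: "v \<longlonglongrightarrow> 0" and bc: "\<And>i. \<bar>b i\<bar> \<le> c i"
    and c: "(\<lambda>m. (\<Sum>i<m. c i) / real m) \<longlonglongrightarrow> \<gamma>"
  shows "(\<lambda>m. (\<Sum>i<m. v i * b i) / real m) \<longlonglongrightarrow> 0"
proof (rule LIMSEQ_I)
  fix \<epsilon> :: real assume \<epsilon>: "\<epsilon> > 0"
  have c0: "0 \<le> c i" for i using bc[of i] by linarith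
  obtain B where B: "B > 0" "\<And>m. \<bar>(\<Sum>i<m. c i) / real m\<bar> \<le> B"
    using convergent_imp_Bseq[OF convergentI[OF c]] unfolding Bseq_def by auto
  obtain N where N: "\<And>i. i \<ge> N \<Longrightarrow> \<bar>v i\<bar> < \<epsilon> / (2 * B)"
    using LIMSEQ_D[OF v, of "\<epsilon> / (2 * B)"] \<epsilon> B(1) by auto
  define D where "D = (\<Sum>i<N. \<bar>v i * b i\<bar>)"
  have D0: "D \<ge> 0" by (simp add: D_def sum_nonneg)
  obtain N' where N': "2 * D / \<epsilon> < real N'" using reals_Archimedean2 by blast
  have "norm ((\<Sum>i<m. v i * b i) / real m - 0) < \<epsilon>" if m: "m \<ge> max (Suc N') N" for m
  proof -
    have m0: "real m > 0" using m by simp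
    have "\<bar>\<Sum>i<m. v i * b i\<bar> \<le> (\<Sum>i<m. \<bar>v i * b i\<bar>)" by (rule sum_abs)
    also have "\<dots> \<le> (\<Sum>i<m. (if i < N then \<bar>v i * b i\<bar> else 0) + \<epsilon> / (2 * B) * c i)"
    proof (rule sum_mono)
      fix i
      show "\<bar>v i * b i\<bar> \<le> (if i < N then \<bar>v i * b i\<bar> else 0) + \<epsilon> / (2 * B) * c i"
      proof (cases "i < N")
        case True
        then show ?thesis using c0[of i] \<epsilon> B(1) by simp
      next
        case False
        then have "\<bar>v i\<bar> * \<bar>b i\<bar> \<le> \<epsilon> / (2 * B) * c i"
          using N[of i] bc[of i] \<epsilon> B(1) by (intro mult_mono) auto
        then show ?thesis using False by (simp add: abs_mult)
      qed
    qed
    also have "\<dots> = D + \<epsilon> / (2 * B) * (\<Sum>i<m. c i)"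
    proof -
      have "(\<Sum>i<m. if i < N then \<bar>v i * b i\<bar> else 0) = (\<Sum>i\<in>{..<m} \<inter> {i. i < N}. \<bar>v i * b i\<bar>)"
        by (simp add: sum.inter_restrict)
      also have "{..<m} \<inter> {i. i < N} = {..<N}" using m by auto
      finally show ?thesis by (simp add: sum.distrib D_def sum_distrib_left)
    qed
    also have "\<dots> \<le> D + \<epsilon> / (2 * B) * (B * real m)"
      using B(2)[of m] m0 \<epsilon> B(1) c0
      by (intro add_left_mono mult_left_mono) (auto simp: sum_nonneg pos_divide_le_eq)
    also have "\<dots> = D + \<epsilon> / 2 * real m" using B(1) by simp
    also have "\<dots> < \<epsilon> / 2 * real m + \<epsilon> / 2 * real m"
    proof -
      have "real N' < real m" using m by linarith
      then have "2 * D / \<epsilon> < real m" using N' by linarith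
      then have "D < \<epsilon> / 2 * real m" using \<epsilon> by (simp add: field_simps)
      then show ?thesis by simp
    qed
    finally have "\<bar>\<Sum>i<m. v i * b i\<bar> < \<epsilon> * real m" by simp
    then show ?thesis using m0 by (simp add: pos_divide_less_eq)
  qed
  then show "\<exists>no. \<forall>m\<ge>no. norm ((\<Sum>i<m. v i * b i) / real m - 0) < \<epsilon>" by blast
qed

lemma mean_const: "(\<lambda>m. (\<Sum>i<m. (1::real)) / real m) \<longlonglongrightarrow> 1"
proof -
  have "\<forall>\<^sub>F m in sequentially. (1::real) = (\<Sum>i<m. (1::real)) / real m"
    using eventually_gt_at_top[of 0] by eventually_elim simp
  then show ?thesis by (rule Lim_transform_eventually[OF tendsto_const])
qed

lemma mean_of_convergent:
  fixes x :: "nat \<Rightarrow> real"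
  assumes "x \<longlonglongrightarrow> l"
  shows "(\<lambda>m. (\<Sum>i<m. x i) / real m) \<longlonglongrightarrow> l"
proof -
  have "(\<lambda>i. x i - l) \<longlonglongrightarrow> 0" using assms LIM_zero by blast
  then have "(\<lambda>m. (\<Sum>i<m. (x i - l) * 1) / real m) \<longlonglongrightarrow> 0"
    by (rule mean_of_vanishing_multiples[OF _ _ mean_const]) simp
  from tendsto_add[OF this tendsto_mult_left[OF mean_const, of l]]
  have "(\<lambda>m. (\<Sum>i<m. (x i - l) * 1) / real m + l * ((\<Sum>i<m. 1) / real m)) \<longlonglongrightarrow> l" by simp
  moreover have "(\<Sum>i<m. (x i - l) * 1) / real m + l * ((\<Sum>i<m. 1) / real m) = (\<Sum>i<m. x i) / real m" for m
    by (cases "m = 0") (simp_all add: sum_subtractf diff_divide_distrib)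
  ultimately show ?thesis by simp
qed

lemma sample_mean_of_convergent:
  fixes f :: "nat \<Rightarrow> real^'k^'l"
  assumes "f \<longlonglongrightarrow> L"
  shows "(\<lambda>m. sample_mean m f) \<longlonglongrightarrow> L"
proof (intro vec_tendstoI)
  fix p q
  have "(\<lambda>m. (\<Sum>i<m. f i $ p $ q) / real m) \<longlonglongrightarrow> L $ p $ q"
    by (intro mean_of_convergent tendsto_vec_nth[OF tendsto_vec_nth[OF assms]])
  then show "(\<lambda>m. sample_mean m f $ p $ q) \<longlonglongrightarrow> L $ p $ q"
    by (simp add: sample_mean_def)
qed

lemma borel_measurable_vec_nth: "(\<lambda>x::real^'k. x $ p) \<in> borel_measurable borel"
  by (intro borel_measurable_continuous_onI linear_continuous_on bounded_linear_vec_nth)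

context prob_space
begin

text \<open>
  A form of the continuous mapping theorem for a quantity \<open>Q\<close> which is close to its limit whenever finitely
  many convergent quantities are; \<open>Q\<close> itself can be arbitrary outside this event.
\<close>

lemma tendsto_in_probability_controlled:
  fixes Y :: "'i \<Rightarrow> nat \<Rightarrow> 'a \<Rightarrow> 'b::metric_space" and Q :: "nat \<Rightarrow> 'a \<Rightarrow> 'c::metric_space"
  assumes I: "finite I"
    and Y: "\<And>j. j \<in> I \<Longrightarrow> tendsto_in_probability M (Y j) (y j)"
    and meas: "\<And>j m h. j \<in> I \<Longrightarrow> {\<omega> \<in> space M. dist (Y j m \<omega>) (y j) > h} \<in> sets M"
    and ctrl: "\<And>\<epsilon>. \<epsilon> > 0 \<Longrightarrow> \<exists>h>0. \<forall>\<^sub>F m in sequentially. \<forall>\<omega>\<in>space M.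
      (\<forall>j\<in>I. dist (Y j m \<omega>) (y j) \<le> h) \<longrightarrow> dist (Q m \<omega>) q \<le> \<epsilon>"
  shows "tendsto_in_probability M Q q"
  unfolding tendsto_in_probability_def
proof (intro allI impI)
  fix \<epsilon> :: real assume "\<epsilon> > 0"
  then obtain h where h: "h > 0" and ev: "\<forall>\<^sub>F m in sequentially. \<forall>\<omega>\<in>space M.
      (\<forall>j\<in>I. dist (Y j m \<omega>) (y j) \<le> h) \<longrightarrow> dist (Q m \<omega>) q \<le> \<epsilon>"
    using ctrl by blast
  let ?B = "\<lambda>j m. {\<omega> \<in> space M. dist (Y j m \<omega>) (y j) > h}"
  have "\<forall>\<^sub>F m in sequentially. prob {\<omega> \<in> space M. dist (Q m \<omega>) q > \<epsilon>} \<le> (\<Sum>j\<in>I. prob (?B j m))"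
    using ev
  proof eventually_elim
    case (elim m)
    then have "{\<omega> \<in> space M. dist (Q m \<omega>) q > \<epsilon>} \<subseteq> (\<Union>j\<in>I. ?B j m)"
      by (auto simp: not_le[symmetric])
    then have "prob {\<omega> \<in> space M. dist (Q m \<omega>) q > \<epsilon>} \<le> prob (\<Union>j\<in>I. ?B j m)"
      using I meas by (intro finite_measure_mono sets.finite_UN) auto
    also have "\<dots> \<le> (\<Sum>j\<in>I. prob (?B j m))"
      using I meas by (intro finite_measure_subadditive_finite) auto
    finally show ?case .
  qed
  moreover have "(\<lambda>m. \<Sum>j\<in>I. prob (?B j m)) \<longlonglongrightarrow> (\<Sum>j\<in>I. 0)"
    using Y h unfolding tendsto_in_probability_def by (intro tendsto_sum) auto
  then have "(\<lambda>m. \<Sum>j\<in>I. prob (?B j m)) \<longlonglongrightarrow> 0" by simp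
  ultimately show "(\<lambda>m. prob {\<omega> \<in> space M. dist (Q m \<omega>) q > \<epsilon>}) \<longlonglongrightarrow> 0"
    by (rule tendsto_sandwich[OF always_eventually[OF allI[OF measure_nonneg]] _ tendsto_const])
qed

lemma square_sum_of_centred_independent:
  fixes Z :: "nat \<Rightarrow> 'a \<Rightarrow> real"
  assumes indep: "indep_vars (\<lambda>_. borel) Z UNIV"
    and int: "\<And>i. integrable M (\<lambda>\<omega>. (Z i \<omega>)\<^sup>2)" and int1: "\<And>i. integrable M (Z i)"
    and centred: "\<And>i. expectation (Z i) = 0"
  shows "integrable M (\<lambda>\<omega>. (\<Sum>i<m. Z i \<omega>)\<^sup>2) \<and>
    expectation (\<lambda>\<omega>. (\<Sum>i<m. Z i \<omega>)\<^sup>2) = (\<Sum>i<m. expectation (\<lambda>\<omega>. (Z i \<omega>)\<^sup>2))"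
proof (induction m)
  case (Suc m)
  let ?S = "\<lambda>\<omega>. \<Sum>i<m. Z i \<omega>"
  have S1: "integrable M ?S" using int1 by auto
  have ind: "indep_var borel (Z m) borel ?S"
    by (rule indep_vars_sum) (auto intro: indep_vars_subset[OF indep])
  have ZS: "integrable M (\<lambda>\<omega>. Z m \<omega> * ?S \<omega>)" "expectation (\<lambda>\<omega>. Z m \<omega> * ?S \<omega>) = 0"
    using indep_var_integrable[OF ind int1 S1] indep_var_lebesgue_integral[OF ind int1 S1] centred
    by simp_all
  have eq: "(\<lambda>\<omega>. (\<Sum>i<Suc m. Z i \<omega>)\<^sup>2) = (\<lambda>\<omega>. (?S \<omega>)\<^sup>2 + (Z m \<omega>)\<^sup>2 + 2 * (Z m \<omega> * ?S \<omega>))"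
    by (simp add: fun_eq_iff power2_sum algebra_simps)
  show ?case unfolding eq using Suc.IH int[of m] ZS by simp
qed simp

text \<open>
  Chebyshev's inequality.  Second moments replace variances in the hypothesis, which spares centring in
  the applications.
\<close>

lemma weak_law_of_large_numbers:
  fixes Y :: "nat \<Rightarrow> 'a \<Rightarrow> real"
  assumes indep: "indep_vars (\<lambda>_. borel) Y UNIV"
    and int: "\<And>i. integrable M (\<lambda>\<omega>. (Y i \<omega>)\<^sup>2)"
    and var: "(\<lambda>m. (\<Sum>i<m. expectation (\<lambda>\<omega>. (Y i \<omega>)\<^sup>2)) / (real m)\<^sup>2) \<longlonglongrightarrow> 0"
    and mean: "(\<lambda>m. (\<Sum>i<m. expectation (Y i)) / real m) \<longlonglongrightarrow> \<mu>"
  shows "tendsto_in_probability M (\<lambda>m \<omega>. (\<Sum>i<m. Y i \<omega>) / real m) \<mu>"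
  unfolding tendsto_in_probability_def
proof (intro allI impI)
  fix \<epsilon> :: real assume \<epsilon>: "\<epsilon> > 0"
  have rv [measurable]: "Y i \<in> borel_measurable M" for i
    using indep unfolding indep_vars_def by auto
  have int1: "integrable M (Y i)" for i
    using square_integrable_imp_integrable[OF rv int] .
  define e where "e i = expectation (Y i)" for i
  define Z where "Z i \<omega> = Y i \<omega> - e i" for i \<omega>
  have Zind: "indep_vars (\<lambda>_. borel) Z UNIV"
    unfolding Z_def by (rule indep_vars_compose2[OF indep]) simp
  have Zint: "integrable M (Z i)" "expectation (Z i) = 0" for i
    using int1[of i] unfolding Z_def by (auto simp: e_def prob_space)
  have Z2: "integrable M (\<lambda>\<omega>. (Z i \<omega>)\<^sup>2)" for i
    using int[of i] int1[of i] unfolding Z_def power2_diff by auto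
  have EZ2: "expectation (\<lambda>\<omega>. (Z i \<omega>)\<^sup>2) \<le> expectation (\<lambda>\<omega>. (Y i \<omega>)\<^sup>2)" for i
    using variance_eq[OF int1 int, of i] unfolding Z_def e_def by simp
  note sq = square_sum_of_centred_independent[OF Zind Z2 Zint]
  let ?Q = "\<lambda>m. (\<Sum>i<m. expectation (\<lambda>\<omega>. (Y i \<omega>)\<^sup>2)) / (real m)\<^sup>2"
  have "\<forall>\<^sub>F m in sequentially. \<bar>(\<Sum>i<m. e i) / real m - \<mu>\<bar> < \<epsilon> / 2"
    using tendstoD[OF mean, of "\<epsilon> / 2"] \<epsilon> by (simp add: dist_real_def e_def)
  then have "\<forall>\<^sub>F m in sequentially. prob {\<omega> \<in> space M. dist ((\<Sum>i<m. Y i \<omega>) / real m) \<mu> > \<epsilon>}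
      \<le> 4 / \<epsilon>\<^sup>2 * ?Q m"
    using eventually_gt_at_top[of 0]
  proof eventually_elim
    case (elim m)
    let ?S = "\<lambda>\<omega>. \<Sum>i<m. Z i \<omega>"
    have ES: "expectation ?S = 0" using Zint by simp
    have a: "\<epsilon> / 2 * real m > 0" using elim(2) \<epsilon> by simp
    have [measurable]: "Z i \<in> borel_measurable M" for i unfolding Z_def by measurable
    have "{\<omega> \<in> space M. dist ((\<Sum>i<m. Y i \<omega>) / real m) \<mu> > \<epsilon>}
        \<subseteq> {\<omega> \<in> space M. \<bar>?S \<omega> - expectation ?S\<bar> \<ge> \<epsilon> / 2 * real m}"
    proof (rule subsetI)
      fix \<omega> assume \<omega>: "\<omega> \<in> {\<omega> \<in> space M. dist ((\<Sum>i<m. Y i \<omega>) / real m) \<mu> > \<epsilon>}"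
      then have *: "\<epsilon> < \<bar>(\<Sum>i<m. Y i \<omega>) / real m - \<mu>\<bar>" by (simp add: dist_real_def)
      have "(\<Sum>i<m. Y i \<omega>) / real m - \<mu> = ?S \<omega> / real m + ((\<Sum>i<m. e i) / real m - \<mu>)"
        by (simp add: Z_def sum_subtractf diff_divide_distrib)
      then have "\<epsilon> / 2 < \<bar>?S \<omega> / real m\<bar>" using * elim(1) by linarith
      then have "\<epsilon> / 2 * real m \<le> \<bar>?S \<omega>\<bar>" using elim(2) by (simp add: field_simps)
      then show "\<omega> \<in> {\<omega> \<in> space M. \<bar>?S \<omega> - expectation ?S\<bar> \<ge> \<epsilon> / 2 * real m}"
        using \<omega> by (simp add: ES)
    qed
    then have "prob {\<omega> \<in> space M. dist ((\<Sum>i<m. Y i \<omega>) / real m) \<mu> > \<epsilon>}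
        \<le> prob {\<omega> \<in> space M. \<bar>?S \<omega> - expectation ?S\<bar> \<ge> \<epsilon> / 2 * real m}"
      by (intro finite_measure_mono) auto
    also have "\<dots> \<le> variance ?S / (\<epsilon> / 2 * real m)\<^sup>2"
      using sq[of m] by (intro Chebyshev_inequality a) auto
    also have "\<dots> = (\<Sum>i<m. expectation (\<lambda>\<omega>. (Z i \<omega>)\<^sup>2)) / (\<epsilon> / 2 * real m)\<^sup>2"
      using sq[of m] by (simp add: ES)
    also have "\<dots> \<le> (\<Sum>i<m. expectation (\<lambda>\<omega>. (Y i \<omega>)\<^sup>2)) / (\<epsilon> / 2 * real m)\<^sup>2"
      by (intro divide_right_mono sum_mono EZ2) simp
    also have "\<dots> = 4 / \<epsilon>\<^sup>2 * ?Q m" by (simp add: power_mult_distrib power_divide)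
    finally show ?case .
  qed
  moreover have "(\<lambda>m. 4 / \<epsilon>\<^sup>2 * ?Q m) \<longlonglongrightarrow> 0"
    using tendsto_mult_right_zero[OF var] by blast
  ultimately show "(\<lambda>m. prob {\<omega> \<in> space M. dist ((\<Sum>i<m. Y i \<omega>) / real m) \<mu> > \<epsilon>}) \<longlonglongrightarrow> 0"
    by (rule tendsto_sandwich[OF always_eventually[OF allI[OF measure_nonneg]] _ tendsto_const])
qed

text \<open>
  One entry of a weighted moment matrix.  The deterministic products \<open>a b\<close> are split off first, because
  their squares need not have controlled means; the second moments of the remaining terms
  \<open>a f + b e + e f\<close> are at most of the order \<open>1 + c\<close>.
\<close>

lemma weighted_cross_moment_tendsto_in_probability:
  fixes e f :: "nat \<Rightarrow> 'a \<Rightarrow> real" and a b c w :: "nat \<Rightarrow> real"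
  assumes indep: "indep_vars (\<lambda>_. borel) (\<lambda>i \<omega>. (e i \<omega>, f i \<omega>)) UNIV"
    and int: "\<And>i. integrable M (\<lambda>\<omega>. (e i \<omega>)^4)" "\<And>i. integrable M (\<lambda>\<omega>. (f i \<omega>)^4)"
    and K: "\<And>i. expectation (\<lambda>\<omega>. (e i \<omega>)^4) \<le> K" "\<And>i. expectation (\<lambda>\<omega>. (f i \<omega>)^4) \<le> K"
    and mean: "\<And>i. expectation (e i) = 0" "\<And>i. expectation (f i) = 0"
    and cov: "(\<lambda>i. expectation (\<lambda>\<omega>. e i \<omega> * f i \<omega>)) \<longlonglongrightarrow> \<eta>"
    and ab: "(\<lambda>m. (\<Sum>i<m. a i * b i) / real m) \<longlonglongrightarrow> \<alpha>"
    and abc: "\<And>i. (a i)\<^sup>2 \<le> c i" "\<And>i. (b i)\<^sup>2 \<le> c i"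
    and c: "(\<lambda>m. (\<Sum>i<m. c i) / real m) \<longlonglongrightarrow> \<gamma>"
    and w: "w \<longlonglongrightarrow> 1"
  shows "tendsto_in_probability M
    (\<lambda>m \<omega>. (\<Sum>i<m. w i * ((a i + e i \<omega>) * (b i + f i \<omega>))) / real m) (\<alpha> + \<eta>)"
proof -
  have rv: "(\<lambda>\<omega>. (e i \<omega>, f i \<omega>)) \<in> borel_measurable M" for i
    using indep unfolding indep_vars_def by blast
  have [measurable]: "e i \<in> borel_measurable M" "f i \<in> borel_measurable M" for i
    using measurable_compose[OF rv, of fst borel] measurable_compose[OF rv, of snd borel]
    by (simp_all add: borel_measurable_continuous_onI continuous_on_fst continuous_on_snd)
  have sq_le: "x\<^sup>2 \<le> 1 + x^4" for x :: real
  proof -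
    have "2 * x\<^sup>2 \<le> x^4 + 1" using sum_squares_bound[of "x\<^sup>2" 1] by simp
    then show ?thesis using zero_le_power2[of x] by linarith
  qed
  have square_integrable: "integrable M (\<lambda>\<omega>. (x \<omega>)\<^sup>2)"
    if "integrable M (\<lambda>\<omega>. (x \<omega>)^4)" "x \<in> borel_measurable M" for x :: "'a \<Rightarrow> real"
  proof (rule Bochner_Integration.integrable_bound)
    show "integrable M (\<lambda>\<omega>. 1 + (x \<omega>)^4)" using that(1) by simp
    show "(\<lambda>\<omega>. (x \<omega>)\<^sup>2) \<in> borel_measurable M" using that(2) by simp
    have "norm ((x \<omega>)\<^sup>2) \<le> norm (1 + (x \<omega>)^4)" for \<omega>
      using sq_le[of "x \<omega>"] by simp
    then show "AE \<omega> in M. norm ((x \<omega>)\<^sup>2) \<le> norm (1 + (x \<omega>)^4)" by simp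
  qed
  have e2: "integrable M (\<lambda>\<omega>. (e i \<omega>)\<^sup>2)" and f2: "integrable M (\<lambda>\<omega>. (f i \<omega>)\<^sup>2)" for i
    by (rule square_integrable; use int in simp)+
  have e1: "integrable M (e i)" and f1: "integrable M (f i)" for i
    using square_integrable_imp_integrable[OF _ e2] square_integrable_imp_integrable[OF _ f2] by simp_all
  have ef_le: "\<bar>x * y\<bar> \<le> x\<^sup>2 + y\<^sup>2" for x y :: real
  proof -
    have "2 * \<bar>x * y\<bar> \<le> x\<^sup>2 + y\<^sup>2"
      using sum_squares_bound[of "\<bar>x\<bar>" "\<bar>y\<bar>"] by (simp add: abs_mult)
    then show ?thesis by linarith
  qed
  have ef: "integrable M (\<lambda>\<omega>. e i \<omega> * f i \<omega>)" for i
  proof (rule Bochner_Integration.integrable_bound)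
    show "integrable M (\<lambda>\<omega>. (e i \<omega>)\<^sup>2 + (f i \<omega>)\<^sup>2)" using e2[of i] f2[of i] by simp
    have "norm (e i \<omega> * f i \<omega>) \<le> norm ((e i \<omega>)\<^sup>2 + (f i \<omega>)\<^sup>2)" for \<omega>
      using ef_le[of "e i \<omega>" "f i \<omega>"] by simp
    then show "AE \<omega> in M. norm (e i \<omega> * f i \<omega>) \<le> norm ((e i \<omega>)\<^sup>2 + (f i \<omega>)\<^sup>2)" by simp
  qed simp
  define Y where "Y i \<omega> = w i * (a i * f i \<omega> + b i * e i \<omega> + e i \<omega> * f i \<omega>)" for i \<omega>
  have Yind: "indep_vars (\<lambda>_. borel) Y UNIV"
  proof -
    have "indep_vars (\<lambda>_. borel)
        (\<lambda>i \<omega>. (\<lambda>p. w i * (a i * snd p + b i * fst p + fst p * snd p)) (e i \<omega>, f i \<omega>)) UNIV"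
      by (rule indep_vars_compose2[OF indep])
         (intro borel_measurable_continuous_onI continuous_intros)
    then show ?thesis by (simp add: Y_def[abs_def])
  qed
  have EY: "expectation (Y i) = w i * expectation (\<lambda>\<omega>. e i \<omega> * f i \<omega>)" for i
    unfolding Y_def using e1[of i] f1[of i] ef[of i] mean by simp
  have three: "(x + y + z)\<^sup>2 \<le> 3 * (x\<^sup>2 + y\<^sup>2 + z\<^sup>2)" for x y z :: real
  proof -
    have "0 \<le> (x - y)\<^sup>2 + (y - z)\<^sup>2 + (x - z)\<^sup>2" by simp
    then show ?thesis by (simp add: power2_eq_square algebra_simps)
  qed
  define g where "g i \<omega> = (w i)\<^sup>2 * (3 * (c i * (1 + (f i \<omega>)^4) + c i * (1 + (e i \<omega>)^4) + ((e i \<omega>)^4 + (f i \<omega>)^4)))" for i \<omega>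
  have Yg: "(Y i \<omega>)\<^sup>2 \<le> g i \<omega>" for i \<omega>
  proof -
    have "(a i * f i \<omega> + b i * e i \<omega> + e i \<omega> * f i \<omega>)\<^sup>2
        \<le> 3 * ((a i * f i \<omega>)\<^sup>2 + (b i * e i \<omega>)\<^sup>2 + (e i \<omega> * f i \<omega>)\<^sup>2)" by (rule three)
    moreover have "(a i * f i \<omega>)\<^sup>2 \<le> c i * (1 + (f i \<omega>)^4)"
      unfolding power_mult_distrib using abc(1)[of i] sq_le by (intro mult_mono) (auto intro: order_trans[OF zero_le_power2])
    moreover have "(b i * e i \<omega>)\<^sup>2 \<le> c i * (1 + (e i \<omega>)^4)"
      unfolding power_mult_distrib using abc(2)[of i] sq_le by (intro mult_mono) (auto intro: order_trans[OF zero_le_power2])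
    moreover have "(e i \<omega> * f i \<omega>)\<^sup>2 \<le> (e i \<omega>)^4 + (f i \<omega>)^4"
      using ef_le[of "(e i \<omega>)\<^sup>2" "(f i \<omega>)\<^sup>2"] by (simp add: power_mult_distrib)
    ultimately show ?thesis
      unfolding Y_def g_def power_mult_distrib[of "w i"] by (intro mult_left_mono) auto
  qed
  have gint: "integrable M (g i)" for i
    unfolding g_def using int[of i] by auto
  have Y2: "integrable M (\<lambda>\<omega>. (Y i \<omega>)\<^sup>2)" for i
  proof (rule Bochner_Integration.integrable_bound[OF gint[of i]])
    show "(\<lambda>\<omega>. (Y i \<omega>)\<^sup>2) \<in> borel_measurable M" unfolding Y_def by measurable
    have "norm ((Y i \<omega>)\<^sup>2) \<le> norm (g i \<omega>)" for \<omega> using Yg[of i \<omega>] by simp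
    then show "AE \<omega> in M. norm ((Y i \<omega>)\<^sup>2) \<le> norm (g i \<omega>)" by simp
  qed
  have K0: "K \<ge> 0" using K(1)[of 0] by (rule order_trans[rotated]) simp
  obtain B where B: "B > 0" "\<And>i. \<bar>w i\<bar> \<le> B"
    using convergent_imp_Bseq[OF convergentI[OF w]] unfolding Bseq_def by auto
  have c0: "0 \<le> c i" for i using abc(1)[of i] by (rule order_trans[OF zero_le_power2])
  define G where "G i = B\<^sup>2 * (3 * (2 * (1 + K) * c i + 2 * K))" for i
  have EY2: "expectation (\<lambda>\<omega>. (Y i \<omega>)\<^sup>2) \<le> G i" for i
  proof -
    have "expectation (\<lambda>\<omega>. (Y i \<omega>)\<^sup>2) \<le> expectation (g i)"
      by (rule integral_mono[OF Y2 gint Yg])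
    also have "\<dots> = (w i)\<^sup>2 * (3 * (c i * (1 + expectation (\<lambda>\<omega>. (f i \<omega>)^4))
        + c i * (1 + expectation (\<lambda>\<omega>. (e i \<omega>)^4))
        + (expectation (\<lambda>\<omega>. (e i \<omega>)^4) + expectation (\<lambda>\<omega>. (f i \<omega>)^4))))"
      unfolding g_def using int[of i] by (simp add: prob_space)
    also have "\<dots> \<le> B\<^sup>2 * (3 * (c i * (1 + K) + c i * (1 + K) + (K + K)))"
    proof (rule mult_mono)
      show "(w i)\<^sup>2 \<le> B\<^sup>2" using B abs_le_square_iff[of "w i" B] by simp
      show "3 * (c i * (1 + expectation (\<lambda>\<omega>. (f i \<omega>)^4)) + c i * (1 + expectation (\<lambda>\<omega>. (e i \<omega>)^4))
          + (expectation (\<lambda>\<omega>. (e i \<omega>)^4) + expectation (\<lambda>\<omega>. (f i \<omega>)^4)))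
          \<le> 3 * (c i * (1 + K) + c i * (1 + K) + (K + K))"
        using K[of i] c0[of i] by (intro mult_left_mono add_mono order_refl) auto
      have "0 \<le> expectation (\<lambda>\<omega>. (e i \<omega>)^4)" "0 \<le> expectation (\<lambda>\<omega>. (f i \<omega>)^4)" by simp_all
      then show "0 \<le> 3 * (c i * (1 + expectation (\<lambda>\<omega>. (f i \<omega>)^4)) + c i * (1 + expectation (\<lambda>\<omega>. (e i \<omega>)^4))
          + (expectation (\<lambda>\<omega>. (e i \<omega>)^4) + expectation (\<lambda>\<omega>. (f i \<omega>)^4)))"
        using c0[of i] by (intro mult_nonneg_nonneg add_nonneg_nonneg) auto
    qed simp
    also have "\<dots> = G i" by (simp add: G_def algebra_simps)
    finally show ?thesis .
  qed
  have "(\<lambda>m. (\<Sum>i<m. G i) / real m * (1 / real m)) \<longlonglongrightarrow> B\<^sup>2 * (3 * (2 * (1 + K) * \<gamma> + 2 * K * 1)) * 0"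
  proof (rule tendsto_mult)
    have "(\<lambda>m. B\<^sup>2 * (3 * (2 * (1 + K) * ((\<Sum>i<m. c i) / real m) + 2 * K * ((\<Sum>i<m. 1) / real m))))
      \<longlonglongrightarrow> B\<^sup>2 * (3 * (2 * (1 + K) * \<gamma> + 2 * K * 1))"
      by (intro tendsto_mult tendsto_add tendsto_const c mean_const)
    moreover have "B\<^sup>2 * (3 * (2 * (1 + K) * ((\<Sum>i<m. c i) / real m) + 2 * K * ((\<Sum>i<m. 1) / real m)))
      = (\<Sum>i<m. G i) / real m" for m
      unfolding G_def sum_distrib_left[symmetric] sum.distrib
      by (simp add: add_divide_distrib distrib_left)
    ultimately show "(\<lambda>m. (\<Sum>i<m. G i) / real m) \<longlonglongrightarrow> B\<^sup>2 * (3 * (2 * (1 + K) * \<gamma> + 2 * K * 1))"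
      by simp
  qed (rule lim_1_over_n)
  then have Gm: "(\<lambda>m. (\<Sum>i<m. G i) / (real m)\<^sup>2) \<longlonglongrightarrow> 0"
    by (simp add: power2_eq_square)
  have var: "(\<lambda>m. (\<Sum>i<m. expectation (\<lambda>\<omega>. (Y i \<omega>)\<^sup>2)) / (real m)\<^sup>2) \<longlonglongrightarrow> 0"
    by (rule tendsto_sandwich[OF _ _ tendsto_const Gm])
       (auto intro!: always_eventually divide_right_mono sum_mono EY2 divide_nonneg_nonneg sum_nonneg)
  have meanY: "(\<lambda>m. (\<Sum>i<m. expectation (Y i)) / real m) \<longlonglongrightarrow> 1 * \<eta>"
    unfolding EY by (intro mean_of_convergent tendsto_mult w cov)
  have tip: "tendsto_in_probability M (\<lambda>m \<omega>. (\<Sum>i<m. Y i \<omega>) / real m) \<eta>"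
    using weak_law_of_large_numbers[OF Yind Y2 var meanY] by simp
  have "(\<lambda>i. w i - 1) \<longlonglongrightarrow> 0" using w LIM_zero by blast
  moreover have "\<bar>a i * b i\<bar> \<le> c i" for i
    using sum_squares_bound[of "\<bar>a i\<bar>" "\<bar>b i\<bar>"] abc[of i] by (simp add: abs_mult)
  ultimately have "(\<lambda>m. (\<Sum>i<m. (w i - 1) * (a i * b i)) / real m) \<longlonglongrightarrow> 0"
    by (rule mean_of_vanishing_multiples[OF _ _ c])
  from tendsto_add[OF this ab] have det: "(\<lambda>m. (\<Sum>i<m. w i * (a i * b i)) / real m) \<longlonglongrightarrow> \<alpha>"
    by (simp add: left_diff_distrib sum_subtractf diff_divide_distrib)
  have split: "(\<Sum>i<m. w i * ((a i + e i \<omega>) * (b i + f i \<omega>))) / real m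
      = (\<Sum>i<m. w i * (a i * b i)) / real m + (\<Sum>i<m. Y i \<omega>) / real m" for m \<omega>
    unfolding Y_def add_divide_distrib[symmetric] sum.distrib[symmetric]
    by (simp add: algebra_simps)
  show ?thesis
  proof (rule tendsto_in_probability_controlled[where I = "{()}" and Y = "\<lambda>_ m \<omega>. (\<Sum>i<m. Y i \<omega>) / real m" and y = "\<lambda>_. \<eta>"])
    show "{\<omega> \<in> space M. h < dist ((\<Sum>i<m. Y i \<omega>) / real m) \<eta>} \<in> sets M" for m h
      unfolding Y_def by measurable
    fix \<epsilon> :: real assume \<epsilon>: "\<epsilon> > 0"
    have "\<forall>\<^sub>F m in sequentially. dist ((\<Sum>i<m. w i * (a i * b i)) / real m) \<alpha> < \<epsilon> / 2"
      using \<epsilon> by (intro tendstoD[OF det]) simp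
    then have "\<forall>\<^sub>F m in sequentially. \<forall>\<omega>\<in>space M. (\<forall>j\<in>{()}. dist ((\<Sum>i<m. Y i \<omega>) / real m) \<eta> \<le> \<epsilon> / 2)
        \<longrightarrow> dist ((\<Sum>i<m. w i * ((a i + e i \<omega>) * (b i + f i \<omega>))) / real m) (\<alpha> + \<eta>) \<le> \<epsilon>"
    proof eventually_elim
      case (elim m)
      show ?case
      proof (intro ballI impI)
        fix \<omega> assume "\<forall>j\<in>{()}. dist ((\<Sum>i<m. Y i \<omega>) / real m) \<eta> \<le> \<epsilon> / 2"
        then have "\<bar>(\<Sum>i<m. Y i \<omega>) / real m - \<eta>\<bar> \<le> \<epsilon> / 2" by (simp add: dist_real_def)
        then show "dist ((\<Sum>i<m. w i * ((a i + e i \<omega>) * (b i + f i \<omega>))) / real m) (\<alpha> + \<eta>) \<le> \<epsilon>"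
          using elim unfolding split dist_real_def by linarith
      qed
    qed
    then show "\<exists>h>0. \<forall>\<^sub>F m in sequentially. \<forall>\<omega>\<in>space M. (\<forall>j\<in>{()}. dist ((\<Sum>i<m. Y i \<omega>) / real m) \<eta> \<le> h)
        \<longrightarrow> dist ((\<Sum>i<m. w i * ((a i + e i \<omega>) * (b i + f i \<omega>))) / real m) (\<alpha> + \<eta>) \<le> \<epsilon>"
      using \<epsilon> by (intro exI[of _ "\<epsilon> / 2"]) simp
  qed (use tip in auto)
qed

text \<open>
  The diagonal of \<open>A\<close> gives the limit of the mean of \<open>|a i|\<^sup>2\<close>, which dominates the products of any two
  components of \<open>a i\<close>; the entries are then covered one by one.
\<close>

lemma weighted_second_moment_tendsto_in_probability:
  fixes err :: "nat \<Rightarrow> 'a \<Rightarrow> real^'k" and a :: "nat \<Rightarrow> real^'k" and A E :: "real^'k^'k"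
  assumes indep: "indep_vars (\<lambda>_. borel) err UNIV"
    and int: "\<And>i p. integrable M (\<lambda>\<omega>. (err i \<omega> $ p)^4)"
    and K: "\<And>i p. expectation (\<lambda>\<omega>. (err i \<omega> $ p)^4) \<le> K"
    and mean: "\<And>i p. expectation (\<lambda>\<omega>. err i \<omega> $ p) = 0"
    and cov: "\<And>p q. (\<lambda>i. expectation (\<lambda>\<omega>. err i \<omega> $ p * err i \<omega> $ q)) \<longlonglongrightarrow> E $ p $ q"
    and A: "(\<lambda>m. sample_mean m (\<lambda>i. outer (a i) (a i))) \<longlonglongrightarrow> A"
    and w: "w \<longlonglongrightarrow> 1"
  shows "tendsto_in_probability M (\<lambda>m \<omega>. weighted_second_moment w m (\<lambda>i. a i + err i \<omega>)) (A + E)"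
proof -
  have "err i \<in> borel_measurable M" for i
    using indep unfolding indep_vars_def by blast
  from measurable_compose[OF this borel_measurable_vec_nth]
  have [measurable]: "(\<lambda>\<omega>. err i \<omega> $ p) \<in> borel_measurable M" for i p .
  have entryA: "(\<lambda>m. (\<Sum>i<m. a i $ p * a i $ q) / real m) \<longlonglongrightarrow> A $ p $ q" for p q
    using tendsto_vec_nth[OF tendsto_vec_nth[OF A]] by (simp add: sample_mean_def outer_def)
  have normA: "(\<lambda>m. (\<Sum>i<m. (norm (a i))\<^sup>2) / real m) \<longlonglongrightarrow> (\<Sum>p\<in>UNIV. A $ p $ p)"
  proof -
    have "(\<lambda>m. \<Sum>p\<in>UNIV. (\<Sum>i<m. a i $ p * a i $ p) / real m) \<longlonglongrightarrow> (\<Sum>p\<in>UNIV. A $ p $ p)"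
      by (intro tendsto_sum entryA)
    moreover have "(\<Sum>p\<in>UNIV. (\<Sum>i<m. a i $ p * a i $ p) / real m) = (\<Sum>i<m. (norm (a i))\<^sup>2) / real m" for m
      unfolding sum_divide_distrib[symmetric] power2_norm_eq_inner inner_vec_def inner_real_def
      by (subst sum.swap) simp
    ultimately show ?thesis by simp
  qed
  have comp_le: "(a i $ p)\<^sup>2 \<le> (norm (a i))\<^sup>2" for i p
    using component_le_norm_cart[of "a i" p] by (simp add: abs_le_square_iff[symmetric])
  define W where "W p m \<omega> = weighted_second_moment w m (\<lambda>i. a i + err i \<omega>) $ fst p $ snd p" for p m \<omega>
  have W_eq: "W p m \<omega> = (\<Sum>i<m. w i * ((a i $ fst p + err i \<omega> $ fst p) * (a i $ snd p + err i \<omega> $ snd p))) / real m"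
    for p m \<omega>
    by (simp add: W_def weighted_second_moment_def sample_mean_def outer_def)
  have tip: "tendsto_in_probability M (W p) (A $ fst p $ snd p + E $ fst p $ snd p)" for p
    unfolding W_eq[abs_def]
  proof (rule weighted_cross_moment_tendsto_in_probability[OF _ int int K K mean mean cov entryA comp_le comp_le normA w])
    show "indep_vars (\<lambda>_. borel) (\<lambda>i \<omega>. (err i \<omega> $ fst p, err i \<omega> $ snd p)) UNIV"
      by (rule indep_vars_compose2[OF indep])
         (intro borel_measurable_continuous_onI continuous_intros)
  qed
  show ?thesis
  proof (rule tendsto_in_probability_controlled[where I = "UNIV :: ('k \<times> 'k) set" and Y = W
        and y = "\<lambda>p. A $ fst p $ snd p + E $ fst p $ snd p"])
    show "{\<omega> \<in> space M. h < dist (W p m \<omega>) (A $ fst p $ snd p + E $ fst p $ snd p)} \<in> sets M" for p m h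
      unfolding W_eq by measurable
    fix \<epsilon> :: real assume \<epsilon>: "\<epsilon> > 0"
    define h where "h = \<epsilon> / (real CARD('k) * real CARD('k))"
    have "dist (weighted_second_moment w m (\<lambda>i. a i + err i \<omega>)) (A + E) \<le> \<epsilon>"
      if "\<forall>p\<in>UNIV. dist (W p m \<omega>) (A $ fst p $ snd p + E $ fst p $ snd p) \<le> h" for m \<omega>
    proof -
      let ?D = "weighted_second_moment w m (\<lambda>i. a i + err i \<omega>) - (A + E)"
      have ent: "\<bar>?D $ p $ q\<bar> \<le> h" for p q
        using that[rule_format, of "(p, q)"] by (simp add: W_def dist_real_def)
      have "norm ?D \<le> (\<Sum>p\<in>UNIV. norm (?D $ p))"
        unfolding norm_vec_def[of ?D] by (rule L2_set_le_sum) simp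
      also have "\<dots> \<le> (\<Sum>p\<in>UNIV. \<Sum>q\<in>UNIV. \<bar>?D $ p $ q\<bar>)"
        by (intro sum_mono norm_le_l1_cart)
      also have "\<dots> \<le> (\<Sum>p\<in>(UNIV::'k set). \<Sum>q\<in>(UNIV::'k set). h)"
        by (intro sum_mono ent)
      also have "\<dots> = \<epsilon>" by (simp add: h_def)
      finally show ?thesis by (simp add: dist_norm)
    qed
    moreover have "h > 0" using \<epsilon> by (simp add: h_def)
    ultimately show "\<exists>h>0. \<forall>\<^sub>F m in sequentially. \<forall>\<omega>\<in>space M.
        (\<forall>p\<in>UNIV. dist (W p m \<omega>) (A $ fst p $ snd p + E $ fst p $ snd p) \<le> h) \<longrightarrow>
        dist (weighted_second_moment w m (\<lambda>i. a i + err i \<omega>)) (A + E) \<le> \<epsilon>"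
      by (intro exI[of _ h]) simp
  qed (use tip in auto)
qed

end

section \<open>Consistency\<close>

lemma selection_congruence_entry:
  fixes S :: "real^'j^'j" and \<iota> :: "'j::finite \<Rightarrow> 'k::finite"
  assumes "inj \<iota>"
  shows "(transpose (selection \<iota>) ** S ** selection \<iota>) $ \<iota> j $ \<iota> k = S $ j $ k"
  by (simp add: selection_def rows_at_def transpose_def matrix_matrix_mult_def mat_def
      inj_eq[OF assms] if_distrib if_distribR cong: if_cong)

lemma selection_congruence_entry_0:
  fixes S :: "real^'j^'j" and \<iota> :: "'j::finite \<Rightarrow> 'k::finite"
  assumes "p \<notin> range \<iota> \<or> q \<notin> range \<iota>"
  shows "(transpose (selection \<iota>) ** S ** selection \<iota>) $ p $ q = 0"
proof -
  have "(selection \<iota> :: real^'k^'j) $ j $ p = 0 \<or> (selection \<iota> :: real^'k^'j) $ k $ q = 0" for j k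
    using assms unfolding selection_def rows_at_def mat_def by auto
  then show ?thesis
    unfolding matrix_matrix_mult_def transpose_def vec_lambda_beta sum_distrib_right
    by (intro sum.neutral ballI) (metis mult_zero_left mult_zero_right)
qed

lemma sample_mean_outer_congruence:
  fixes A :: "real^'k^'l"
  shows "sample_mean m (\<lambda>i. outer (A *v a i) (A *v a i)) =
    A ** sample_mean m (\<lambda>i. outer (a i) (a i)) ** transpose A"
proof -
  have "sample_mean m (\<lambda>i. outer (A *v a i) (A *v a i)) *v x =
      (A ** sample_mean m (\<lambda>i. outer (a i) (a i)) ** transpose A) *v x" for x
  proof -
    have "sample_mean m (\<lambda>i. outer (A *v a i) (A *v a i)) *v x
        = (1 / real m) *\<^sub>R (\<Sum>i<m. ((A *v a i) \<bullet> x) *\<^sub>R (A *v a i))"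
      by (simp add: sample_mean_def matrix_vector_mult_sum_left outer_vector_mult
          flip: scaleR_matrix_vector_assoc)
    also have "\<dots> = A *v ((1 / real m) *\<^sub>R (\<Sum>i<m. (a i \<bullet> (transpose A *v x)) *\<^sub>R a i))"
      using transpose_matrix_inner[of x A]
      by (simp add: matrix_vector_mult_scaleR linear_sum[OF matrix_vector_mul_linear] inner_commute)
    also have "\<dots> = A *v (sample_mean m (\<lambda>i. outer (a i) (a i)) *v (transpose A *v x))"
      by (simp add: sample_mean_def matrix_vector_mult_sum_left outer_vector_mult
          flip: scaleR_matrix_vector_assoc)
    finally show ?thesis by (simp add: matrix_vector_mul_assoc matrix_mul_assoc)
  qed
  then show ?thesis by (simp add: matrix_eq)
qed

text \<open>
  The limit inherits positive semidefiniteness; nonsingularity makes it definite.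
\<close>

lemma limit_second_moment_pos_def:
  fixes a :: "nat \<Rightarrow> real^'n" and V :: "real^'n^'n"
  assumes lim: "(\<lambda>m. sample_mean m (\<lambda>i. outer (a i) (a i))) \<longlonglongrightarrow> V" and inv: "invertible V"
  shows "pos_def V"
proof (rule pos_def_if_semidefinite_invertible[OF _ _ inv])
  have "transpose (sample_mean m (\<lambda>i. outer (a i) (a i))) = sample_mean m (\<lambda>i. outer (a i) (a i))" for m
    by (simp add: sample_mean_def outer_def transpose_def vec_eq_iff mult.commute)
  then have "(\<lambda>m. sample_mean m (\<lambda>i. outer (a i) (a i))) \<longlonglongrightarrow> transpose V"
    using tendsto_transpose[OF lim] by simp
  then show "transpose V = V" using lim by (rule LIMSEQ_unique)
  fix x
  have "(\<lambda>m. x \<bullet> (sample_mean m (\<lambda>i. outer (a i) (a i)) *v x)) \<longlonglongrightarrow> x \<bullet> (V *v x)"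
    by (intro tendsto_inner tendsto_matrix_vector_mult tendsto_const lim)
  moreover have "0 \<le> x \<bullet> (sample_mean m (\<lambda>i. outer (a i) (a i)) *v x)" for m
    using quadratic_form_weighted_second_moment[of x "\<lambda>_. 1" m a]
    by (simp add: weighted_second_moment_def sum_nonneg)
  ultimately show "0 \<le> x \<bullet> (V *v x)"
    by (intro LIMSEQ_le_const) auto
qed

text \<open>
  Pointwise \<open>x\<^sup>4 \<le> 1 + |x|\<^sup>2\<^sup>r\<close>, as \<open>2 r \<ge> 4\<close>.
\<close>

lemma (in prob_space) fourth_moment_le:
  fixes x :: "'a \<Rightarrow> real"
  assumes x: "x \<in> borel_measurable M" and r: "r \<ge> 2" and B: "B \<ge> 0"
    and le: "(\<integral>\<^sup>+\<omega>. ennreal (\<bar>x \<omega>\<bar> powr (2 * r)) \<partial>M) \<le> ennreal B"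
  shows "integrable M (\<lambda>\<omega>. (x \<omega>)^4) \<and> expectation (\<lambda>\<omega>. (x \<omega>)^4) \<le> 1 + B"
proof -
  note [measurable] = x
  have pt: "y^4 \<le> 1 + \<bar>y\<bar> powr (2 * r)" for y :: real
  proof (cases "\<bar>y\<bar> \<le> 1")
    case True
    then have "\<bar>y\<bar>^4 \<le> 1" by (intro power_le_one) auto
    then have "y^4 \<le> 1" by simp
    then show ?thesis using powr_ge_zero[of "\<bar>y\<bar>" "2 * r"] by linarith
  next
    case False
    then have "\<bar>y\<bar>^4 = \<bar>y\<bar> powr 4" by (simp add: powr_numeral)
    also have "\<dots> \<le> \<bar>y\<bar> powr (2 * r)" using False r by (intro powr_mono) auto
    finally show ?thesis by simp
  qed
  have "(\<integral>\<^sup>+\<omega>. ennreal ((x \<omega>)^4) \<partial>M) \<le> (\<integral>\<^sup>+\<omega>. 1 + ennreal (\<bar>x \<omega>\<bar> powr (2 * r)) \<partial>M)"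
    using pt by (intro nn_integral_mono) (simp add: ennreal_plus[symmetric] ennreal_leI del: ennreal_plus flip: ennreal_1)
  also have "\<dots> = 1 + (\<integral>\<^sup>+\<omega>. ennreal (\<bar>x \<omega>\<bar> powr (2 * r)) \<partial>M)"
    by (subst nn_integral_add) (auto simp: emeasure_space_1)
  also have "\<dots> \<le> 1 + ennreal B" by (intro add_left_mono le)
  also have "\<dots> = ennreal (1 + B)" using B by (simp add: ennreal_plus flip: ennreal_1)
  finally have b: "(\<integral>\<^sup>+\<omega>. ennreal ((x \<omega>)^4) \<partial>M) \<le> ennreal (1 + B)" .
  have int: "integrable M (\<lambda>\<omega>. (x \<omega>)^4)"
  proof (rule integrableI_bounded)
    show "(\<integral>\<^sup>+\<omega>. ennreal (norm ((x \<omega>)^4)) \<partial>M) < \<infinity>"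
      using b by (simp add: le_less_trans[OF _ ennreal_less_top])
  qed measurable
  moreover have "ennreal (expectation (\<lambda>\<omega>. (x \<omega>)^4)) \<le> ennreal (1 + B)"
    using b nn_integral_eq_integral[OF int] by simp
  then have "expectation (\<lambda>\<omega>. (x \<omega>)^4) \<le> 1 + B" using B by (subst (asm) ennreal_le_iff) auto
  ultimately show ?thesis by simp
qed

theorem lemma8:
  fixes M :: "'w measure"
    and X0 :: "real^'d^'n"
    and a0 :: "nat \<Rightarrow> real^'n"
    and err :: "nat \<Rightarrow> 'w \<Rightarrow> real^('n::finite + 'd::finite)"
    and J :: "('n::finite + 'd::finite) set"
    and \<iota> :: "'j::finite \<Rightarrow> 'n::finite + 'd::finite"
    and \<sigma> :: real
    and \<Sigma> :: "nat \<Rightarrow> real^'j^'j"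
    and \<Sigma>_inf :: "real^'j^'j"
    and V_A :: "real^'n^'n"
    and \<mu>4 :: "'n::finite + 'd::finite \<Rightarrow> 'n + 'd \<Rightarrow> 'n + 'd \<Rightarrow> 'n + 'd \<Rightarrow> real"
    and Xhat :: "nat \<Rightarrow> (nat \<Rightarrow> real^('n::finite + 'd::finite)) \<Rightarrow> (real^'d^'n) option"
    and sigma2_hat :: "nat \<Rightarrow> 'w \<Rightarrow> real"
    and VA_hat :: "nat \<Rightarrow> 'w \<Rightarrow> real^'n^'n"
  assumes prob: "prob_space M"
    and J: "bij_betw \<iota> UNIV J"
    and indep: "prob_space.indep_vars M (\<lambda>_. borel) err UNIV"
    and second_moments: "\<And>i. integrable M (\<lambda>\<omega>. (norm (err i \<omega>))\<^sup>2)"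
    and zero_mean: "\<And>i. (\<integral>\<omega>. err i \<omega> \<partial>M) = 0"
    and error_free: "\<And>i j. j \<notin> J \<Longrightarrow> (\<integral>\<omega>. (err i \<omega> $ j)\<^sup>2 \<partial>M) = 0"
    and sigma2_pos: "\<sigma>\<^sup>2 > 0"
    and cov: "\<And>i. cov_matrix M (\<lambda>\<omega>. rows_at \<iota> (err i \<omega>)) = \<sigma>\<^sup>2 *\<^sub>R \<Sigma> i"
    and lambda_min: "\<exists>\<kappa>>0. \<forall>i. lambda_min (\<Sigma> i) \<ge> \<kappa>\<^sup>2"
    and rank_Z0J: "rank (rows_at \<iota> (Zmat X0)) = CARD('d)"
    and moments_2r: "\<exists>r::real. r \<ge> 2 \<and>
      r > real CARD('d) * (real (card J) - (real CARD('d) + 1) / 2) \<and>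
      (SUP i. SUP j\<in>J. \<integral>\<^sup>+\<omega>. ennreal (\<bar>err i \<omega> $ j\<bar> powr (2 * r)) \<partial>M) < \<infinity>"
    and moments_delta: "\<exists>\<delta>::real. \<delta> > 0 \<and>
      (SUP i. SUP j\<in>J. \<integral>\<^sup>+\<omega>. ennreal (\<bar>err i \<omega> $ j\<bar> powr (4 + 2 * \<delta>)) \<partial>M) < \<infinity> \<and>
      (\<lambda>m. 1 / real m powr (1 + \<delta> / 2) * (\<Sum>i<m. norm (a0 i) powr (2 + \<delta>))) \<longlonglongrightarrow> 0"
    and V_A_lim: "(\<lambda>m. sample_mean m (\<lambda>i. outer (a0 i) (a0 i))) \<longlonglongrightarrow> V_A"
    and V_A_nonsingular: "invertible V_A"
    and \<Sigma>_lim: "\<Sigma> \<longlonglongrightarrow> \<Sigma>_inf"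
    and third_moments: "\<And>i p q r. p \<in> J \<Longrightarrow> q \<in> J \<Longrightarrow> r \<in> J \<Longrightarrow>
      (\<integral>\<omega>. err i \<omega> $ p * err i \<omega> $ q * err i \<omega> $ r \<partial>M) = 0"
    and fourth_moments: "\<And>p q r u. p \<in> J \<Longrightarrow> q \<in> J \<Longrightarrow> r \<in> J \<Longrightarrow> u \<in> J \<Longrightarrow>
      (\<lambda>m. sample_mean m (\<lambda>i. \<integral>\<omega>. err i \<omega> $ p * err i \<omega> $ q * err i \<omega> $ r * err i \<omega> $ u \<partial>M))
        \<longlonglongrightarrow> \<mu>4 p q r u"
    \<comment> \<open>the estimators; \<open>sigma2_hat\<close> and \<open>VA_hat\<close> are arbitrary where \<open>Xhat\<close> is infinite\<close>
    and Xhat: "\<And>m. ewtls_estimator \<iota> \<Sigma> m (Xhat m)"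
    and sigma2_hat_rv: "\<And>m. sigma2_hat m \<in> borel_measurable M"
    and VA_hat_rv: "\<And>m. VA_hat m \<in> borel_measurable M"
    and sigma2_hat: "\<And>m \<omega> X. \<omega> \<in> space M \<Longrightarrow>
      Xhat m (data_matrix m (observation X0 a0 err) \<omega>) = Some X \<Longrightarrow>
      sigma2_hat m \<omega> =
        sigma2_formula m (data_matrix m (observation X0 a0 err) \<omega>) (S_bar M \<sigma> err m) X"
    and VA_hat: "\<And>m \<omega> X. \<omega> \<in> space M \<Longrightarrow>
      Xhat m (data_matrix m (observation X0 a0 err) \<omega>) = Some X \<Longrightarrow>
      VA_hat m \<omega> =
        VA_formula m (data_matrix m (observation X0 a0 err) \<omega>) (S_bar M \<sigma> err m) X"
  shows "tendsto_in_probability M sigma2_hat (\<sigma>\<^sup>2) \<and>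
    tendsto_in_probability M VA_hat V_A"
proof -
  interpret prob_space M by (rule prob)
  have \<iota>: "inj \<iota>" and J_eq: "J = range \<iota>"
    using J by (auto simp: bij_betw_def)
  obtain \<kappa> where \<kappa>: "\<kappa> > 0" "\<And>i. lambda_min (\<Sigma> i) \<ge> \<kappa>\<^sup>2" using lambda_min by blast
  have rv: "err i \<in> borel_measurable M" for i
    using indep unfolding indep_vars_def by blast
  have rvc [measurable]: "(\<lambda>\<omega>. err i \<omega> $ p) \<in> borel_measurable M" for i p
    by (rule measurable_compose[OF rv borel_measurable_vec_nth])
  \<comment> \<open>A zero Bochner integral means a zero mean only for an integrable function.\<close>
  have err_int: "integrable M (err i)" for i
  proof (rule Bochner_Integration.integrable_bound)
    show "integrable M (\<lambda>\<omega>. 1 + (norm (err i \<omega>))\<^sup>2)" using second_moments[of i] by simp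
    have "norm (err i \<omega>) \<le> norm (1 + (norm (err i \<omega>))\<^sup>2)" for \<omega>
    proof -
      have "2 * norm (err i \<omega>) \<le> (norm (err i \<omega>))\<^sup>2 + 1"
        using sum_squares_bound[of "norm (err i \<omega>)" 1] by simp
      then have "norm (err i \<omega>) \<le> 1 + (norm (err i \<omega>))\<^sup>2" using norm_ge_zero[of "err i \<omega>"] by linarith
      then show ?thesis by simp
    qed
    then show "AE \<omega> in M. norm (err i \<omega>) \<le> norm (1 + (norm (err i \<omega>))\<^sup>2)" by simp
  qed (rule rv)
  have mean0: "expectation (\<lambda>\<omega>. err i \<omega> $ p) = 0" for i p
    using integral_bounded_linear[OF bounded_linear_vec_nth[of p] err_int[of i]] zero_mean[of i] by simp
  have sq_int: "integrable M (\<lambda>\<omega>. (err i \<omega> $ p)\<^sup>2)" for i p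
  proof (rule Bochner_Integration.integrable_bound[OF second_moments[of i]])
    have "norm ((err i \<omega> $ p)\<^sup>2) \<le> norm ((norm (err i \<omega>))\<^sup>2)" for \<omega>
      using component_le_norm_cart[of "err i \<omega>" p] by (simp add: abs_le_square_iff[symmetric])
    then show "AE \<omega> in M. norm ((err i \<omega> $ p)\<^sup>2) \<le> norm ((norm (err i \<omega>))\<^sup>2)" by simp
  qed measurable
  have err0: "AE \<omega> in M. err i \<omega> $ p = 0" if "p \<notin> J" for i p
    using integral_nonneg_eq_0_iff_AE[OF sq_int[of i p]] error_free[OF that, of i] by simp
  obtain r :: real where r: "r \<ge> 2"
    and r_fin: "(SUP i. SUP j\<in>J. \<integral>\<^sup>+\<omega>. ennreal (\<bar>err i \<omega> $ j\<bar> powr (2 * r)) \<partial>M) < \<infinity>"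
    using moments_2r by blast
  define B where "B = enn2real (SUP i. SUP j\<in>J. \<integral>\<^sup>+\<omega>. ennreal (\<bar>err i \<omega> $ j\<bar> powr (2 * r)) \<partial>M)"
  have B0: "B \<ge> 0" by (simp add: B_def)
  \<comment> \<open>Components outside \<open>J\<close> vanish almost surely, so the bound holds for all components.\<close>
  have B: "(\<integral>\<^sup>+\<omega>. ennreal (\<bar>err i \<omega> $ j\<bar> powr (2 * r)) \<partial>M) \<le> ennreal B" for i j
  proof (cases "j \<in> J")
    case True
    then have "(\<integral>\<^sup>+\<omega>. ennreal (\<bar>err i \<omega> $ j\<bar> powr (2 * r)) \<partial>M)
        \<le> (SUP i. SUP j\<in>J. \<integral>\<^sup>+\<omega>. ennreal (\<bar>err i \<omega> $ j\<bar> powr (2 * r)) \<partial>M)"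
      by (intro SUP_upper2[of i] SUP_upper2[of j]) auto
    then show ?thesis using r_fin by (simp add: B_def)
  next
    case False
    have "(\<integral>\<^sup>+\<omega>. ennreal (\<bar>err i \<omega> $ j\<bar> powr (2 * r)) \<partial>M) = (\<integral>\<^sup>+\<omega>. 0 \<partial>M)"
      by (rule nn_integral_cong_AE) (use err0[OF False, of i] in eventually_elim, simp)
    then show ?thesis by simp
  qed
  note fourth = fourth_moment_le[OF rvc r B0 B]
  \<comment> \<open>The covariance of the full error vector is that of its \<open>J\<close>-part, padded with zeros.\<close>
  define E where "E i = transpose (selection \<iota>) ** \<Sigma> i ** selection \<iota>" for i
  have cov_entry: "expectation (\<lambda>\<omega>. err i \<omega> $ p * err i \<omega> $ q) = \<sigma>\<^sup>2 * E i $ p $ q" for i p q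
  proof (cases "p \<in> range \<iota> \<and> q \<in> range \<iota>")
    case True
    then obtain j k where jk: "p = \<iota> j" "q = \<iota> k" by blast
    have "cov_matrix M (\<lambda>\<omega>. rows_at \<iota> (err i \<omega>)) $ j $ k = \<sigma>\<^sup>2 * \<Sigma> i $ j $ k"
      using cov[of i] by simp
    then show ?thesis
      by (simp add: cov_matrix_def rows_at_def mean0 jk E_def selection_congruence_entry[OF \<iota>])
  next
    case False
    have "AE \<omega> in M. err i \<omega> $ p * err i \<omega> $ q = 0"
    proof (cases "p \<in> range \<iota>")
      case True
      then have "q \<notin> J" using False by (simp add: J_eq)
      from err0[OF this, of i] show ?thesis by eventually_elim simp
    next
      case False
      then have "p \<notin> J" by (simp add: J_eq)
      from err0[OF this, of i] show ?thesis by eventually_elim simp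
    qed
    then have "expectation (\<lambda>\<omega>. err i \<omega> $ p * err i \<omega> $ q) = 0"
      by (rule integral_eq_zero_AE)
    then show ?thesis
      using False by (simp add: E_def selection_congruence_entry_0)
  qed
  have \<Sigma>_sym: "transpose (\<Sigma> i) = \<Sigma> i" for i
  proof -
    have "\<sigma>\<^sup>2 *\<^sub>R transpose (\<Sigma> i) = \<sigma>\<^sup>2 *\<^sub>R \<Sigma> i"
      unfolding transpose_scaleR[symmetric] cov[symmetric]
      by (simp add: cov_matrix_def transpose_def vec_eq_iff mult.commute)
    then show ?thesis using sigma2_pos by simp
  qed
  have \<Sigma>_low: "\<kappa>\<^sup>2 * (norm x)\<^sup>2 \<le> x \<bullet> (\<Sigma> i *v x)" for i x
    using lambda_min_le_quadratic_form[OF \<Sigma>_sym, of i x] mult_right_mono[OF \<kappa>(2)[of i], of "(norm x)\<^sup>2"]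
    by simp
  have \<Sigma>_pd: "pos_def (\<Sigma> i)" for i
    by (rule pos_defI_lower_bound[OF \<Sigma>_sym _ \<Sigma>_low]) (use \<kappa>(1) in simp)
  have \<Sigma>_inf_pd: "pos_def \<Sigma>_inf"
  proof (rule pos_defI_lower_bound[of _ "\<kappa>\<^sup>2"])
    have "\<Sigma> \<longlonglongrightarrow> transpose \<Sigma>_inf"
      using tendsto_transpose[OF \<Sigma>_lim] unfolding \<Sigma>_sym .
    then show "transpose \<Sigma>_inf = \<Sigma>_inf" using \<Sigma>_lim by (rule LIMSEQ_unique)
    show "\<kappa>\<^sup>2 * (norm x)\<^sup>2 \<le> x \<bullet> (\<Sigma>_inf *v x)" for x
      by (rule LIMSEQ_le_const[of "\<lambda>i. x \<bullet> (\<Sigma> i *v x)"])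
         (auto intro!: tendsto_inner tendsto_matrix_vector_mult \<Sigma>_lim \<Sigma>_low)
  qed (use \<kappa>(1) in simp)
  have V_pd: "pos_def V_A"
    by (rule limit_second_moment_pos_def[OF V_A_lim V_A_nonsingular])
  interpret L: ewtls_limit \<iota> X0 V_A \<Sigma>_inf "\<sigma>\<^sup>2"
    by unfold_locales (fact \<iota> V_pd \<Sigma>_inf_pd sigma2_pos rank_Z0J)+

  obtain w_low w_up where w_lim: "w_low \<longlonglongrightarrow> 1" "w_up \<longlonglongrightarrow> 1"
    and weights: "L.comparison_weights \<Sigma> w_low w_up"
    by (rule L.comparison_weights_exist[OF \<Sigma>_pd \<Sigma>_lim])
  \<comment> \<open>The lower and upper weights serve the optimisation problem, the unit weights the two formulas
    for the estimates; one index makes the three moment matrices a single family.\<close>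
  define w where "w k = (if k = 0 then w_low else if k = 1 then w_up else (\<lambda>_. 1))" for k :: nat
  have w_lim: "w k \<longlonglongrightarrow> 1" for k
    using w_lim by (simp add: w_def)

  define c where "c = observation X0 a0 err"
  define N where "N = (regression_map X0 :: real^('n + 'd)^'n)"
  have c_eq: "c i \<omega> = transpose N *v a0 i + err i \<omega>" for i \<omega>
    by (simp add: c_def observation_def N_def transpose_regression_map_mult)
  have E_lim: "E \<longlonglongrightarrow> L.error_covariance"
    unfolding E_def L.error_covariance_def by (intro tendsto_matrix_mult tendsto_const \<Sigma>_lim)
  have N_lim: "(\<lambda>m. sample_mean m (\<lambda>i. outer (transpose N *v a0 i) (transpose N *v a0 i)))
      \<longlonglongrightarrow> transpose N ** V_A ** N"
    unfolding sample_mean_outer_congruence transpose_transpose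
    by (intro tendsto_matrix_mult tendsto_const V_A_lim)
  have wlln: "tendsto_in_probability M (\<lambda>m \<omega>. weighted_second_moment (w k) m (\<lambda>i. c i \<omega>)) L.limit_moment" for k
    unfolding c_eq L.limit_moment_def N_def[symmetric]
  proof (rule weighted_second_moment_tendsto_in_probability[OF indep _ _ mean0 _ N_lim w_lim])
    show "integrable M (\<lambda>\<omega>. (err i \<omega> $ p)^4)" for i p using fourth by blast
    show "expectation (\<lambda>\<omega>. (err i \<omega> $ p)^4) \<le> 1 + B" for i p using fourth by blast
    show "(\<lambda>i. expectation (\<lambda>\<omega>. err i \<omega> $ p * err i \<omega> $ q))
        \<longlonglongrightarrow> (\<sigma>\<^sup>2 *\<^sub>R L.error_covariance) $ p $ q" for p q
      unfolding cov_entry vector_scaleR_component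
      using tendsto_mult[OF tendsto_const tendsto_vec_nth[OF tendsto_vec_nth[OF E_lim]], of "\<sigma>\<^sup>2" p q]
      by simp
  qed
  have S_bar: "S_bar M \<sigma> err m = sample_mean m E" for m
  proof -
    have "(1 / \<sigma>\<^sup>2) *\<^sub>R cov_matrix M (err i) = E i" for i
      using sigma2_pos by (simp add: cov_matrix_def vec_eq_iff mean0 cov_entry)
    then show ?thesis by (simp add: S_bar_def)
  qed
  have S_lim: "(\<lambda>m. S_bar M \<sigma> err m) \<longlonglongrightarrow> L.error_covariance"
    unfolding S_bar by (rule sample_mean_of_convergent[OF E_lim])
  have wsm_data: "weighted_second_moment u m (data_matrix m c \<omega>) = weighted_second_moment u m (\<lambda>i. c i \<omega>)"
    for u m \<omega>
    by (simp add: weighted_second_moment_def sample_mean_def data_matrix_def)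

  have main: "\<exists>h>0. \<forall>\<^sub>F m in sequentially. \<forall>\<omega>\<in>space M.
      (\<forall>k\<in>{0, 1, 2}. dist (weighted_second_moment (w k) m (\<lambda>i. c i \<omega>)) L.limit_moment \<le> h) \<longrightarrow>
      dist (sigma2_hat m \<omega>) (\<sigma>\<^sup>2) \<le> \<epsilon> \<and> dist (VA_hat m \<omega>) V_A \<le> \<epsilon>" if \<epsilon>: "\<epsilon> > 0" for \<epsilon>
  proof -
    obtain h0 where h0: "h0 > 0"
      "\<And>m C E X. norm (weighted_second_moment (\<lambda>_. 1) m C - L.limit_moment) \<le> h0 \<Longrightarrow>
        norm (E - L.error_covariance) \<le> h0 \<Longrightarrow> norm (X - X0) \<le> h0 \<Longrightarrow>
        dist (sigma2_formula m C E X) (\<sigma>\<^sup>2) < \<epsilon> \<and> dist (VA_formula m C E X) V_A < \<epsilon>"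
      using L.formulas_near[OF \<epsilon>] by blast
    obtain h1 where h1: "h1 > 0"
      and near: "\<And>m C \<Sigma> w w'. m > 0 \<Longrightarrow> L.comparison_weights \<Sigma> w w' \<Longrightarrow>
      norm (weighted_second_moment w m C - L.limit_moment) \<le> h1 \<Longrightarrow>
      norm (weighted_second_moment w' m C - L.limit_moment) \<le> h1 \<Longrightarrow>
      (\<exists>X. ewtls_solution \<iota> \<Sigma> m C X) \<and>
      (\<forall>X. ewtls_solution \<iota> \<Sigma> m C X \<longrightarrow> norm (X - X0) < h0)"
      using L.ewtls_solution_near[OF h0(1)] by blast
    define h where "h = min h0 h1"
    have h: "h > 0" "h \<le> h0" "h \<le> h1" using h0(1) h1 by (auto simp: h_def)
    have "\<forall>\<^sub>F m in sequentially. dist (S_bar M \<sigma> err m) L.error_covariance < h0"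
      by (rule tendstoD[OF S_lim h0(1)])
    then have "\<forall>\<^sub>F m in sequentially. \<forall>\<omega>\<in>space M.
      (\<forall>k\<in>{0, 1, 2}. dist (weighted_second_moment (w k) m (\<lambda>i. c i \<omega>)) L.limit_moment \<le> h) \<longrightarrow>
      dist (sigma2_hat m \<omega>) (\<sigma>\<^sup>2) \<le> \<epsilon> \<and> dist (VA_hat m \<omega>) V_A \<le> \<epsilon>"
      using eventually_gt_at_top[of 0]
    proof eventually_elim
      case (elim m)
      show ?case
      proof (intro ballI impI)
        fix \<omega> assume \<omega>: "\<omega> \<in> space M"
          and close: "\<forall>k\<in>{0, 1, 2}. dist (weighted_second_moment (w k) m (\<lambda>i. c i \<omega>)) L.limit_moment \<le> h"
        let ?C = "data_matrix m c \<omega>"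
        have W: "norm (weighted_second_moment (w k) m ?C - L.limit_moment) \<le> h" if "k \<in> {0, 1, 2}" for k
          unfolding wsm_data using bspec[OF close that] by (simp add: dist_norm)
        have W0: "norm (weighted_second_moment (w 0) m ?C - L.limit_moment) \<le> h1"
          and W1: "norm (weighted_second_moment (w 1) m ?C - L.limit_moment) \<le> h1"
          using W[of 0] W[of 1] h(3) by auto
        have "w 2 = (\<lambda>_. 1)" by (simp add: w_def fun_eq_iff)
        then have W2: "norm (weighted_second_moment (\<lambda>_. 1) m ?C - L.limit_moment) \<le> h0"
          using W[of 2] h(2) by simp
        have sol: "\<exists>X. ewtls_solution \<iota> \<Sigma> m ?C X"
          "\<And>X. ewtls_solution \<iota> \<Sigma> m ?C X \<Longrightarrow> norm (X - X0) < h0"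
          using near[OF elim(2) weights] W0 W1 by (auto simp: w_def)
        have "?C \<in> space (\<Pi>\<^sub>M i\<in>{..<m}. (borel :: (real^('n + 'd)) measure))"
          by (simp add: space_PiM data_matrix_def)
        then have est: "case Xhat m ?C of Some X \<Rightarrow> ewtls_solution \<iota> \<Sigma> m ?C X
            | None \<Rightarrow> \<not> (\<exists>X. ewtls_solution \<iota> \<Sigma> m ?C X)"
          using Xhat[of m] unfolding ewtls_estimator_def by blast
        \<comment> \<open>A solution exists on this event, so the estimator is finite.\<close>
        with sol(1) obtain X where X: "Xhat m ?C = Some X" by (cases "Xhat m ?C") auto
        then have "norm (X - X0) \<le> h0" using est sol(2)[of X] by simp
        moreover have "norm (S_bar M \<sigma> err m - L.error_covariance) \<le> h0"
          using elim(1) by (simp add: dist_norm)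
        ultimately have "dist (sigma2_formula m ?C (S_bar M \<sigma> err m) X) (\<sigma>\<^sup>2) < \<epsilon> \<and>
            dist (VA_formula m ?C (S_bar M \<sigma> err m) X) V_A < \<epsilon>"
          using h0(2)[OF W2] by blast
        then show "dist (sigma2_hat m \<omega>) (\<sigma>\<^sup>2) \<le> \<epsilon> \<and> dist (VA_hat m \<omega>) V_A \<le> \<epsilon>"
          using sigma2_hat[OF \<omega> X[unfolded c_def]] VA_hat[OF \<omega> X[unfolded c_def]]
          by (simp add: c_def)
      qed
    qed
    then show ?thesis using h(1) by blast
  qed
  have meas: "{\<omega> \<in> space M. h < dist (weighted_second_moment (w k) m (\<lambda>i. c i \<omega>)) L.limit_moment} \<in> sets M"
    for k m h
  proof -
    have "(\<lambda>\<omega>. (weighted_second_moment (w k) m (\<lambda>i. c i \<omega>) - L.limit_moment) $ p $ q) \<in> borel_measurable M" for p q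
      unfolding weighted_second_moment_def sample_mean_def outer_def c_eq
      by (simp, measurable)
    then have "(\<lambda>\<omega>. norm (weighted_second_moment (w k) m (\<lambda>i. c i \<omega>) - L.limit_moment)) \<in> borel_measurable M"
      unfolding norm_vec_def L2_set_def real_norm_def by measurable
    then show ?thesis unfolding dist_norm by measurable
  qed
  show ?thesis
  proof
    show "tendsto_in_probability M sigma2_hat (\<sigma>\<^sup>2)"
    proof (rule tendsto_in_probability_controlled[OF _ wlln meas])
      fix \<epsilon> :: real assume "\<epsilon> > 0"
      from main[OF this] obtain h where "h > 0" and "\<forall>\<^sub>F m in sequentially. \<forall>\<omega>\<in>space M.
        (\<forall>k\<in>{0, 1, 2}. dist (weighted_second_moment (w k) m (\<lambda>i. c i \<omega>)) L.limit_moment \<le> h) \<longrightarrow>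
        dist (sigma2_hat m \<omega>) (\<sigma>\<^sup>2) \<le> \<epsilon> \<and> dist (VA_hat m \<omega>) V_A \<le> \<epsilon>" by blast
      then show "\<exists>h>0. \<forall>\<^sub>F m in sequentially. \<forall>\<omega>\<in>space M.
        (\<forall>k\<in>{0, 1, 2}. dist (weighted_second_moment (w k) m (\<lambda>i. c i \<omega>)) L.limit_moment \<le> h) \<longrightarrow>
        dist (sigma2_hat m \<omega>) (\<sigma>\<^sup>2) \<le> \<epsilon>"
        by (intro exI[of _ h] conjI) (auto elim!: eventually_mono)
    qed simp
    show "tendsto_in_probability M VA_hat V_A"
    proof (rule tendsto_in_probability_controlled[OF _ wlln meas])
      fix \<epsilon> :: real assume "\<epsilon> > 0"
      from main[OF this] obtain h where "h > 0" and "\<forall>\<^sub>F m in sequentially. \<forall>\<omega>\<in>space M.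
        (\<forall>k\<in>{0, 1, 2}. dist (weighted_second_moment (w k) m (\<lambda>i. c i \<omega>)) L.limit_moment \<le> h) \<longrightarrow>
        dist (sigma2_hat m \<omega>) (\<sigma>\<^sup>2) \<le> \<epsilon> \<and> dist (VA_hat m \<omega>) V_A \<le> \<epsilon>" by blast
      then show "\<exists>h>0. \<forall>\<^sub>F m in sequentially. \<forall>\<omega>\<in>space M.
        (\<forall>k\<in>{0, 1, 2}. dist (weighted_second_moment (w k) m (\<lambda>i. c i \<omega>)) L.limit_moment \<le> h) \<longrightarrow>
        dist (VA_hat m \<omega>) V_A \<le> \<epsilon>"
        by (intro exI[of _ h] conjI) (auto elim!: eventually_mono)
    qed simp
  qed
qed

end
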